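(* Let $\Bbbk$ be a field, let $R=\Bbbk[x_1,\ldots,x_n]$ with its usual $\mathbb{Z}^n$-grading, let $N\subseteq R$ be a monomial ideal, and suppose that $\mathcal{F}$ is a ($\mathbb{Z}^n$-graded free) resolution of $N$ (in the form of a resolution of $R/N$ with $\mathcal F_0=R$). Let $X$ be a non-empty finite-dimensional regular CW-complex whose vertices are labeled by the minimal monomial generators of $N$. Then the resolution $\mathcal{F}$ is supported on the regular CW-complex $X$ if and only if $\mathcal{F}$ is a poset resolution supported on the CW-poset $P_X$.
   Context: A CW-complex is regular if its attaching maps (characteristic maps of the closed cells) are homeomorphisms onto their images. The face poset $P_X$ is the set of closed cells of $X$ ordered by inclusion, together with the empty cell $\hat 0=\varnothing$ as least element; it is ranked by $\mathrm{rk}(\sigma)=\dim(\sigma)+1$. A CW-poset is a poset with more than one element, with a least element $\hat 0$, such that the order complex of each open interval $(\hat 0,x)$, $x\ne\hat 0$, is homeomorphic to a sphere; $P_X$ is a CW-poset. Multigrading. If $m_1,\dots,m_r$ are the minimal monomial generators of $N$ and the vertices of $X$ are $1,\ldots,r$, each cell $\sigma\neq\varnothing$ with vertex set $V_\sigma$ is labeled by $m_\sigma=\mathrm{lcm}(m_j: j\in V_\sigma)$, and $m_\varnothing=1$. Let $\eta:P_X\to\mathbb{Z}^n$ send $\sigma$ to the exponent vector of $m_\sigma$. Supported on $X$. Let $\mathcal{F}_X$ be the complex of $\mathbb{Z}^n$-graded free $R$-modules with one rank-one free summand $R\sigma$, generated in multidegree $\eta(\sigma)$, for each cell $\sigma$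 of $X$ (including $\varnothing$), placed in homological degree $\dim(\sigma)+1$, and with differential $$\partial(\sigma)=\sum_{\tau\subset\sigma,\ \dim\sigma=\dim\tau+1}c_{\sigma,\tau}\frac{m_\sigma}{m_\tau}\,\tau,$$ where $c_{\sigma,\tau}\in\{-1,0,1\}$ are the incidence numbers of the cellular chain complex of $X$ over $\Bbbk$ (augmented by the empty cell) for chosen orientations of the cells. The resolution $\mathcal{F}$ is supported on $X$ if it is isomorphic to $\mathcal{F}_X$ as a complex of $\mathbb{Z}^n$-graded $R$-modules. The sequence $\mathcal{D}(P_X)$. All homology is reduced simplicial homology over $\Bbbk$, with $\widetilde H_{-1}(\{\varnothing\},\Bbbk)\cong\Bbbk$ for the complex $\{\varnothing\}$ whose only face is empty. For $\alpha\neq\hat0$ let $\Delta_\alpha$ and $\mathbf{D}_\alpha$ be the order complexes of $(\hat 0,\alpha)$ and $(\hat 0,\alpha]$; write $\lambda\lessdot\alpha$ if $\alpha$ covers $\lambda$. Put $\mathcal{D}_0=\widetilde H_{-1}(\{\varnothing\},\Bbbk)$, and for $i\ge1$ put $\mathcal{D}_i=\bigoplus_{\alpha\neq\hat 0}\mathcal{D}_{i,\alpha}$ with $\mathcal{D}_{i,\alpha}=\widetilde H_{i-2}(\Delta_\alpha,\Bbbk)$ (nonzero only if $\mathrm{rk}(\alpha)=i$). For $i\ge 2$ and $\hat 0\ne\lambda\lessdot\alpha$, let $\Delta_{\alpha,\lambda}=\mathbf{D}_\lambda\cap\bigcup_{\beta\lessdot\alpha,\beta\neq\lambda}\mathbf{D}_\beta\subseteq\Delta_\lambda$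 and let $\varphi_i^{\alpha,\lambda}:\mathcal{D}_{i,\alpha}\to\mathcal{D}_{i-1,\lambda}$ be the composite of the Mayer–Vietoris connecting homomorphism $\widetilde H_{i-2}(\Delta_\alpha,\Bbbk)\to\widetilde H_{i-3}(\Delta_{\alpha,\lambda},\Bbbk)$ of the triple $\bigl(\mathbf{D}_\lambda,\bigcup_{\beta\lessdot\alpha,\beta\ne\lambda}\mathbf{D}_\beta,\Delta_\alpha\bigr)$ (sending the class of a cycle $a+b$, with $a$ a chain in $\mathbf{D}_\lambda$ and $b$ a chain in the other subcomplex, to the class of the boundary of $a$) with the map $\widetilde H_{i-3}(\Delta_{\alpha,\lambda},\Bbbk)\to\widetilde H_{i-3}(\Delta_\lambda,\Bbbk)$ induced by inclusion. Set $\varphi_i|_{\mathcal{D}_{i,\alpha}}=\sum_{\lambda\lessdot\alpha}\varphi_i^{\alpha,\lambda}$ for $i\ge2$, and let $\varphi_1|_{\mathcal{D}_{1,\alpha}}$ be the identity of $\widetilde H_{-1}(\{\varnothing\},\Bbbk)$. Poset resolution supported on $P_X$. Let $\mathcal{F}(\eta)$ be the sequence of $\mathbb{Z}^n$-graded free $R$-modules with $\mathcal{F}_0=R\otimes_\Bbbk\mathcal{D}_0$, where $x^{\mathbf a}\otimes v$ has multidegree $\mathbf a$, and, for $i\ge1$, $\mathcal{F}_i=\bigoplus_{\lambda\neq\hat 0}R\otimes_\Bbbk\mathcal{D}_{i,\lambda}$, where $x^{\mathbf a}\otimes v$ with $v\in\mathcal{D}_{i,\lambda}$ has multidegree $\mathbf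 a+\eta(\lambda)$. Its maps are $\partial_i|_{R\otimes\mathcal{D}_{i,\alpha}}=\sum_{\lambda\lessdot\alpha}x^{\eta(\alpha)-\eta(\lambda)}\otimes\varphi_i^{\alpha,\lambda}$ for $i\ge2$ and $\partial_1|_{R\otimes\mathcal{D}_{1,\lambda}}=x^{\eta(\lambda)}\otimes\varphi_1|_{\mathcal{D}_{1,\lambda}}$. The resolution $\mathcal{F}$ is a poset resolution supported on $P_X$ if it is isomorphic to $\mathcal{F}(\eta)$ as a sequence of $\mathbb{Z}^n$-graded $R$-modules and maps. *)

theory Defs
  imports "HOL-Homology.Homology" "HOL-Algebra.Algebraic_Closure_Type" "HOL-Algebra.Ideal"
begin

section \<open>Graded modules over a polynomial ring\<close>

text \<open>The polynomial ring in the variables indexed by the finite type \<open>'n\<close>: finitely supported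
  functions on exponent vectors, with the convolution product of \<^theory>\<open>HOL-Library.Poly_Mapping\<close>.\<close>

type_synonym ('n, 'k) mpol = "(nat ^ 'n) \<Rightarrow>\<^sub>0 'k"

abbreviation mpol_ring :: "('n::finite, 'k::comm_ring_1) mpol ring" where
  "mpol_ring \<equiv> ring_of_type_algebra"

definition xpow :: "nat ^ 'n \<Rightarrow> ('n::finite, 'k::comm_ring_1) mpol" where
  "xpow a = Poly_Mapping.single a 1"

definition mdeg :: "nat ^ 'n \<Rightarrow> int ^ 'n" where
  "mdeg a = (\<chi> i. int (a $ i))"

definition monomial_ideal :: "('n::finite, 'k::comm_ring_1) mpol set \<Rightarrow> bool" where
  "monomial_ideal N \<longleftrightarrow> (\<exists>A. N = genideal mpol_ring (xpow ` A))"

text \<open>Generators are recorded by their exponent vectors.\<close>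

definition minimal_monomial_generators ::
    "('n::finite, 'k::comm_ring_1) mpol set \<Rightarrow> (nat ^ 'n) set \<Rightarrow> bool" where
  "minimal_monomial_generators N A \<longleftrightarrow>
     genideal mpol_ring (xpow ` A) = N \<and> (\<forall>B. B \<subset> A \<longrightarrow> genideal mpol_ring (xpow ` B) \<noteq> N)"

text \<open>The inherited record fields \<open>mult\<close> and \<open>one\<close> play no role in modules.\<close>

record ('r, 'm, 'd) gmodule = "('r, 'm) module" +
  hcomp :: "'d \<Rightarrow> 'm set"

definition graded_module :: "(('n::finite, 'k::field) mpol, 'm, int ^ 'n) gmodule \<Rightarrow> bool" where
  "graded_module M \<longleftrightarrow>
     Module.module mpol_ring M \<and>
     (\<forall>d. additive_subgroup (hcomp M d) M) \<and>
     (\<forall>a c d. \<forall>m\<in>hcomp M d. Poly_Mapping.single a c \<odot>\<^bsub>M\<^esub> m \<in> hcomp M (mdeg a + d)) \<and>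
     (\<forall>m\<in>carrier M. \<exists>!u. (\<forall>d. u d \<in> hcomp M d) \<and> finite {d. u d \<noteq> \<zero>\<^bsub>M\<^esub>} \<and>
        m = finsum M u {d. u d \<noteq> \<zero>\<^bsub>M\<^esub>})"

definition graded_free_module ::
    "(('n::finite, 'k::field) mpol, 'm, int ^ 'n) gmodule \<Rightarrow> bool" where
  "graded_free_module M \<longleftrightarrow> graded_module M \<and>
     (\<exists>B \<subseteq> (\<Union>d. hcomp M d). \<forall>m\<in>carrier M.
        \<exists>!c :: 'm \<Rightarrow>\<^sub>0 ('n, 'k) mpol. Poly_Mapping.keys c \<subseteq> B \<and>
          m = finsum M (\<lambda>b. Poly_Mapping.lookup c b \<odot>\<^bsub>M\<^esub> b) (Poly_Mapping.keys c))"

definition graded_hom ::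
    "('r, 'm, 'd) gmodule \<Rightarrow> ('r, 'l, 'd) gmodule \<Rightarrow> ('m \<Rightarrow> 'l) \<Rightarrow> bool" where
  "graded_hom M L f \<longleftrightarrow>
     f \<in> carrier M \<rightarrow> carrier L \<and>
     (\<forall>x\<in>carrier M. \<forall>y\<in>carrier M. f (x \<oplus>\<^bsub>M\<^esub> y) = f x \<oplus>\<^bsub>L\<^esub> f y) \<and>
     (\<forall>r. \<forall>x\<in>carrier M. f (r \<odot>\<^bsub>M\<^esub> x) = r \<odot>\<^bsub>L\<^esub> f x) \<and>
     (\<forall>d. f ` hcomp M d \<subseteq> hcomp L d)"

definition graded_iso ::
    "('r, 'm, 'd) gmodule \<Rightarrow> ('r, 'l, 'd) gmodule \<Rightarrow> ('m \<Rightarrow> 'l) \<Rightarrow> bool" where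
  "graded_iso M L f \<longleftrightarrow> graded_hom M L f \<and> bij_betw f (carrier M) (carrier L)"

text \<open>A sequence of graded modules is given by modules \<open>F i\<close> (\<open>i \<ge> 0\<close>) and maps
  \<open>d i\<close> from \<open>F i\<close> to \<open>F (i - 1)\<close> for \<open>i \<ge> 1\<close>; the value \<open>d 0\<close> is never used.\<close>

definition isomorphic_sequences ::
    "(nat \<Rightarrow> ('r, 'm, 'd) gmodule) \<Rightarrow> (nat \<Rightarrow> 'm \<Rightarrow> 'm) \<Rightarrow>
     (nat \<Rightarrow> ('r, 'l, 'd) gmodule) \<Rightarrow> (nat \<Rightarrow> 'l \<Rightarrow> 'l) \<Rightarrow> bool" where
  "isomorphic_sequences F d G e \<longleftrightarrow>
     (\<exists>f. (\<forall>i. graded_iso (F i) (G i) (f i)) \<and>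
          (\<forall>i\<ge>1. \<forall>x\<in>carrier (F i). f (i - 1) (d i x) = e i (f i x)))"

text \<open>The free module of rank one whose generator has degree \<open>mdeg s\<close>.\<close>

definition mpol_gmodule ::
    "nat ^ 'n \<Rightarrow> (('n::finite, 'k::field) mpol, ('n, 'k) mpol, int ^ 'n) gmodule" where
  "mpol_gmodule s =
     \<lparr>carrier = UNIV, monoid.mult = (*), one = 1, ring.zero = 0, add = (+), module.smult = (*),
      hcomp = (\<lambda>d. {p. \<forall>a\<in>Poly_Mapping.keys p. mdeg a + mdeg s = d})\<rparr>"

text \<open>A graded free resolution of \<open>R/N\<close> with \<open>F 0\<close> equal to \<open>R\<close>; since the modules \<open>F i\<close>
  live in one common type, this equality is an identification \<open>\<epsilon>\<close> of graded modules.\<close>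

definition graded_free_resolution ::
    "('n::finite, 'k::field) mpol set \<Rightarrow> (nat \<Rightarrow> (('n, 'k) mpol, 'm, int ^ 'n) gmodule) \<Rightarrow>
     (nat \<Rightarrow> 'm \<Rightarrow> 'm) \<Rightarrow> bool" where
  "graded_free_resolution N F d \<longleftrightarrow>
     (\<forall>i. graded_free_module (F i)) \<and>
     (\<forall>i\<ge>1. graded_hom (F i) (F (i - 1)) (d i)) \<and>
     (\<forall>i\<ge>1. {x \<in> carrier (F i). d i x = \<zero>\<^bsub>F (i - 1)\<^esub>} = d (i + 1) ` carrier (F (i + 1))) \<and>
     (\<exists>\<epsilon>. graded_iso (F 0) (mpol_gmodule 0) \<epsilon> \<and> \<epsilon> ` d 1 ` carrier (F 1) = N)"

definition gdirect_sum :: "'i set \<Rightarrow> ('i \<Rightarrow> ('r, 'm, 'd) gmodule) \<Rightarrow> ('r, 'i \<Rightarrow> 'm, 'd) gmodule" where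
  "gdirect_sum I M =
     (let C = {f \<in> (\<Pi>\<^sub>E i\<in>I. carrier (M i)). finite {i \<in> I. f i \<noteq> \<zero>\<^bsub>M i\<^esub>}} in
     \<lparr>carrier = C, monoid.mult = undefined, one = undefined,
      ring.zero = (\<lambda>i\<in>I. \<zero>\<^bsub>M i\<^esub>),
      add = (\<lambda>f g. \<lambda>i\<in>I. f i \<oplus>\<^bsub>M i\<^esub> g i),
      module.smult = (\<lambda>r f. \<lambda>i\<in>I. r \<odot>\<^bsub>M i\<^esub> f i),
      hcomp = (\<lambda>d. {f \<in> C. \<forall>i\<in>I. f i \<in> hcomp (M i) d})\<rparr>)"

text \<open>The tensor product \<open>R \<otimes> V\<close> over the field, for a vector space \<open>V\<close>. As the monomials are a
  basis of \<open>R\<close>, its elements are the finite sums of tensors \<open>x\<^sup>a \<otimes> v\<close>, stored as finitely supported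
  functions from exponent vectors to \<open>V\<close> (polynomials with coefficients in \<open>V\<close>). The tensor
  \<open>x\<^sup>a \<otimes> v\<close> has degree \<open>mdeg a + mdeg s\<close>.\<close>

definition mpol_tensor ::
    "nat ^ 'n \<Rightarrow> ('k, 'v) module \<Rightarrow> (('n::finite, 'k::field) mpol, nat ^ 'n \<Rightarrow> 'v, int ^ 'n) gmodule" where
  "mpol_tensor s V =
     (let C = {u. range u \<subseteq> carrier V \<and> finite {a. u a \<noteq> \<zero>\<^bsub>V\<^esub>}} in
     \<lparr>carrier = C, monoid.mult = undefined, one = undefined,
      ring.zero = (\<lambda>_. \<zero>\<^bsub>V\<^esub>),
      add = (\<lambda>u v a. u a \<oplus>\<^bsub>V\<^esub> v a),
      module.smult = (\<lambda>r u a. finsum V (\<lambda>b. Poly_Mapping.lookup r b \<odot>\<^bsub>V\<^esub> u (a - b))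
                 {b \<in> Poly_Mapping.keys r. b \<le> a}),
      hcomp = (\<lambda>d. {u \<in> C. \<forall>a. u a \<noteq> \<zero>\<^bsub>V\<^esub> \<longrightarrow> mdeg a + mdeg s = d})\<rparr>)"

text \<open>The map \<open>x\<^sup>m \<otimes> \<phi>\<close> into \<open>R \<otimes> W\<close>, sending \<open>x\<^sup>a \<otimes> v\<close> to \<open>x\<^sup>a\<^sup>+\<^sup>m \<otimes> \<phi> v\<close>.\<close>

definition xpow_tensor ::
    "('k, 'w) module \<Rightarrow> nat ^ 'n \<Rightarrow> ('v \<Rightarrow> 'w) \<Rightarrow> (nat ^ 'n \<Rightarrow> 'v) \<Rightarrow> (nat ^ 'n \<Rightarrow> 'w)" where
  "xpow_tensor W m \<phi> u = (\<lambda>a. if m \<le> a then \<phi> (u (a - m)) else \<zero>\<^bsub>W\<^esub>)"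


section \<open>Reduced simplicial homology of order complexes\<close>

definition order_complex :: "'p::order set \<Rightarrow> 'p set set" where
  "order_complex Q = {s. finite s \<and> s \<subseteq> Q \<and> Complete_Partial_Order.chain (\<le>) s}"

text \<open>A complex is a set of faces, each a finite chain of the ambient order; the order of its
  vertices fixes the signs. The empty face is a face of dimension \<open>-1\<close>, so the homology below is
  reduced. The complex \<open>{{}}\<close> has only the empty face.\<close>

definition simp_chains :: "int \<Rightarrow> 'p set set \<Rightarrow> ('p set \<Rightarrow>\<^sub>0 'k::field) set" where
  "simp_chains p K = {c. \<forall>s\<in>Poly_Mapping.keys c. s \<in> K \<and> int (card s) = p + 1}"

definition simp_boundary :: "('p::order set \<Rightarrow>\<^sub>0 'k::field) \<Rightarrow> ('p set \<Rightarrow>\<^sub>0 'k)" where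
  "simp_boundary c = (\<Sum>s\<in>Poly_Mapping.keys c. \<Sum>x\<in>s.
     Poly_Mapping.single (s - {x}) ((-1) ^ card {y \<in> s. y < x} * Poly_Mapping.lookup c s))"

definition simp_cycles :: "int \<Rightarrow> 'p::order set set \<Rightarrow> ('p set \<Rightarrow>\<^sub>0 'k::field) set" where
  "simp_cycles p K = {c \<in> simp_chains p K. simp_boundary c = 0}"

definition simp_boundaries :: "int \<Rightarrow> 'p::order set set \<Rightarrow> ('p set \<Rightarrow>\<^sub>0 'k::field) set" where
  "simp_boundaries p K = simp_boundary ` simp_chains (p + 1) K"

definition homology_class ::
    "int \<Rightarrow> 'p::order set set \<Rightarrow> ('p set \<Rightarrow>\<^sub>0 'k::field) \<Rightarrow> ('p set \<Rightarrow>\<^sub>0 'k) set" where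
  "homology_class p K z = {z + b | b. b \<in> simp_boundaries p K}"

definition reduced_homology ::
    "int \<Rightarrow> 'p::order set set \<Rightarrow> ('k::field, ('p set \<Rightarrow>\<^sub>0 'k) set) module" where
  "reduced_homology p K =
     \<lparr>carrier = homology_class p K ` simp_cycles p K, monoid.mult = undefined, one = undefined,
      ring.zero = simp_boundaries p K,
      add = (\<lambda>A B. {a + b | a b. a \<in> A \<and> b \<in> B}),
      module.smult = (\<lambda>r A. {Poly_Mapping.map ((*) r) a + b | a b. a \<in> A \<and> b \<in> simp_boundaries p K})\<rparr>"

text \<open>The Mayer--Vietoris connecting homomorphism from degree \<open>p\<close> of \<open>K \<union> L\<close> to degree \<open>p - 1\<close>
  of \<open>K \<inter> L\<close>.\<close>

definition mv_connecting ::
    "int \<Rightarrow> 'p::order set set \<Rightarrow> 'p set set \<Rightarrow> ('p set \<Rightarrow>\<^sub>0 'k::field) set \<Rightarrow> ('p set \<Rightarrow>\<^sub>0 'k) set" where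
  "mv_connecting p K L A =
     (THE C. \<exists>a\<in>simp_chains p K. \<exists>b\<in>simp_chains p L.
        a + b \<in> A \<and> C = homology_class (p - 1) (K \<inter> L) (simp_boundary a))"

text \<open>The map induced in degree \<open>p\<close> by the inclusion of a subcomplex into \<open>K\<close>.\<close>

definition inclusion_induced ::
    "int \<Rightarrow> 'p::order set set \<Rightarrow> ('p set \<Rightarrow>\<^sub>0 'k::field) set \<Rightarrow> ('p set \<Rightarrow>\<^sub>0 'k) set" where
  "inclusion_induced p K A = {z + b | z b. z \<in> A \<and> b \<in> simp_boundaries p K}"


section \<open>The sequence of a poset and its homogenization\<close>

definition covers_in :: "'p::order set \<Rightarrow> 'p \<Rightarrow> 'p \<Rightarrow> bool" where
  "covers_in P \<alpha> l \<longleftrightarrow> l \<in> P \<and> \<alpha> \<in> P \<and> l < \<alpha> \<and> \<not> (\<exists>\<mu>\<in>P. l < \<mu> \<and> \<mu> < \<alpha>)"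

text \<open>Posets are sets \<open>P\<close> in an ordered type whose bottom element is the least element of \<open>P\<close>.\<close>

definition Delta_open :: "'p::order_bot set \<Rightarrow> 'p \<Rightarrow> 'p set set" where
  "Delta_open P \<alpha> = order_complex {x \<in> P. bot < x \<and> x < \<alpha>}"

definition Delta_closed :: "'p::order_bot set \<Rightarrow> 'p \<Rightarrow> 'p set set" where
  "Delta_closed P \<alpha> = order_complex {x \<in> P. bot < x \<and> x \<le> \<alpha>}"

definition Delta_others :: "'p::order_bot set \<Rightarrow> 'p \<Rightarrow> 'p \<Rightarrow> 'p set set" where
  "Delta_others P \<alpha> l = (\<Union>\<beta>\<in>{\<beta>. covers_in P \<alpha> \<beta> \<and> \<beta> \<noteq> l}. Delta_closed P \<beta>)"

text \<open>The summands of the \<open>i\<close>-th term are indexed by the elements other than bottom if \<open>i \<ge> 1\<close>;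
  the term of index \<open>0\<close> is a single summand, indexed by bottom.\<close>

definition D_index :: "'p::order_bot set \<Rightarrow> nat \<Rightarrow> 'p set" where
  "D_index P i = (if i = 0 then {bot} else P - {bot})"

definition D_space :: "'p::order_bot set \<Rightarrow> nat \<Rightarrow> 'p \<Rightarrow> ('k::field, ('p set \<Rightarrow>\<^sub>0 'k) set) module" where
  "D_space P i \<alpha> =
     (if i = 0 then reduced_homology (-1) {{}} else reduced_homology (int i - 2) (Delta_open P \<alpha>))"

text \<open>For \<open>i = 1\<close> the map on the summand of \<open>\<alpha>\<close> is the identity of the homology of \<open>{{}}\<close> in
  degree \<open>-1\<close> when \<open>\<alpha>\<close> is an atom; for all other \<open>\<alpha>\<close> the summand is zero, and so is the map.\<close>

definition D_map ::
    "'p::order_bot set \<Rightarrow> nat \<Rightarrow> 'p \<Rightarrow> 'p \<Rightarrow> ('p set \<Rightarrow>\<^sub>0 'k::field) set \<Rightarrow> ('p set \<Rightarrow>\<^sub>0 'k) set" where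
  "D_map P i \<alpha> l A =
     (if i = 1 then (if Delta_open P \<alpha> = {{}} then A else ring.zero (D_space P 0 bot :: ('k, _) module))
      else inclusion_induced (int i - 3) (Delta_open P l)
             (mv_connecting (int i - 2) (Delta_closed P l) (Delta_others P \<alpha> l) A))"

definition poset_module ::
    "'p::order_bot set \<Rightarrow> ('p \<Rightarrow> nat ^ 'n) \<Rightarrow> nat \<Rightarrow>
     (('n::finite, 'k::field) mpol, 'p \<Rightarrow> nat ^ 'n \<Rightarrow> ('p set \<Rightarrow>\<^sub>0 'k) set, int ^ 'n) gmodule" where
  "poset_module P \<eta> i =
     gdirect_sum (D_index P i)
       (\<lambda>\<alpha>. mpol_tensor (if i = 0 then 0 else \<eta> \<alpha>) (D_space P i \<alpha>))"

definition poset_differential ::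
    "'p::order_bot set \<Rightarrow> ('p \<Rightarrow> nat ^ 'n) \<Rightarrow> nat \<Rightarrow>
     ('p \<Rightarrow> nat ^ 'n::finite \<Rightarrow> ('p set \<Rightarrow>\<^sub>0 'k::field) set) \<Rightarrow>
     ('p \<Rightarrow> nat ^ 'n \<Rightarrow> ('p set \<Rightarrow>\<^sub>0 'k) set)" where
  "poset_differential P \<eta> i f =
     (\<lambda>l\<in>D_index P (i - 1).
        finsum (mpol_tensor (if i = 1 then 0 else \<eta> l) (D_space P (i - 1) l) ::
            (('n, 'k) mpol, nat ^ 'n \<Rightarrow> ('p set \<Rightarrow>\<^sub>0 'k) set, int ^ 'n) gmodule)
          (\<lambda>\<alpha>. xpow_tensor (D_space P (i - 1) l) (if i = 1 then \<eta> \<alpha> else \<eta> \<alpha> - \<eta> l)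
                 (D_map P i \<alpha> l) (f \<alpha>))
          {\<alpha> \<in> D_index P i. (i = 1 \<or> covers_in P \<alpha> l) \<and> f \<alpha> \<noteq> (\<lambda>_. ring.zero (D_space P i \<alpha> :: ('k, _) module))})"


section \<open>Regular CW complexes and cellular incidence numbers\<close>

definition disc_interior :: "nat \<Rightarrow> (nat \<Rightarrow> real) set" where
  "disc_interior n = {x \<in> topspace (Euclidean_space n). (\<Sum>i<n. x i ^ 2) < 1}"

definition disc_boundary :: "nat \<Rightarrow> (nat \<Rightarrow> real) set" where
  "disc_boundary n = {x \<in> topspace (Euclidean_space n). (\<Sum>i<n. x i ^ 2) = 1}"

definition disc :: "nat \<Rightarrow> (nat \<Rightarrow> real) set" where
  "disc n = {x \<in> topspace (Euclidean_space n). (\<Sum>i<n. x i ^ 2) \<le> 1}"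

text \<open>Cells are represented by the closed cells, that is by the images of the characteristic
  maps. In a CW complex different open cells have different closures, so the closed cells index
  the cells faithfully.\<close>

record 'x cell_complex =
  cw_space :: "'x topology"
  cw_cells :: "'x set set"
  cw_dim :: "'x set \<Rightarrow> nat"
  cw_char :: "'x set \<Rightarrow> (nat \<Rightarrow> real) \<Rightarrow> 'x"

definition open_cell :: "'x cell_complex \<Rightarrow> 'x set \<Rightarrow> 'x set" where
  "open_cell K \<sigma> = cw_char K \<sigma> ` disc_interior (cw_dim K \<sigma>)"

definition cell_boundary :: "'x cell_complex \<Rightarrow> 'x set \<Rightarrow> 'x set" where
  "cell_boundary K \<sigma> = cw_char K \<sigma> ` disc_boundary (cw_dim K \<sigma>)"

definition cw_complex :: "'x cell_complex \<Rightarrow> bool" where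
  "cw_complex K \<longleftrightarrow>
     Hausdorff_space (cw_space K) \<and>
     (\<forall>\<sigma>\<in>cw_cells K.
        continuous_map (subtopology (Euclidean_space (cw_dim K \<sigma>)) (disc (cw_dim K \<sigma>)))
          (cw_space K) (cw_char K \<sigma>) \<and>
        cw_char K \<sigma> ` disc (cw_dim K \<sigma>) = \<sigma> \<and>
        homeomorphic_map (subtopology (Euclidean_space (cw_dim K \<sigma>)) (disc_interior (cw_dim K \<sigma>)))
          (subtopology (cw_space K) (open_cell K \<sigma>)) (cw_char K \<sigma>) \<and>
        (\<exists>T\<subseteq>cw_cells K. finite T \<and> (\<forall>\<tau>\<in>T. cw_dim K \<tau> < cw_dim K \<sigma>) \<and>
           cell_boundary K \<sigma> \<subseteq> (\<Union>\<tau>\<in>T. open_cell K \<tau>))) \<and>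
     (\<Union>\<sigma>\<in>cw_cells K. open_cell K \<sigma>) = topspace (cw_space K) \<and>
     (\<forall>\<sigma>\<in>cw_cells K. \<forall>\<tau>\<in>cw_cells K. \<sigma> \<noteq> \<tau> \<longrightarrow> open_cell K \<sigma> \<inter> open_cell K \<tau> = {}) \<and>
     (\<forall>A\<subseteq>topspace (cw_space K).
        (\<forall>\<sigma>\<in>cw_cells K. closedin (cw_space K) (A \<inter> \<sigma>)) \<longrightarrow> closedin (cw_space K) A)"

definition regular_cw_complex :: "'x cell_complex \<Rightarrow> bool" where
  "regular_cw_complex K \<longleftrightarrow> cw_complex K \<and>
     (\<forall>\<sigma>\<in>cw_cells K.
        homeomorphic_map (subtopology (Euclidean_space (cw_dim K \<sigma>)) (disc (cw_dim K \<sigma>)))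
          (subtopology (cw_space K) \<sigma>) (cw_char K \<sigma>))"

definition vertices :: "'x cell_complex \<Rightarrow> 'x set set" where
  "vertices K = {v \<in> cw_cells K. cw_dim K v = 0}"

text \<open>The face poset is ordered by inclusion, the order of the type \<open>'x set\<close>.\<close>

definition face_poset :: "'x cell_complex \<Rightarrow> 'x set set" where
  "face_poset K = insert {} (cw_cells K)"

definition cell_rank :: "'x cell_complex \<Rightarrow> 'x set \<Rightarrow> nat" where
  "cell_rank K \<sigma> = (if \<sigma> = {} then 0 else cw_dim K \<sigma> + 1)"

definition skeleton :: "'x cell_complex \<Rightarrow> int \<Rightarrow> 'x set" where
  "skeleton K d = \<Union>{\<sigma> \<in> cw_cells K. int (cw_dim K \<sigma>) \<le> d}"

definition cellular_chain_group :: "'x cell_complex \<Rightarrow> int \<Rightarrow> 'x chain set monoid" where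
  "cellular_chain_group K d =
     relative_homology_group d (subtopology (cw_space K) (skeleton K d)) (skeleton K (d - 1))"

text \<open>An orientation of a cell is a generator of the infinite cyclic homology group of the closed
  cell relative to its boundary.\<close>

definition orientation :: "'x cell_complex \<Rightarrow> ('x set \<Rightarrow> 'x chain set) \<Rightarrow> bool" where
  "orientation K \<omega> \<longleftrightarrow>
     (\<forall>\<sigma>\<in>cw_cells K.
        let H = relative_homology_group (int (cw_dim K \<sigma>)) (subtopology (cw_space K) \<sigma>) (cell_boundary K \<sigma>)
        in \<omega> \<sigma> \<in> carrier H \<and> generate H {\<omega> \<sigma>} = carrier H)"

definition cellular_generator ::
    "'x cell_complex \<Rightarrow> ('x set \<Rightarrow> 'x chain set) \<Rightarrow> 'x set \<Rightarrow> 'x chain set" where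
  "cellular_generator K \<omega> \<sigma> =
     (let d = int (cw_dim K \<sigma>) in
      hom_induced d (subtopology (cw_space K) \<sigma>) (cell_boundary K \<sigma>)
        (subtopology (cw_space K) (skeleton K d)) (skeleton K (d - 1)) id (\<omega> \<sigma>))"

text \<open>The coefficients of the augmented cellular boundary maps with respect to the generators
  given by \<open>\<omega>\<close>. The boundary of a cell of positive dimension is taken in the exact sequence of the
  triple of consecutive skeleta; on a vertex the boundary is the augmentation, which sends the class
  of a singular 0-chain to the sum of its coefficients.\<close>

definition incidence_numbers ::
    "'x cell_complex \<Rightarrow> ('x set \<Rightarrow> 'x chain set) \<Rightarrow> ('x set \<Rightarrow> 'x set \<Rightarrow> int) \<Rightarrow> bool" where
  "incidence_numbers K \<omega> c \<longleftrightarrow>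
     (\<forall>v\<in>vertices K. \<forall>z\<in>\<omega> v. (\<Sum>s\<in>Poly_Mapping.keys z. Poly_Mapping.lookup z s) = c v {}) \<and>
     (\<forall>\<sigma>\<in>cw_cells K - vertices K.
        let d = int (cw_dim K \<sigma>); C = cellular_chain_group K (d - 1) in
        hom_relboundary d (subtopology (cw_space K) (skeleton K d)) (skeleton K (d - 1)) (skeleton K (d - 2))
            (cellular_generator K \<omega> \<sigma>) =
        finprod C (\<lambda>\<tau>. cellular_generator K \<omega> \<tau> [^]\<^bsub>C\<^esub> c \<sigma> \<tau>)
          {\<tau> \<in> cw_cells K. \<tau> \<subset> \<sigma> \<and> cw_dim K \<sigma> = cw_dim K \<tau> + 1})"


section \<open>Resolutions supported on a CW complex and on its face poset\<close>

text \<open>The exponent vector of the least common multiple of the labels of the vertices of a cell; it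
  is zero for the empty cell.\<close>

definition cell_label :: "'x cell_complex \<Rightarrow> ('x set \<Rightarrow> nat ^ 'n) \<Rightarrow> 'x set \<Rightarrow> nat ^ 'n" where
  "cell_label K m \<sigma> = (\<chi> i. Max (insert 0 {m v $ i | v. v \<in> vertices K \<and> v \<subseteq> \<sigma>}))"

definition cells_of_rank :: "'x cell_complex \<Rightarrow> nat \<Rightarrow> 'x set set" where
  "cells_of_rank K i = {\<sigma> \<in> face_poset K. cell_rank K \<sigma> = i}"

definition cellular_module ::
    "'x cell_complex \<Rightarrow> ('x set \<Rightarrow> nat ^ 'n) \<Rightarrow> nat \<Rightarrow>
     (('n::finite, 'k::field) mpol, 'x set \<Rightarrow> ('n, 'k) mpol, int ^ 'n) gmodule" where
  "cellular_module K m i = gdirect_sum (cells_of_rank K i) (\<lambda>\<sigma>. mpol_gmodule (cell_label K m \<sigma>))"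

definition cellular_differential ::
    "'x cell_complex \<Rightarrow> ('x set \<Rightarrow> nat ^ 'n) \<Rightarrow> ('x set \<Rightarrow> 'x set \<Rightarrow> int) \<Rightarrow> nat \<Rightarrow>
     ('x set \<Rightarrow> ('n::finite, 'k::field) mpol) \<Rightarrow> ('x set \<Rightarrow> ('n, 'k) mpol)" where
  "cellular_differential K m c i f =
     (\<lambda>\<tau>\<in>cells_of_rank K (i - 1).
        \<Sum>\<sigma>\<in>{\<sigma> \<in> cells_of_rank K i. \<tau> \<subset> \<sigma> \<and> f \<sigma> \<noteq> 0}.
          f \<sigma> * Poly_Mapping.single (cell_label K m \<sigma> - cell_label K m \<tau>) (of_int (c \<sigma> \<tau>)))"

definition supported_on_cw_complex ::
    "'x cell_complex \<Rightarrow> ('x set \<Rightarrow> nat ^ 'n) \<Rightarrow>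
     (nat \<Rightarrow> (('n::finite, 'k::field) mpol, 'm, int ^ 'n) gmodule) \<Rightarrow> (nat \<Rightarrow> 'm \<Rightarrow> 'm) \<Rightarrow> bool" where
  "supported_on_cw_complex K m F d \<longleftrightarrow>
     (\<exists>\<omega> c. orientation K \<omega> \<and> incidence_numbers K \<omega> c \<and>
        isomorphic_sequences F d (cellular_module K m) (cellular_differential K m c))"

definition poset_resolution_on ::
    "'p::order_bot set \<Rightarrow> ('p \<Rightarrow> nat ^ 'n) \<Rightarrow>
     (nat \<Rightarrow> (('n::finite, 'k::field) mpol, 'm, int ^ 'n) gmodule) \<Rightarrow> (nat \<Rightarrow> 'm \<Rightarrow> 'm) \<Rightarrow> bool" where
  "poset_resolution_on P \<eta> F d \<longleftrightarrow>
     isomorphic_sequences F d (poset_module P \<eta>) (poset_differential P \<eta>)"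

end

theory Submission
  imports Defs
begin

text \<open>
  Both conditions compare \<open>F\<close> with a sequence of graded free modules that is built from the labelled
  complex, so the theorem follows from an isomorphism between the cellular sequence and the poset
  sequence that exists for every choice of orientations and incidence numbers, and from the
  existence of such a choice. Term by term, the cellular sequence has one copy of \<open>R\<close> for each cell
  \<open>\<sigma>\<close>, in the degree given by the rank of \<open>\<sigma>\<close>, and the poset sequence has the tensor product of \<open>R\<close>
  with the reduced homology of the order complex \<open>\<Delta>\<^sub>\<sigma>\<close> of the open interval below \<open>\<sigma>\<close>. It has to be
  shown that this homology is a line in the right degree and zero elsewhere, with generators that
  the Mayer--Vietoris maps transform by the incidence numbers.

  The generators are explicit. By recursion on the rank let \<open>E \<emptyset>\<close> be the empty simplex, let
  \<open>Z \<sigma>\<close> be the sum of the \<open>E \<tau>\<close> over the facets \<open>\<tau>\<close> of \<open>\<sigma>\<close>, weighted by the incidence numbers, and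
  let \<open>E \<sigma>\<close> be the cone with apex \<open>\<sigma>\<close> over \<open>Z \<sigma>\<close>, with a sign. These are the barycentric subdivisions
  of the cell \<open>\<sigma>\<close> and of its boundary; formally, \<open>E \<sigma>\<close> has boundary \<open>Z \<sigma>\<close>, and \<open>Z \<sigma>\<close> is a cycle
  because the cellular boundary squares to zero (\<open>boundary_E_Z\<close>). The chain \<open>Z \<sigma>\<close> is the sum of
  a multiple of \<open>E \<lambda>\<close>, which lies in the closed interval of a facet \<open>\<lambda>\<close>, and of a chain in the closed
  intervals of the other facets. So the connecting homomorphism takes the class of \<open>Z \<sigma>\<close> to the
  class of \<open>Z \<lambda>\<close> times the incidence number (\<open>D_map_zclass\<close>), and sending the basis element \<open>\<sigma>\<close> to
  the class of \<open>Z \<sigma>\<close> is the required isomorphism (\<open>cellular_iso_poset\<close>).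

  That \<open>Z \<sigma>\<close> spans the homology of \<open>\<Delta>\<^sub>\<sigma>\<close> (\<open>sphere_like_all\<close>) is deduced from the exactness of the
  augmented cellular chain complex of each closed cell over the field. Removing the vertices of
  \<open>\<Delta>\<^sub>\<sigma>\<close> one by one, from the highest rank down, turns every cycle into a combination of chains \<open>E \<tau>\<close>
  plus a boundary (\<open>relative_cycle_decomposition\<close>), and the coefficients of this combination form
  a cellular cycle.

  Exactness over the integers comes from topology. In a regular complex a closed cell is a union
  of open cells (\<open>cell_face_subset\<close>, a consequence of invariance of domain). Hence a closed cell can
  be built up by attaching one cell after the other, each step adding the relative homology of
  a disc modulo its boundary (\<open>attach_iso\<close>). The cellular chain groups are therefore free on the
  cells (\<open>lower_homology_generated\<close>, \<open>skeleton_independent\<close>), incidence numbers exist, and they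
  are the same in every subcomplex (\<open>boundary_formula_exists\<close>, \<open>incidence_formula\<close>). As a closed
  cell is contractible, its augmented chain complex is exact (\<open>integral_exact\<close>). An exact complex of
  free groups that is bounded on the right splits, so that exactness is preserved by the passage
  to the field (\<open>exact_base_change\<close>).
\<close>

abbreviation "keys \<equiv> Poly_Mapping.keys"
abbreviation "lookup \<equiv> Poly_Mapping.lookup"
abbreviation "single \<equiv> Poly_Mapping.single"

section \<open>Exactness and change of coefficients\<close>

text \<open>Over the integers, an exact complex of free modules that ends on the right splits: at each
  term the identity is the sum of a map through the differential that leaves and one through the
  differential that arrives. The splitting is built from right to left, and it survives any change
  of coefficients. The matrix entry \<open>d s t\<close> is the coefficient of \<open>t\<close> in the differential of \<open>s\<close>;
  the terms are indexed from \<open>S 1\<close> on, and \<open>S 0\<close> is empty.\<close>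

lemma integral_splitting:
  fixes d :: "'i \<Rightarrow> 'i \<Rightarrow> int"
  assumes S0: "S 0 = {}" and fin: "\<And>n. finite (S n)"
    and dd: "\<And>n s m. s \<in> S (Suc (Suc n)) \<Longrightarrow> m \<in> S n \<Longrightarrow> (\<Sum>t\<in>S (Suc n). d s t * d t m) = 0"
    and ex: "\<And>n a. (\<And>m. m \<in> S n \<Longrightarrow> (\<Sum>t\<in>S (Suc n). a t * d t m) = 0) \<Longrightarrow>
       \<exists>b. \<forall>t\<in>S (Suc n). a t = (\<Sum>v\<in>S (Suc (Suc n)). b v * d v t)"
  shows "\<exists>g h. \<forall>s\<in>S (Suc n). \<forall>t\<in>S (Suc n).
    (if s = t then 1 else 0) = (\<Sum>u\<in>S n. d s u * g u t) + (\<Sum>v\<in>S (Suc (Suc n)). h s v * d v t)"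
proof (induction n)
  case 0
  have "\<exists>b. \<forall>t\<in>S (Suc 0). (if s = t then 1 else 0) = (\<Sum>v\<in>S (Suc (Suc 0)). b v * d v t)" for s
    by (rule ex) (simp add: S0)
  then obtain h where "\<And>s t. t \<in> S (Suc 0) \<Longrightarrow> (if s = t then 1 else 0) = (\<Sum>v\<in>S (Suc (Suc 0)). h s v * d v t)"
    by metis
  then show ?case by (intro exI[of _ "\<lambda>_ _. 0"] exI[of _ h]) simp
next
  case (Suc n)
  then obtain g h where gh: "\<And>s t. s \<in> S (Suc n) \<Longrightarrow> t \<in> S (Suc n) \<Longrightarrow>
    (if s = t then 1 else 0) = (\<Sum>u\<in>S n. d s u * g u t) + (\<Sum>v\<in>S (Suc (Suc n)). h s v * d v t)" by blast
  \<comment> \<open>The rows of \<open>1 - d h\<close> are cycles, because \<open>h d = 1 - d g\<close> and \<open>d d = 0\<close>; exactness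
    lifts them.\<close>
  let ?e = "\<lambda>s t. (if s = t then 1 else 0) - (\<Sum>u\<in>S (Suc n). d s u * h u t)"
  have "\<exists>b. \<forall>t\<in>S (Suc (Suc n)). ?e s t = (\<Sum>v\<in>S (Suc (Suc (Suc n))). b v * d v t)" if s: "s \<in> S (Suc (Suc n))" for s
  proof (rule ex)
    fix m assume m: "m \<in> S (Suc n)"
    have "(\<Sum>t\<in>S (Suc (Suc n)). \<Sum>u\<in>S (Suc n). d s u * h u t * d t m) = (\<Sum>u\<in>S (Suc n). d s u * (\<Sum>t\<in>S (Suc (Suc n)). h u t * d t m))"
      by (subst sum.swap) (simp add: sum_distrib_left mult.assoc)
    also have "\<dots> = (\<Sum>u\<in>S (Suc n). d s u * ((if u = m then 1 else 0) - (\<Sum>w\<in>S n. d u w * g w m)))"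
      by (rule sum.cong[OF refl]) (use gh m in simp)
    also have "\<dots> = d s m - (\<Sum>u\<in>S (Suc n). \<Sum>w\<in>S n. d s u * d u w * g w m)"
      using m fin by (simp add: right_diff_distrib sum_subtractf sum_distrib_left mult.assoc if_distrib[of "\<lambda>x. _ * x"] cong: if_cong)
    also have "(\<Sum>u\<in>S (Suc n). \<Sum>w\<in>S n. d s u * d u w * g w m) = (\<Sum>w\<in>S n. (\<Sum>u\<in>S (Suc n). d s u * d u w) * g w m)"
      by (subst sum.swap) (simp add: sum_distrib_right)
    also have "\<dots> = 0" using dd[OF s] by simp
    finally have "(\<Sum>t\<in>S (Suc (Suc n)). \<Sum>u\<in>S (Suc n). d s u * h u t * d t m) = d s m" by simp
    then show "(\<Sum>t\<in>S (Suc (Suc n)). ?e s t * d t m) = 0"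
      using s fin by (simp add: left_diff_distrib sum_subtractf sum_distrib_right if_distrib[of "\<lambda>x. x * _"] cong: if_cong)
  qed
  then have "\<exists>h'. \<forall>s\<in>S (Suc (Suc n)). \<forall>t\<in>S (Suc (Suc n)). ?e s t = (\<Sum>v\<in>S (Suc (Suc (Suc n))). h' s v * d v t)"
    by (intro bchoice ballI)
  then obtain h' where h': "\<And>s t. s \<in> S (Suc (Suc n)) \<Longrightarrow> t \<in> S (Suc (Suc n)) \<Longrightarrow> ?e s t = (\<Sum>v\<in>S (Suc (Suc (Suc n))). h' s v * d v t)"
    by blast
  show ?case
  proof (intro exI ballI)
    fix s t assume "s \<in> S (Suc (Suc n))" "t \<in> S (Suc (Suc n))"
    from h'[OF this] show "(if s = t then 1 else 0) = (\<Sum>u\<in>S (Suc n). d s u * h u t) + (\<Sum>v\<in>S (Suc (Suc (Suc n))). h' s v * d v t)"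
      by simp
  qed
qed

text \<open>A cycle with coefficients in any commutative ring is the product of itself with the split
  identity, and the summand that starts with the differential of the cycle vanishes.\<close>

theorem exact_base_change:
  fixes d :: "'i \<Rightarrow> 'i \<Rightarrow> int" and a :: "'i \<Rightarrow> 'k::comm_ring_1"
  assumes "S 0 = {}" and fin: "\<And>n. finite (S n)"
    and "\<And>n s m. s \<in> S (Suc (Suc n)) \<Longrightarrow> m \<in> S n \<Longrightarrow> (\<Sum>t\<in>S (Suc n). d s t * d t m) = 0"
    and "\<And>n a. (\<And>m. m \<in> S n \<Longrightarrow> (\<Sum>t\<in>S (Suc n). a t * d t m) = 0) \<Longrightarrow>
       \<exists>b. \<forall>t\<in>S (Suc n). a t = (\<Sum>v\<in>S (Suc (Suc n)). b v * d v t)"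
    and cyc: "\<And>m. m \<in> S n \<Longrightarrow> (\<Sum>t\<in>S (Suc n). a t * of_int (d t m)) = 0"
  shows "\<exists>b. \<forall>t\<in>S (Suc n). a t = (\<Sum>v\<in>S (Suc (Suc n)). b v * of_int (d v t))"
proof -
  have "\<exists>g h. \<forall>s\<in>S (Suc n). \<forall>t\<in>S (Suc n).
    (if s = t then 1 else 0) = (\<Sum>u\<in>S n. d s u * g u t) + (\<Sum>v\<in>S (Suc (Suc n)). h s v * d v t)"
    by (rule integral_splitting) (fact assms(1-4))+
  then obtain g h where gh: "\<And>s t. s \<in> S (Suc n) \<Longrightarrow> t \<in> S (Suc n) \<Longrightarrow>
    (if s = t then 1 else 0) = (\<Sum>u\<in>S n. d s u * g u t) + (\<Sum>v\<in>S (Suc (Suc n)). h s v * d v t)" by blast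
  show ?thesis
  proof (intro exI ballI)
    fix t assume t: "t \<in> S (Suc n)"
    have split: "(if s = t then 1 else 0) = (\<Sum>u\<in>S n. of_int (d s u) * of_int (g u t)) + (\<Sum>v\<in>S (Suc (Suc n)). of_int (h s v) * of_int (d v t) :: 'k)"
      if "s \<in> S (Suc n)" for s
      using arg_cong[OF gh[OF that t], of "of_int :: int \<Rightarrow> 'k"] by (simp split: if_splits)
    have "a t = (\<Sum>s\<in>S (Suc n). a s * (if s = t then 1 else 0))"
      using t fin by (simp add: if_distrib[of "\<lambda>x. _ * x"] cong: if_cong)
    also have "\<dots> = (\<Sum>s\<in>S (Suc n). \<Sum>u\<in>S n. a s * of_int (d s u) * of_int (g u t))
        + (\<Sum>s\<in>S (Suc n). \<Sum>v\<in>S (Suc (Suc n)). a s * of_int (h s v) * of_int (d v t))"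
      by (simp add: split distrib_left sum.distrib sum_distrib_left mult.assoc)
    also have "(\<Sum>s\<in>S (Suc n). \<Sum>u\<in>S n. a s * of_int (d s u) * of_int (g u t)) = (\<Sum>u\<in>S n. (\<Sum>s\<in>S (Suc n). a s * of_int (d s u)) * of_int (g u t))"
      by (subst sum.swap) (simp add: sum_distrib_right)
    also have "\<dots> = 0" using cyc by simp
    also have "(\<Sum>s\<in>S (Suc n). \<Sum>v\<in>S (Suc (Suc n)). a s * of_int (h s v) * of_int (d v t))
      = (\<Sum>v\<in>S (Suc (Suc n)). (\<Sum>s\<in>S (Suc n). a s * of_int (h s v)) * of_int (d v t))"
      by (subst sum.swap) (simp add: sum_distrib_right)
    finally show "a t = (\<Sum>v\<in>S (Suc (Suc n)). (\<Sum>s\<in>S (Suc n). a s * of_int (h s v)) * of_int (d v t))" by simp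
  qed
qed

section \<open>Simplicial chains, cones and boundaries\<close>

definition smul :: "'k::comm_ring_1 \<Rightarrow> ('a \<Rightarrow>\<^sub>0 'k) \<Rightarrow> ('a \<Rightarrow>\<^sub>0 'k)" where
  "smul r c = Poly_Mapping.map ((*) r) c"

lemma lookup_smul [simp]: "lookup (smul r c) s = r * lookup c s"
  unfolding smul_def by (simp add: Poly_Mapping.map.rep_eq when_def)

lemma smul_simps [simp]:
  "smul 0 c = 0" "smul 1 c = c" "smul r 0 = 0" "smul r (smul q c) = smul (r * q) c"
  "smul r (single s x) = single s (r * x)"
  by (rule poly_mapping_eqI; simp add: lookup_single when_def mult.assoc)+

lemma smul_add: "smul r (a + b) = smul r a + smul r b" "smul (r + q) a = smul r a + smul q a"
  by (rule poly_mapping_eqI; simp add: lookup_add algebra_simps)+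

lemma smul_diff: "smul r (a - b) = smul r a - smul r b" "smul (r - q) a = smul r a - smul q a" "smul (- r) a = - smul r a"
  by (rule poly_mapping_eqI; simp add: lookup_minus algebra_simps)+

lemma smul_sum: "smul r (sum f A) = (\<Sum>x\<in>A. smul r (f x))" "smul (sum g A) c = (\<Sum>x\<in>A. smul (g x) c)"
  by (rule poly_mapping_eqI; simp add: lookup_sum sum_distrib_left sum_distrib_right)+

lemma keys_smul: "keys (smul r c) \<subseteq> keys c"
  by (auto simp: in_keys_iff)

text \<open>The linear map on finitely supported functions with prescribed values on the basis.\<close>

definition lext :: "('a \<Rightarrow> ('b \<Rightarrow>\<^sub>0 'k)) \<Rightarrow> ('a \<Rightarrow>\<^sub>0 'k::comm_ring_1) \<Rightarrow> ('b \<Rightarrow>\<^sub>0 'k)" where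
  "lext f c = (\<Sum>s\<in>keys c. smul (lookup c s) (f s))"

lemma lext_superset:
  "finite A \<Longrightarrow> keys c \<subseteq> A \<Longrightarrow> lext f c = (\<Sum>s\<in>A. smul (lookup c s) (f s))"
  unfolding lext_def by (rule sum.mono_neutral_left) (auto simp: in_keys_iff)

lemma lext_zero [simp]: "lext f 0 = 0" by (simp add: lext_def)

lemma lext_add: "lext f (a + b) = lext f a + lext f b"
proof -
  let ?A = "keys a \<union> keys b"
  have "lext f (a + b) = (\<Sum>s\<in>?A. smul (lookup (a + b) s) (f s))"
    by (rule lext_superset) (auto simp: in_keys_iff lookup_add)
  also have "\<dots> = lext f a + lext f b"
    by (simp add: lext_superset[of ?A] lookup_add smul_add sum.distrib)
  finally show ?thesis .
qed

lemma lext_smul: "lext f (smul r a) = smul r (lext f a)"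
  using lext_superset[OF finite_keys keys_smul, of f r a] by (simp add: lext_def smul_sum)

lemma lext_single [simp]: "lext f (single s x) = smul x (f s)"
  by (simp add: lext_superset[of "{s}"])

lemma lext_diff: "lext f (a - b) = lext f a - lext f b"
proof -
  have "a - b = a + smul (-1) b" by (rule poly_mapping_eqI) (simp add: lookup_add lookup_minus)
  then have "lext f (a - b) = lext f a + smul (-1) (lext f b)" by (simp only: lext_add lext_smul)
  also have "\<dots> = lext f a - lext f b" by (rule poly_mapping_eqI) (simp add: lookup_add lookup_minus)
  finally show ?thesis .
qed

lemma lext_sum: "lext f (sum g A) = (\<Sum>x\<in>A. lext f (g x))"
  by (induction A rule: infinite_finite_induct) (auto simp: lext_add)

lemma lext_lext: "lext f (lext g c) = lext (\<lambda>s. lext f (g s)) c"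
  by (simp add: lext_def[of g] lext_def[of "\<lambda>s. lext f (g s)"] lext_sum lext_smul)

lemma lext_cong: "(\<And>s. s \<in> keys c \<Longrightarrow> f s = g s) \<Longrightarrow> lext f c = lext g c"
  by (simp add: lext_def)

lemma lext_fun_add: "lext (\<lambda>s. f s + g s) c = lext f c + lext g c"
  by (simp add: lext_def smul_add sum.distrib)

lemma lext_fun_smul: "lext (\<lambda>s. smul r (f s)) c = smul r (lext f c)"
  by (simp add: lext_def smul_sum mult.commute)

lemma lext_id: "lext (\<lambda>s. single s 1) c = c"
proof (rule poly_mapping_eqI)
  fix t
  have "lookup (lext (\<lambda>s. single s 1) c) t
    = (\<Sum>s\<in>keys c. if s = t then lookup c s else 0)"
    by (simp add: lext_def lookup_sum lookup_single when_def)
  also have "\<dots> = lookup c t" by (simp add: in_keys_iff)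
  finally show "lookup (lext (\<lambda>s. single s 1) c) t = lookup c t" .
qed

lemma keys_lext: "keys (lext f c) \<subseteq> (\<Union>s\<in>keys c. keys (f s))"
proof
  fix t assume "t \<in> keys (lext f c)"
  then have "(\<Sum>s\<in>keys c. lookup c s * lookup (f s) t) \<noteq> 0"
    by (simp add: in_keys_iff lext_def lookup_sum)
  then obtain s where s: "s \<in> keys c" "lookup c s * lookup (f s) t \<noteq> 0"
    by (meson sum.neutral)
  then have "lookup (f s) t \<noteq> 0" by auto
  with s(1) show "t \<in> (\<Union>s\<in>keys c. keys (f s))" by (auto simp: in_keys_iff)
qed

definition face_sum :: "'p::order set \<Rightarrow> ('p set \<Rightarrow>\<^sub>0 'k::field)" where
  "face_sum s = (\<Sum>x\<in>s. single (s - {x}) ((-1) ^ card {y \<in> s. y < x}))"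

lemma simp_boundary_lext: "simp_boundary c = lext face_sum c"
  unfolding simp_boundary_def lext_def face_sum_def smul_sum
  by (simp add: mult.commute)

definition cone_over :: "'p \<Rightarrow> ('p set \<Rightarrow>\<^sub>0 'k::field) \<Rightarrow> ('p set \<Rightarrow>\<^sub>0 'k)" where
  "cone_over l = lext (\<lambda>s. single (insert l s) 1)"

lemma boundary_linear:
  "simp_boundary (a + b) = simp_boundary a + simp_boundary b" "simp_boundary (a - b) = simp_boundary a - simp_boundary b"
  "simp_boundary (smul r a) = smul r (simp_boundary a)" "simp_boundary (sum g A) = (\<Sum>x\<in>A. simp_boundary (g x))"
  "simp_boundary 0 = 0"
  by (simp_all add: simp_boundary_lext lext_add lext_diff lext_smul lext_sum)

lemma cone_linear:
  "cone_over l (a + b) = cone_over l a + cone_over l b" "cone_over l (a - b) = cone_over l a - cone_over l b"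
  "cone_over l (smul r a) = smul r (cone_over l a)" "cone_over l (sum g A) = (\<Sum>x\<in>A. cone_over l (g x))"
  "cone_over l 0 = 0" "cone_over l (single s x) = single (insert l s) x"
  by (simp_all add: cone_over_def lext_add lext_diff lext_smul lext_sum)

text \<open>The sign of a face is the parity of the number of vertices below the omitted one. A vertex on top
  changes none of the old signs, and its own omission contributes the sign \<open>(-1) ^ card s\<close>.\<close>

lemma face_sum_insert_top:
  assumes "finite s" "\<And>x. x \<in> s \<Longrightarrow> x < l"
  shows "face_sum (insert l s) = cone_over l (face_sum s) + single s ((-1) ^ card s)"
proof -
  have ls: "l \<notin> s" using assms(2) by blast
  have 1: "{y \<in> insert l s. y < l} = s" "insert l s - {l} = s" using assms(2) ls by auto
  have 2: "{y \<in> insert l s. y < x} = {y \<in> s. y < x}" "insert l s - {x} = insert l (s - {x})" if "x \<in> s" for x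
    using assms(2)[OF that] ls that by (auto dest: less_asym)
  have "face_sum (insert l s) = single (insert l s - {l}) ((-1) ^ card {y \<in> insert l s. y < l})
      + (\<Sum>x\<in>s. single (insert l s - {x}) ((-1) ^ card {y \<in> insert l s. y < x}))"
    unfolding face_sum_def by (rule sum.insert[OF assms(1) ls])
  also have "\<dots> = single s ((-1) ^ card s) + (\<Sum>x\<in>s. single (insert l (s - {x})) ((-1) ^ card {y \<in> s. y < x}))"
    unfolding 1 by (intro arg_cong2[where f = "(+)"] refl sum.cong) (simp only: 2)
  also have "(\<Sum>x\<in>s. single (insert l (s - {x})) ((-1) ^ card {y \<in> s. y < x})) = cone_over l (face_sum s)"
    unfolding face_sum_def cone_linear ..
  finally show ?thesis by (simp add: add.commute)
qed

lemma boundary_cone: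
  assumes "\<And>s. s \<in> keys c \<Longrightarrow> finite s \<and> card s = r \<and> (\<forall>x\<in>s. x < l)"
  shows "simp_boundary (cone_over l c) = cone_over l (simp_boundary c) + smul ((-1) ^ r) c"
proof -
  have "simp_boundary (cone_over l c) = lext (\<lambda>s. face_sum (insert l s)) c"
    unfolding simp_boundary_lext cone_over_def lext_lext by simp
  also have "\<dots> = lext (\<lambda>s. cone_over l (face_sum s) + smul ((-1) ^ r) (single s 1)) c"
  proof (rule lext_cong)
    fix s assume "s \<in> keys c"
    from assms[OF this] have s: "finite s" "card s = r" "\<And>x. x \<in> s \<Longrightarrow> x < l" by blast+
    show "face_sum (insert l s) = cone_over l (face_sum s) + smul ((-1) ^ r) (single s 1)"
      using face_sum_insert_top[OF s(1,3)] s(2) by simp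
  qed
  also have "\<dots> = lext (\<lambda>s. cone_over l (face_sum s)) c + smul ((-1) ^ r) c"
    unfolding lext_fun_add lext_fun_smul lext_id ..
  also have "lext (\<lambda>s. cone_over l (face_sum s)) c = cone_over l (simp_boundary c)"
    unfolding simp_boundary_lext cone_over_def lext_lext ..
  finally show ?thesis .
qed

lemma keys_face_sum:
  fixes s :: "'p::order set"
  assumes "t \<in> keys (face_sum s :: 'p set \<Rightarrow>\<^sub>0 'k::field)"
  shows "\<exists>x\<in>s. t = s - {x}"
proof -
  have "(\<Sum>x\<in>s. lookup (single (s - {x}) ((-1) ^ card {y \<in> s. y < x})) t) \<noteq> (0::'k)"
    using assms by (simp add: in_keys_iff face_sum_def lookup_sum)
  then obtain x where "x \<in> s" "lookup (single (s - {x}) ((-1) ^ card {y \<in> s. y < x})) t \<noteq> (0::'k)"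
    by (meson sum.neutral)
  then show ?thesis by (auto simp: lookup_single when_def split: if_splits)
qed

text \<open>By induction on the number of vertices: the simplex is a cone over the face opposite to its
  largest vertex, and the two copies of the boundary of that face cancel.\<close>

lemma boundary_face_sum:
  fixes s :: "'p::order set"
  shows "finite s \<Longrightarrow> Complete_Partial_Order.chain (\<le>) s \<Longrightarrow> simp_boundary (face_sum s :: 'p set \<Rightarrow>\<^sub>0 'k::field) = 0"
proof (induction "card s" arbitrary: s)
  case 0
  then show ?case by (simp add: face_sum_def boundary_linear)
next
  case (Suc n)
  then have ne: "s \<noteq> {}" by auto
  have "\<exists>l\<in>s. \<forall>x\<in>s. x \<le> l" using \<open>finite s\<close> ne Suc.prems(2)
  proof (induction s rule: finite_ne_induct)
    case (insert x F)
    then have "Complete_Partial_Order.chain (\<le>) F" by (auto simp: chain_def)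
    then obtain l where l: "l \<in> F" "\<forall>x\<in>F. x \<le> l" using insert by blast
    show ?case
    proof (cases "x \<le> l")
      case False
      then have "l \<le> x" using insert.prems l(1) by (auto simp: chain_def)
      then show ?thesis using l by (auto intro: order_trans)
    qed (use l in auto)
  qed simp
  then obtain l where l: "l \<in> s" "\<And>x. x \<in> s \<Longrightarrow> x \<le> l" by blast
  define s' where "s' = s - {l}"
  have s: "s = insert l s'" and lt: "\<And>x. x \<in> s' \<Longrightarrow> x < l" and fin: "finite s'" and card: "card s' = n"
    using l Suc by (auto simp: s'_def less_le)
  have ch: "Complete_Partial_Order.chain (\<le>) s'" using Suc.prems(2) by (auto simp: chain_def s'_def)
  have IH: "simp_boundary (face_sum s' :: 'p set \<Rightarrow>\<^sub>0 'k) = 0" using Suc.hyps(1)[of s'] card fin ch by simp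
  have keys: "t \<in> keys (face_sum s' :: 'p set \<Rightarrow>\<^sub>0 'k) \<Longrightarrow> finite t \<and> card t = n - 1 \<and> (\<forall>x\<in>t. x < l)" for t
    using keys_face_sum[of t s'] fin card lt by auto
  have fsi: "(face_sum (insert l s') :: 'p set \<Rightarrow>\<^sub>0 'k) = cone_over l (face_sum s') + single s' ((-1) ^ card s')"
    by (rule face_sum_insert_top[OF fin]) (rule lt)
  have bc: "simp_boundary (cone_over l (face_sum s' :: 'p set \<Rightarrow>\<^sub>0 'k)) = cone_over l (simp_boundary (face_sum s')) + smul ((-1) ^ (n - 1)) (face_sum s')"
    by (rule boundary_cone) (rule keys)
  have single: "simp_boundary (single s' x :: 'p set \<Rightarrow>\<^sub>0 'k) = smul x (face_sum s')" for x
    by (simp add: simp_boundary_lext)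
  have "simp_boundary (face_sum s :: 'p set \<Rightarrow>\<^sub>0 'k) = cone_over l (simp_boundary (face_sum s')) + smul ((-1) ^ (n - 1)) (face_sum s') + smul ((-1) ^ n) (face_sum s')"
    unfolding s fsi boundary_linear bc single card ..
  also have "\<dots> = smul ((-1) ^ (n - 1)) (face_sum s') + smul ((-1) ^ n) (face_sum s')" by (simp add: IH cone_linear)
  also have "\<dots> = 0"
  proof (cases n)
    case 0
    then have "s' = {}" using card fin by simp
    then show ?thesis by (simp add: face_sum_def)
  next
    case (Suc m)
    then show ?thesis by (simp add: smul_diff)
  qed
  finally show ?case .
qed

lemma boundary_boundary:
  assumes "\<And>s. s \<in> keys c \<Longrightarrow> finite s \<and> Complete_Partial_Order.chain (\<le>) s"
  shows "simp_boundary (simp_boundary c) = 0"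
proof -
  have "simp_boundary (simp_boundary c) = lext (\<lambda>s. simp_boundary (face_sum s)) c"
    unfolding simp_boundary_lext lext_lext ..
  also have "\<dots> = lext (\<lambda>s. 0) c" by (rule lext_cong) (use assms boundary_face_sum in blast)
  also have "\<dots> = 0" by (simp add: lext_def)
  finally show ?thesis .
qed

lemma lookup_cone:
  assumes "\<And>s. s \<in> keys c \<Longrightarrow> l \<notin> s"
  shows "l \<notin> t \<Longrightarrow> lookup (cone_over l c) (insert l t) = lookup c t"
    "l \<notin> t \<Longrightarrow> lookup (cone_over l c) t = 0"
proof -
  assume t: "l \<notin> t"
  have "lookup (cone_over l c) (insert l t) = (\<Sum>s\<in>keys c. if s = t then lookup c s else 0)"
    unfolding cone_over_def lext_def lookup_sum
  proof (rule sum.cong[OF refl])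
    fix s assume "s \<in> keys c"
    then have "l \<notin> s" by (rule assms)
    then have "insert l s = insert l t \<longleftrightarrow> s = t" using t by auto
    then show "lookup (smul (lookup c s) (single (insert l s) 1)) (insert l t) = (if s = t then lookup c s else 0)"
      by (simp add: lookup_single when_def)
  qed
  also have "\<dots> = lookup c t" by (simp add: in_keys_iff)
  finally show "lookup (cone_over l c) (insert l t) = lookup c t" .
  have "lookup (single (insert l s) (x::'b)) t = 0" for s x
    using t by (auto simp: lookup_single when_def)
  then show "lookup (cone_over l c) t = 0"
    unfolding cone_over_def lext_def lookup_sum by simp
qed

lemma keys_cone: "t \<in> keys (cone_over l c) \<Longrightarrow> \<exists>s\<in>keys c. t = insert l s"
  unfolding cone_over_def using keys_lext[of "\<lambda>s. single (insert l s) 1" c]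
  by (auto split: if_splits)

lemma keys_boundary: "t \<in> keys (simp_boundary c) \<Longrightarrow> \<exists>s\<in>keys c. \<exists>x\<in>s. t = s - {x}"
  unfolding simp_boundary_lext using keys_lext[of face_sum c] keys_face_sum by blast

section \<open>Order complexes of graded posets with an acyclic chain complex\<close>

text \<open>Indexed by the number of vertices, so that all indices are natural numbers.\<close>

abbreviation ochains :: "nat \<Rightarrow> 'p::order set \<Rightarrow> ('p set \<Rightarrow>\<^sub>0 'k::field) set" where
  "ochains r Q \<equiv> simp_chains (int r - 1) (order_complex Q)"

lemma simp_chains_nat: "c \<in> simp_chains (int r - 1) L \<longleftrightarrow> (\<forall>s\<in>keys c. s \<in> L \<and> card s = r)"
  unfolding simp_chains_def by auto

lemma simp_chains_0 [simp]: "0 \<in> simp_chains p L" by (simp add: simp_chains_def)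

lemma simp_chains_add: "a \<in> simp_chains p L \<Longrightarrow> b \<in> simp_chains p L \<Longrightarrow> a + b \<in> simp_chains p L"
  unfolding simp_chains_def using keys_add[of a b] by blast

lemma simp_chains_smul: "a \<in> simp_chains p L \<Longrightarrow> smul r a \<in> simp_chains p L"
  unfolding simp_chains_def using keys_smul[of r a] by blast

lemma simp_chains_diff: "a \<in> simp_chains p L \<Longrightarrow> b \<in> simp_chains p L \<Longrightarrow> a - b \<in> simp_chains p L"
  unfolding simp_chains_def using keys_diff[of a b] by blast

lemma simp_chains_sum: "(\<And>x. x \<in> A \<Longrightarrow> f x \<in> simp_chains p L) \<Longrightarrow> sum f A \<in> simp_chains p L"
  by (induction A rule: infinite_finite_induct) (auto intro: simp_chains_add)

lemma simp_chains_mono: "L \<subseteq> M \<Longrightarrow> a \<in> simp_chains p L \<Longrightarrow> a \<in> simp_chains p M"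
  unfolding simp_chains_def by blast

lemma order_complex_mono: "A \<subseteq> B \<Longrightarrow> order_complex A \<subseteq> order_complex B"
  unfolding order_complex_def by blast

lemma order_complex_insert_top:
  "s \<in> order_complex A \<Longrightarrow> l \<in> B \<Longrightarrow> A \<subseteq> B \<Longrightarrow> (\<And>x. x \<in> s \<Longrightarrow> x < l) \<Longrightarrow> insert l s \<in> order_complex B"
  unfolding order_complex_def chain_def by (auto intro: less_imp_le)

lemma order_complex_subset: "s \<in> order_complex A \<Longrightarrow> t \<subseteq> s \<Longrightarrow> t \<in> order_complex A"
  unfolding order_complex_def chain_def by (auto intro: finite_subset)

lemma order_complex_empty: "order_complex {} = {{}}"
  unfolding order_complex_def chain_def by auto

lemma empty_in_order_complex: "{} \<in> order_complex A"
  unfolding order_complex_def chain_def by auto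

text \<open>The elements below \<open>x\<close> whose rank is one less than \<open>n\<close>. The shift makes the layer with
  index \<open>0\<close> empty, so that the lowest term of an augmented complex needs no separate treatment.\<close>

definition rank_layer :: "'p::order set \<Rightarrow> ('p \<Rightarrow> nat) \<Rightarrow> 'p \<Rightarrow> nat \<Rightarrow> 'p set" where
  "rank_layer P rk x n = {t \<in> P. t \<le> x \<and> Suc (rk t) = n}"

text \<open>The combinatorial shadow of a regular cell complex. The matrix \<open>d\<close> stands for the cellular
  boundary with coefficients in the field; \<open>exact\<close> says that the augmented cellular complex of the
  cells below any \<open>x\<close> other than bottom is exact, also on the left.\<close>

locale graded_acyclic_poset =
  fixes P :: "'p::order_bot set" and rk :: "'p \<Rightarrow> nat" and d :: "'p \<Rightarrow> 'p \<Rightarrow> 'k::field"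
  assumes bot_in: "bot \<in> P" and rk_bot: "rk bot = 0"
    and rk_mono: "\<And>x y. x \<in> P \<Longrightarrow> y \<in> P \<Longrightarrow> x < y \<Longrightarrow> rk x < rk y"
    and fin_below: "\<And>x. x \<in> P \<Longrightarrow> finite {y \<in> P. y \<le> x}"
    and d_support: "\<And>x y. x \<in> P \<Longrightarrow> y \<in> P \<Longrightarrow> d x y \<noteq> 0 \<Longrightarrow> y < x \<and> rk x = Suc (rk y)"
    and dd: "\<And>x y n. x \<in> P \<Longrightarrow> rk x = Suc n \<Longrightarrow> y \<in> rank_layer P rk x n \<Longrightarrow>
        (\<Sum>t\<in>rank_layer P rk x (Suc n). d x t * d t y) = 0"
    and exact: "\<And>x n a. x \<in> P \<Longrightarrow> x \<noteq> bot \<Longrightarrow>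
        (\<And>y. y \<in> rank_layer P rk x n \<Longrightarrow> (\<Sum>t\<in>rank_layer P rk x (Suc n). a t * d t y) = 0) \<Longrightarrow>
        \<exists>b. \<forall>t\<in>rank_layer P rk x (Suc n). a t = (\<Sum>v\<in>rank_layer P rk x (Suc (Suc n)). b v * d v t)"
begin

abbreviation "layer \<equiv> rank_layer P rk"
abbreviation "at_rank Q r \<equiv> {l \<in> insert bot Q. rk l = r}"

lemma finite_layer: "x \<in> P \<Longrightarrow> finite (layer x n)"
  by (rule finite_subset[OF _ fin_below]) (auto simp: rank_layer_def)

lemma rk_pos: "x \<in> P \<Longrightarrow> x \<noteq> bot \<Longrightarrow> 0 < rk x"
  using rk_mono[OF bot_in, of x] rk_bot by (simp add: bot.not_eq_extremum)

lemma rk_0: "x \<in> P \<Longrightarrow> rk x = 0 \<Longrightarrow> x = bot"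
  using rk_pos by force

definition lcovers :: "'p \<Rightarrow> 'p set" where "lcovers a = {l \<in> P. l < a \<and> Suc (rk l) = rk a}"

lemma finite_lcovers: "a \<in> P \<Longrightarrow> finite (lcovers a)"
  by (rule finite_subset[OF _ fin_below]) (auto simp: lcovers_def)

text \<open>\<open>E a\<close> is the barycentric subdivision of the cell \<open>a\<close> and \<open>Z a\<close> that of its boundary sphere. A cone
  over a chain of \<open>r\<close>-element simplices has that chain, with the sign \<open>(-1) ^ r\<close>, in its boundary; the
  same sign in the recursion removes it.\<close>

primrec Ech :: "nat \<Rightarrow> 'p \<Rightarrow> ('p set \<Rightarrow>\<^sub>0 'k)" where
  "Ech 0 a = single {} 1"
| "Ech (Suc r) a = smul ((-1) ^ r) (cone_over a (\<Sum>l\<in>{l \<in> P. l < a \<and> rk l = r}. smul (d a l) (Ech r l)))"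

definition E :: "'p \<Rightarrow> ('p set \<Rightarrow>\<^sub>0 'k)" where "E a = Ech (rk a) a"
definition Z :: "'p \<Rightarrow> ('p set \<Rightarrow>\<^sub>0 'k)" where "Z a = (\<Sum>l\<in>lcovers a. smul (d a l) (E l))"

lemma E_bot: "E bot = single {} 1"
  by (simp add: E_def rk_bot)

lemma E_eq: assumes "a \<in> P" "rk a = Suc r" shows "E a = smul ((-1) ^ r) (cone_over a (Z a))"
proof -
  have "lcovers a = {l \<in> P. l < a \<and> rk l = r}" using assms by (auto simp: lcovers_def)
  then have "Z a = (\<Sum>l\<in>{l \<in> P. l < a \<and> rk l = r}. smul (d a l) (Ech r l))"
    unfolding Z_def E_def by (auto intro!: sum.cong)
  then show ?thesis by (simp add: E_def assms(2))
qed

lemma Z_bot: "Z bot = 0" by (simp add: Z_def lcovers_def)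

lemma Z_layer:
  assumes "x \<in> P" "l \<in> P" "l \<le> x" "rk l = n"
  shows "Z l = (\<Sum>m\<in>layer x n. smul (d l m) (E m))"
  unfolding Z_def
proof (rule sum.mono_neutral_left[OF finite_layer[OF assms(1)]])
  show "lcovers l \<subseteq> layer x n" using assms by (auto simp: lcovers_def rank_layer_def)
  show "\<forall>m\<in>layer x n - lcovers l. smul (d l m) (E m) = 0"
  proof
    fix m assume m: "m \<in> layer x n - lcovers l"
    then have "d l m = 0" using d_support[of l m] assms by (auto simp: lcovers_def rank_layer_def)
    then show "smul (d l m) (E m) = 0" by simp
  qed
qed

lemma lcovers_layer: "lcovers a = layer a (rk a)"
  by (auto simp: lcovers_def rank_layer_def le_less)

definition below :: "'p \<Rightarrow> 'p set" where "below a = {x \<in> P. bot < x \<and> x < a}"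

lemma E_chain: "a \<in> P \<Longrightarrow> E a \<in> ochains (rk a) {x \<in> P. bot < x \<and> x \<le> a}"
  and Z_chain: "a \<in> P \<Longrightarrow> rk a = Suc r \<Longrightarrow> Z a \<in> ochains r (below a)"
proof (induction "rk a" arbitrary: a r rule: less_induct)
  case less
  {
    case 2
    have "smul (d a l) (E l) \<in> ochains r (below a)" if "l \<in> lcovers a" for l
    proof (rule simp_chains_smul, rule simp_chains_mono)
      show "E l \<in> ochains r {x \<in> P. bot < x \<and> x \<le> l}"
        using less(1)[of l] that 2 by (auto simp: lcovers_def)
      show "order_complex {x \<in> P. bot < x \<and> x \<le> l} \<subseteq> order_complex (below a)"
        by (rule order_complex_mono) (use that in \<open>auto simp: below_def lcovers_def\<close>)
    qed
    then show ?case unfolding Z_def by (rule simp_chains_sum)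
  } note z = this
  case 1
  show ?case
  proof (cases "rk a")
    case 0
    then have "a = bot" using rk_0 1 by blast
    then show ?thesis by (simp add: E_bot rk_bot simp_chains_def empty_in_order_complex)
  next
    case (Suc r)
    have ab: "bot < a" using Suc rk_bot by (metis bot.not_eq_extremum nat.distinct(1))
    have "cone_over a (Z a) \<in> ochains (Suc r) {x \<in> P. bot < x \<and> x \<le> a}"
      unfolding simp_chains_nat
    proof
      fix s assume "s \<in> keys (cone_over a (Z a))"
      then obtain t where t: "t \<in> keys (Z a)" "s = insert a t" using keys_cone[of s a "Z a"] by auto
      have tc: "t \<in> order_complex (below a)" "card t = r" using z[OF 1 Suc] t(1) unfolding simp_chains_nat by auto
      have lt: "x < a" if "x \<in> t" for x using tc(1) that by (auto simp: order_complex_def below_def)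
      have "s \<in> order_complex {x \<in> P. bot < x \<and> x \<le> a}" unfolding t(2)
        by (rule order_complex_insert_top[OF tc(1)]) (use lt 1 ab in \<open>auto simp: below_def\<close>)
      moreover have "a \<notin> t" using lt by blast
      then have "card s = Suc r" using t(2) tc by (simp add: order_complex_def)
      ultimately show "s \<in> order_complex {x \<in> P. bot < x \<and> x \<le> a} \<and> card s = Suc r" by blast
    qed
    then show ?thesis unfolding E_eq[OF 1 Suc] Suc by (rule simp_chains_smul)
  qed
qed

lemma Z_keys: assumes "a \<in> P" "rk a = Suc r" "s \<in> keys (Z a)"
  shows "s \<in> order_complex (below a)" "card s = r" "finite s" "\<And>x. x \<in> s \<Longrightarrow> x \<in> P \<and> bot < x \<and> x < a" "a \<notin> s"
    "Complete_Partial_Order.chain (\<le>) s"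
  using Z_chain[OF assms(1,2)] assms(3) unfolding simp_chains_nat by (auto simp: order_complex_def below_def)

lemma E_keys: assumes "a \<in> P" "rk a = Suc r" "s \<in> keys (E a)"
  shows "a \<in> s" "\<And>x. x \<in> s \<Longrightarrow> x \<in> P \<and> bot < x \<and> x \<le> a"
proof -
  show "a \<in> s" using assms(3) keys_smul[of "(-1) ^ r" "cone_over a (Z a)"] keys_cone[of s a "Z a"]
    unfolding E_eq[OF assms(1,2)] by blast
  show "x \<in> P \<and> bot < x \<and> x \<le> a" if "x \<in> s" for x
    using E_chain[OF assms(1)] assms(2,3) that unfolding simp_chains_def by (auto simp: order_complex_def)
qed

lemma minus_one_sq: "smul ((-1) ^ r) (smul ((-1) ^ r) c) = c"
  by (simp flip: power_mult_distrib)

lemma boundary_E_Z: "a \<in> P \<Longrightarrow> simp_boundary (E a) = Z a"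
  and boundary_Z: "a \<in> P \<Longrightarrow> simp_boundary (Z a) = 0"
proof (induction "rk a" arbitrary: a rule: less_induct)
  case less
  {
    case 2
    note aP = 2
    have "simp_boundary (Z a) = (\<Sum>l\<in>lcovers a. smul (d a l) (Z l))"
      unfolding Z_def[of a] boundary_linear
      by (rule sum.cong[OF refl]) (use less(1) in \<open>auto simp: lcovers_def\<close>)
    also have "\<dots> = 0"
    proof (cases "rk a")
      case 0
      then show ?thesis by (simp add: lcovers_def)
    next
      case (Suc n)
      have "(\<Sum>l\<in>lcovers a. smul (d a l) (Z l)) = (\<Sum>l\<in>lcovers a. \<Sum>m\<in>layer a n. smul (d a l * d l m) (E m))"
        by (rule sum.cong) (use aP Suc in \<open>auto simp: Z_layer[of a] smul_sum lcovers_def\<close>)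
      also have "\<dots> = (\<Sum>m\<in>layer a n. smul (\<Sum>l\<in>lcovers a. d a l * d l m) (E m))"
        unfolding smul_sum by (rule sum.swap)
      also have "\<dots> = 0"
        unfolding lcovers_layer Suc by (rule sum.neutral) (use dd[OF aP Suc] in auto)
      finally show ?thesis .
    qed
    finally show ?case .
  } note bz = this
  case 1
  show ?case
  proof (cases "rk a")
    case 0
    then have "a = bot" using rk_0 1 by blast
    then show ?thesis by (simp add: E_bot Z_bot simp_boundary_lext face_sum_def)
  next
    case (Suc r)
    have "simp_boundary (cone_over a (Z a)) = cone_over a (simp_boundary (Z a)) + smul ((-1) ^ r) (Z a)"
      by (rule boundary_cone) (use Z_keys[OF 1 Suc] in auto)
    then show ?thesis unfolding E_eq[OF 1 Suc] boundary_linear bz[OF 1] cone_linear by (simp add: minus_one_sq)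
  qed
qed

text \<open>For \<open>a\<close> of positive rank every simplex of \<open>E a\<close> has \<open>a\<close> as its largest vertex, so no
  simplex occurs in two of the chains.\<close>

lemma E_independent:
  assumes A: "finite A" "A \<subseteq> P" "\<And>a. a \<in> A \<Longrightarrow> rk a = r" and nz: "\<And>a. a \<in> A \<Longrightarrow> E a \<noteq> 0"
    and sum0: "(\<Sum>a\<in>A. smul (x a) (E a)) = 0" and b: "b \<in> A"
  shows "x b = 0"
proof -
  obtain s where s: "s \<in> keys (E b)" using nz[OF b] by fastforce
  have other: "lookup (E a) s = 0" if a: "a \<in> A" "a \<noteq> b" for a
  proof (rule ccontr)
    assume "lookup (E a) s \<noteq> 0"
    then have sa: "s \<in> keys (E a)" by (simp add: in_keys_iff)
    show False
    proof (cases r)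
      case 0
      then show False using rk_0 A a b by (metis subsetD)
    next
      case (Suc r')
      have "a \<in> s" "b \<in> s" using E_keys(1) sa s A a b Suc by blast+
      then have "b \<le> a" using E_keys(2)[of a r' s b] sa A a Suc by auto
      then have "b < a" using a(2) by (metis le_less)
      then have "rk b < rk a" using rk_mono[of b a] a A b by auto
      then show False using A a b by auto
    qed
  qed
  have "0 = lookup (\<Sum>a\<in>A. smul (x a) (E a)) s" using sum0 by simp
  also have "\<dots> = (\<Sum>a\<in>A. x a * lookup (E a) s)" by (simp add: lookup_sum)
  also have "\<dots> = (\<Sum>a\<in>{b}. x a * lookup (E a) s)"
    by (rule sum.mono_neutral_right) (use A b other in auto)
  finally show ?thesis using s by (simp add: in_keys_iff)
qed

text \<open>If \<open>Z a\<close> vanished, then \<open>a\<close> itself would be a cycle in the top degree of the cellular complex of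
  \<open>a\<close>, contrary to exactness.\<close>

lemma Z_nonzero_step:
  assumes a: "a \<in> P" "rk a = Suc r" and nz: "\<And>l. l \<in> lcovers a \<Longrightarrow> E l \<noteq> 0"
  shows "Z a \<noteq> 0"
proof
  assume "Z a = 0"
  then have d0: "d a l = 0" if "l \<in> lcovers a" for l
    by (intro E_independent[OF finite_lcovers[OF a(1)], of r "d a" l]) (use that nz a in \<open>auto simp: lcovers_def Z_def\<close>)
  have R: "layer a (Suc (Suc r)) = {a}" "layer a (Suc (Suc (Suc r))) = {}"
    using a rk_mono[of _ a] by (force simp: rank_layer_def le_less)+
  have "\<exists>b. \<forall>t\<in>layer a (Suc (Suc r)). (1::'k) = (\<Sum>v\<in>layer a (Suc (Suc (Suc r))). b v * d v t)"
  proof (rule exact)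
    fix y assume "y \<in> layer a (Suc r)"
    then have "y \<in> lcovers a" using a by (simp add: lcovers_layer)
    then show "(\<Sum>t\<in>layer a (Suc (Suc r)). 1 * d t y) = 0" unfolding R using d0 by simp
  qed (use a rk_bot in auto)
  then show False unfolding R by simp
qed

lemma cone_nonzero: assumes "\<And>s. s \<in> keys c \<Longrightarrow> l \<notin> s" "c \<noteq> 0" shows "cone_over l c \<noteq> 0"
proof
  assume "cone_over l c = 0"
  obtain s where s: "s \<in> keys c" using assms(2) by fastforce
  have "lookup (cone_over l c) (insert l s) = lookup c s" by (rule lookup_cone(1)) (use assms(1) s in auto)
  then show False using s \<open>cone_over l c = 0\<close> by (simp add: in_keys_iff)
qed

lemma E_nonzero: "a \<in> P \<Longrightarrow> E a \<noteq> 0"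
proof (induction "rk a" arbitrary: a rule: less_induct)
  case less
  show ?case
  proof (cases "rk a")
    case 0
    then have "a = bot" using rk_0 less by blast
    then show ?thesis by (metis E_bot lookup_single_eq lookup_zero zero_neq_one)
  next
    case (Suc r)
    have "Z a \<noteq> 0" by (rule Z_nonzero_step[OF less.prems Suc]) (use less.hyps in \<open>auto simp: lcovers_def\<close>)
    then have "cone_over a (Z a) \<noteq> 0" by (intro cone_nonzero) (use Z_keys[OF less.prems Suc] in auto)
    then show ?thesis unfolding E_eq[OF less.prems Suc] using minus_one_sq[of r "cone_over a (Z a)"] by (metis smul_simps(3))
  qed
qed

lemma Z_nonzero: "a \<in> P \<Longrightarrow> rk a = Suc r \<Longrightarrow> Z a \<noteq> 0"
  using Z_nonzero_step E_nonzero by (auto simp: lcovers_def)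

text \<open>Every cycle of the order complex below \<open>l\<close> is a boundary, or a multiple of \<open>Z l\<close> if it has the top
  dimension. There are no boundaries in the top dimension, so this determines the homology.\<close>

definition sphere_like :: "'p \<Rightarrow> bool" where
  "sphere_like l \<longleftrightarrow> (\<forall>r w. w \<in> ochains r (below l) \<longrightarrow> simp_boundary w = 0 \<longrightarrow>
     (if Suc r = rk l then \<exists>x. w = smul x (Z l)
      else \<exists>v\<in>ochains (Suc r) (below l). simp_boundary v = w))"

lemma chain_card_le:
  assumes s: "s \<in> order_complex Q" and Q: "Q \<subseteq> P - {bot}" "\<And>x. x \<in> Q \<Longrightarrow> rk x \<le> n"
  shows "card s \<le> n"
proof -
  have "inj_on rk s"
  proof (rule inj_onI)
    fix x y assume xy: "x \<in> s" "y \<in> s" "rk x = rk y"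
    then have "x \<le> y \<or> y \<le> x" "x \<in> P" "y \<in> P" using s Q by (auto simp: order_complex_def chain_def)
    then show "x = y" using rk_mono[of x y] rk_mono[of y x] xy(3) by (auto simp: le_less)
  qed
  then have "card s = card (rk ` s)" by (simp add: card_image)
  also have "\<dots> \<le> card {1..n}"
  proof (rule card_mono)
    show "rk ` s \<subseteq> {1..n}"
    proof
      fix k assume "k \<in> rk ` s"
      then obtain x where x: "x \<in> Q" "k = rk x" using s by (auto simp: order_complex_def)
      then have "0 < rk x" using Q(1) rk_pos[of x] by auto
      then show "k \<in> {1..n}" using Q(2)[OF x(1)] x(2) by simp
    qed
  qed simp
  finally show ?thesis by simp
qed

text \<open>All simplices that contain a vertex \<open>l\<close> of maximal rank have \<open>l\<close> on top, so that the star of \<open>l\<close> is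
  the cone over the order complex below \<open>l\<close>.\<close>

lemma link_decomposition:
  fixes z :: "'p set \<Rightarrow>\<^sub>0 'k"
  assumes z: "z \<in> ochains r Q" and Q: "Q \<subseteq> P - {bot}" "l \<in> Q" "\<And>x. x \<in> Q \<Longrightarrow> rk x \<le> rk l"
  obtains w z' where "z = cone_over l w + z'" "z' \<in> ochains r (Q - {l})"
    "\<And>s. s \<in> keys w \<Longrightarrow> s \<in> order_complex (below l \<inter> Q) \<and> Suc (card s) = r"
proof -
  define w where "w = (\<Sum>s\<in>{s \<in> keys z. l \<in> s}. single (s - {l}) (lookup z s))"
  define z' where "z' = (\<Sum>s\<in>{s \<in> keys z. l \<notin> s}. single s (lookup z s))"
  have zk: "s \<in> order_complex Q" "card s = r" if "s \<in> keys z" for s using z that unfolding simp_chains_nat by auto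
  have "cone_over l w + z' = (\<Sum>s\<in>keys z. single s (lookup z s))"
  proof -
    have "cone_over l w = (\<Sum>s\<in>{s \<in> keys z. l \<in> s}. single s (lookup z s))"
      unfolding w_def cone_linear by (rule sum.cong) (auto simp: insert_absorb)
    then have "cone_over l w + z' = (\<Sum>s\<in>{s \<in> keys z. l \<in> s} \<union> {s \<in> keys z. l \<notin> s}. single s (lookup z s))"
      unfolding z'_def by (subst sum.union_disjoint) auto
    also have "{s \<in> keys z. l \<in> s} \<union> {s \<in> keys z. l \<notin> s} = keys z" by auto
    finally show ?thesis .
  qed
  also have "\<dots> = z" using lext_id[of z] by (simp add: lext_def)
  finally have zz: "z = cone_over l w + z'" by simp
  have kz': "keys z' \<subseteq> {s \<in> keys z. l \<notin> s}"
    unfolding z'_def using keys_sum[of "\<lambda>s. single s (lookup z s)" "{s \<in> keys z. l \<notin> s}"]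
    by (auto split: if_splits)
  have z'c: "z' \<in> ochains r (Q - {l})"
    unfolding simp_chains_nat
  proof
    fix s assume "s \<in> keys z'"
    then have "s \<in> keys z" "l \<notin> s" using kz' by auto
    then show "s \<in> order_complex (Q - {l}) \<and> card s = r" using zk[of s] by (auto simp: order_complex_def)
  qed
  have "s \<in> order_complex (below l \<inter> Q) \<and> Suc (card s) = r" if sw: "s \<in> keys w" for s
  proof -
    have "keys w \<subseteq> (\<lambda>s. s - {l}) ` {s \<in> keys z. l \<in> s}"
      unfolding w_def using keys_sum[of "\<lambda>s. single (s - {l}) (lookup z s)" "{s \<in> keys z. l \<in> s}"]
      by (auto split: if_splits)
    then obtain t where t: "t \<in> keys z" "l \<in> t" "s = t - {l}" using sw by auto
    have tc: "finite t" "t \<subseteq> Q" "Complete_Partial_Order.chain (\<le>) t" "card t = r" using zk[OF t(1)] by (auto simp: order_complex_def)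
    have "x \<in> below l" if "x \<in> s" for x
    proof -
      have x: "x \<in> t" "x \<noteq> l" using \<open>x \<in> s\<close> t by auto
      then have "x \<le> l \<or> l \<le> x" using tc(3) t(2) by (auto simp: chain_def)
      moreover have "\<not> l < x" using rk_mono[of l x] Q x tc(2) by fastforce
      ultimately have "x < l" using x(2) by (auto simp: le_less)
      moreover have "bot < x" using Q x tc(2) by (metis DiffD2 bot.not_eq_extremum insertI1 subsetD)
      ultimately show ?thesis using Q x tc(2) by (auto simp: below_def)
    qed
    moreover have "Suc (card s) = r" using t tc by (metis card_Suc_Diff1)
    moreover have "Complete_Partial_Order.chain (\<le>) s" using tc(3) t(3) by (auto simp: chain_def)
    ultimately show ?thesis using tc t by (auto simp: order_complex_def)
  qed
  then show thesis using that[OF zz z'c] by blast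
qed

lemma below_sub: "below l \<subseteq> P - {bot}" by (auto simp: below_def)

lemma simp_cycles_chain_finite:
  "z \<in> simp_chains p (order_complex Q) \<Longrightarrow> s \<in> keys z \<Longrightarrow> finite s \<and> Complete_Partial_Order.chain (\<le>) s"
  by (auto simp: simp_chains_def order_complex_def)

lemma cone_chain:
  assumes u: "u \<in> ochains r (below l \<inter> Q)" and l: "l \<in> Q"
  shows "cone_over l u \<in> ochains (Suc r) Q"
  unfolding simp_chains_nat
proof
  fix s assume "s \<in> keys (cone_over l u)"
  then obtain t where t: "t \<in> keys u" "s = insert l t" using keys_cone[of s l u] by auto
  have tc: "t \<in> order_complex (below l \<inter> Q)" "card t = r" using u t(1) unfolding simp_chains_nat by auto
  have lt: "x < l" if "x \<in> t" for x using tc(1) that by (auto simp: order_complex_def below_def)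
  then have "l \<notin> t" by blast
  moreover have "insert l t \<in> order_complex Q" by (rule order_complex_insert_top[OF tc(1) l _ lt]) auto
  ultimately show "s \<in> order_complex Q \<and> card s = Suc r" using t tc by (simp add: order_complex_def)
qed

text \<open>Removes the vertices of \<open>Q\<close> one by one, a vertex \<open>l\<close> of maximal rank first. Write \<open>z\<close> as the cone
  over a chain \<open>w\<close> below \<open>l\<close> plus a chain without \<open>l\<close>. As \<open>l\<close> does not occur in the boundary of \<open>z\<close>,
  the chain \<open>w\<close> is a cycle. If \<open>l\<close> has rank \<open>r\<close>, then \<open>w\<close> is a multiple of \<open>Z l\<close> and its cone a
  multiple of \<open>E l\<close>; if the rank is larger, then \<open>w\<close> is a boundary and \<open>z\<close> can be changed by the
  boundary of a cone so as to avoid \<open>l\<close>; if it is smaller, then no chain of \<open>Q\<close> has \<open>r\<close> elements.\<close>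

lemma relative_cycle_decomposition:
  fixes z :: "'p set \<Rightarrow>\<^sub>0 'k"
  assumes "finite Q" "Q \<subseteq> P - {bot}" "\<And>x y. x \<in> Q \<Longrightarrow> y \<in> P \<Longrightarrow> bot < y \<Longrightarrow> y \<le> x \<Longrightarrow> y \<in> Q"
    and "\<And>l. l \<in> Q \<Longrightarrow> sphere_like l"
    and "z \<in> ochains r Q"
    and "\<And>s x. s \<in> keys (simp_boundary z) \<Longrightarrow> x \<in> s \<Longrightarrow> rk x < r"
  shows "\<exists>v\<in>ochains (Suc r) Q. \<exists>a.
     z = simp_boundary v + (\<Sum>l\<in>at_rank Q r. smul (a l) (E l))"
  using assms
proof (induction "card Q" arbitrary: Q z rule: less_induct)
  case less
  show ?case
  proof (cases "Q = {}")
    case True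
    have zk: "s = {} \<and> r = 0" if "s \<in> keys z" for s
      using less.prems(5) that unfolding True order_complex_empty simp_chains_nat by auto
    show ?thesis
    proof (cases r)
      case 0
      have "z = smul (lookup z {}) (E bot)"
      proof (rule poly_mapping_eqI)
        fix s show "lookup z s = lookup (smul (lookup z {}) (E bot)) s"
          using zk[of s] by (cases "s = {}") (auto simp: E_bot lookup_single when_def in_keys_iff)
      qed
      moreover have "at_rank Q r = {bot}" using True 0 rk_bot by auto
      ultimately show ?thesis by (intro bexI[of _ 0] exI[of _ "\<lambda>_. lookup z {}"]) (simp_all add: boundary_linear)
    next
      case (Suc r')
      then have "keys z = {}" using zk by blast
      moreover have "at_rank Q r = {}" using True Suc rk_bot by auto
      ultimately show ?thesis by (intro bexI[of _ 0] exI[of _ "\<lambda>_. 0"]) (simp_all add: boundary_linear)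
    qed
  next
    case False
    then have "Max (rk ` Q) \<in> rk ` Q" using less.prems(1) by (intro Max_in) auto
    then obtain l where l: "l \<in> Q" "rk l = Max (rk ` Q)" by (metis imageE)
    have mx: "rk x \<le> rk l" if "x \<in> Q" for x using less.prems(1) l(2) that by simp
    have lP: "l \<in> P" "l \<noteq> bot" using l less.prems(2) by auto
    obtain n where n: "rk l = Suc n" using rk_pos[OF lP] by (cases "rk l") auto
    have belowQ: "below l \<inter> Q = below l"
      using less.prems(3)[OF l(1)] by (auto simp: below_def)
    let ?Q = "Q - {l}"
    have cardQ: "card ?Q < card Q" using less.prems(1) l(1) by (rule card_Diff1_less)
    have lowQ: "y \<in> ?Q" if "x \<in> ?Q" "y \<in> P" "bot < y" "y \<le> x" for x y
    proof -
      have "y \<in> Q" using less.prems(3)[of x y] that by auto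
      moreover have "y \<noteq> l"
      proof
        assume "y = l"
        then have "l < x" using that by (auto simp: le_less)
        then have "rk l < rk x" using rk_mono[of l x] lP that less.prems(2) by auto
        then show False using mx[of x] that by auto
      qed
      ultimately show ?thesis by simp
    qed
    have IH: "\<exists>v\<in>ochains (Suc r) ?Q. \<exists>a.
       y = simp_boundary v + (\<Sum>l\<in>at_rank ?Q r. smul (a l) (E l))"
      if "y \<in> ochains r ?Q" "\<And>s x. s \<in> keys (simp_boundary y) \<Longrightarrow> x \<in> s \<Longrightarrow> rk x < r" for y
    proof (rule less.hyps[OF cardQ])
      show "finite ?Q" "?Q \<subseteq> P - {bot}" using less.prems(1,2) by auto
      show "y \<in> ?Q" if "x \<in> ?Q" "y \<in> P" "bot < y" "y \<le> x" for x y by (rule lowQ[OF that])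
      show "sphere_like l" if "l \<in> ?Q" for l using less.prems(4) that by blast
      show "y \<in> ochains r ?Q" by (rule that(1))
      show "rk x < r" if "s \<in> keys (simp_boundary y)" "x \<in> s" for s x by (rule \<open>\<And>s x. s \<in> keys (simp_boundary y) \<Longrightarrow> x \<in> s \<Longrightarrow> rk x < r\<close>[OF that])
    qed
    have sub: "ochains (Suc r) ?Q \<subseteq> (ochains (Suc r) Q :: ('p set \<Rightarrow>\<^sub>0 'k) set)"
      using simp_chains_mono[OF order_complex_mono[of ?Q Q]] by auto
    obtain w z' where wz: "z = cone_over l w + z'" "z' \<in> ochains r ?Q"
      and w: "\<And>s. s \<in> keys w \<Longrightarrow> s \<in> order_complex (below l \<inter> Q) \<and> Suc (card s) = r"
      by (rule link_decomposition[OF less.prems(5,2) l(1)]) (rule mx, assumption, rule that, assumption+)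
    show ?thesis
    proof (cases "rk l < r")
      case True
      have "keys z = {}"
        using less.prems(5) chain_card_le[OF _ less.prems(2) mx] True unfolding simp_chains_nat by fastforce
      then have "z = 0" by simp
      then show ?thesis by (intro bexI[of _ 0] exI[of _ "\<lambda>_. 0"]) (simp_all add: boundary_linear)
    next
      case False
      show ?thesis
      proof (cases r)
        case 0
        have "w = 0" using w 0 by (metis keys_eq_empty all_not_in_conv nat.distinct(1))
        then have zz: "z = z'" using wz by (simp add: cone_linear)
        obtain v a where va: "v \<in> ochains (Suc r) ?Q"
          "z = simp_boundary v + (\<Sum>l\<in>at_rank ?Q r. smul (a l) (E l))"
          using IH[of z] wz(2) less.prems(6) unfolding zz by blast
        have "at_rank ?Q r = at_rank Q r" using n 0 by auto
        then show ?thesis using va sub by (intro bexI[of _ v] exI[of _ a]) auto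
      next
        case (Suc r')
        have wc: "w \<in> ochains r' (below l)"
          unfolding simp_chains_nat using w Suc belowQ by auto
        have wk: "finite s \<and> card s = r' \<and> (\<forall>x\<in>s. x < l)" if "s \<in> keys w" for s
          using wc that unfolding simp_chains_nat by (auto simp: order_complex_def below_def)
        have bc: "simp_boundary (cone_over l w) = cone_over l (simp_boundary w) + smul ((-1) ^ r') w"
          by (rule boundary_cone) (rule wk)
        have nol: "l \<notin> s" if "s \<in> keys w" for s using wk[OF that] by blast
        have nolb: "l \<notin> s" if s: "s \<in> keys (simp_boundary w)" for s
          using keys_boundary[OF s] nol by auto
        have nolz: "l \<notin> s" if "s \<in> keys z'" for s
          using wz(2) that unfolding simp_chains_nat by (auto simp: order_complex_def)
        have nolbz: "l \<notin> s" if s: "s \<in> keys (simp_boundary z')" for s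
          using keys_boundary[OF s] nolz by auto
        \<comment> \<open>A simplex \<open>t\<close> in the boundary of \<open>w\<close> would give the simplex \<open>insert l t\<close> in the boundary of \<open>z\<close>.\<close>
        have bw: "simp_boundary w = 0"
        proof (rule ccontr)
          assume "simp_boundary w \<noteq> 0"
          then obtain t where t: "t \<in> keys (simp_boundary w)" by fastforce
          have lt: "l \<notin> t" by (rule nolb[OF t])
          have "lookup (simp_boundary z) (insert l t) = lookup (cone_over l (simp_boundary w)) (insert l t)
             + (-1) ^ r' * lookup w (insert l t) + lookup (simp_boundary z') (insert l t)"
            unfolding wz(1) boundary_linear bc by (simp add: lookup_add)
          also have "lookup (cone_over l (simp_boundary w)) (insert l t) = lookup (simp_boundary w) t"
            by (rule lookup_cone(1)[OF nolb lt])
          also have "lookup w (insert l t) = 0" using nol[of "insert l t"] by (auto simp: in_keys_iff)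
          also have "lookup (simp_boundary z') (insert l t) = 0" using nolbz[of "insert l t"] by (auto simp: in_keys_iff)
          finally have "insert l t \<in> keys (simp_boundary z)" using t by (simp add: in_keys_iff)
          then have "rk l < r" using less.prems(6) by blast
          then show False using False by simp
        qed
        have sl: "sphere_like l" by (rule less.prems(4)[OF l(1)])
        show ?thesis
        proof (cases "rk l = r")
          case True
          then have "Suc r' = rk l" using Suc by simp
          then obtain x where x: "w = smul x (Z l)" using sl wc bw unfolding sphere_like_def by metis
          have E: "E l = smul ((-1) ^ r') (cone_over l (Z l))" by (rule E_eq[OF lP(1)]) (use True Suc in simp)
          define x' where "x' = x * (-1) ^ r'"
          have cw: "cone_over l w = smul x' (E l)"
            unfolding x cone_linear E x'_def by (simp add: mult.assoc flip: power_mult_distrib)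
          have bb: "rk y < r" if s: "s \<in> keys (simp_boundary z')" "y \<in> s" for s y
          proof -
            have "simp_boundary z' = simp_boundary z - smul x' (Z l)"
              unfolding wz(1) boundary_linear cw boundary_E_Z[OF lP(1)] by simp
            then have "s \<in> keys (simp_boundary z) \<union> keys (smul x' (Z l))" using s(1) keys_diff by (metis subsetD)
            then show ?thesis
            proof
              assume "s \<in> keys (smul x' (Z l))"
              then have "s \<in> keys (Z l)" using keys_smul[of x' "Z l"] by auto
              from Z_keys(4)[OF lP(1) n this s(2)] show ?thesis using rk_mono[of y l] lP True by auto
            qed (use less.prems(6) s(2) in blast)
          qed
          have "\<exists>v\<in>ochains (Suc r) ?Q. \<exists>a.
             z' = simp_boundary v + (\<Sum>l\<in>at_rank ?Q r. smul (a l) (E l))"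
            by (rule IH[OF wz(2)]) (rule bb)
          then obtain v a where va: "v \<in> ochains (Suc r) ?Q"
            "z' = simp_boundary v + (\<Sum>l\<in>at_rank ?Q r. smul (a l) (E l))"
            by blast
          have set: "at_rank Q r = insert l (at_rank ?Q r)"
            using l(1) True lP by auto
          have nin: "l \<notin> at_rank ?Q r" using lP by auto
          have fin: "finite (at_rank ?Q r)" using less.prems(1) by simp
          have "(\<Sum>m\<in>at_rank Q r. smul ((a(l := x')) m) (E m))
            = smul x' (E l) + (\<Sum>m\<in>at_rank ?Q r. smul ((a(l := x')) m) (E m))"
            unfolding set using fin nin by (subst sum.insert) auto
          also have "(\<Sum>m\<in>at_rank ?Q r. smul ((a(l := x')) m) (E m)) = (\<Sum>m\<in>at_rank ?Q r. smul (a m) (E m))"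
            by (rule sum.cong[OF refl]) (use nin in auto)
          finally have "z = simp_boundary v + (\<Sum>m\<in>at_rank Q r. smul ((a(l := x')) m) (E m))"
            unfolding wz(1) cw va(2) by (simp add: algebra_simps)
          then show ?thesis using va(1) sub by blast
        next
          case ne: False
          then obtain u where u: "u \<in> ochains (Suc r') (below l)" "simp_boundary u = w"
            using sl wc bw Suc unfolding sphere_like_def by (metis)
          have uk: "finite s \<and> card s = r \<and> (\<forall>x\<in>s. x < l)" if "s \<in> keys u" for s
            using u(1) that Suc unfolding simp_chains_nat by (auto simp: order_complex_def below_def)
          have bcu: "simp_boundary (cone_over l u) = cone_over l w + smul ((-1) ^ r) u"
            unfolding u(2)[symmetric] by (rule boundary_cone) (rule uk)
          have cu: "cone_over l u \<in> ochains (Suc r) Q"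
            by (rule cone_chain[OF _ l(1)]) (use u(1) belowQ Suc in simp)
          define y where "y = z' - smul ((-1) ^ r) u"
          have zy: "z = simp_boundary (cone_over l u) + y" unfolding y_def bcu wz(1) by simp
          have uQ: "u \<in> ochains r ?Q"
          proof (rule simp_chains_mono)
            show "order_complex (below l) \<subseteq> order_complex ?Q"
              by (rule order_complex_mono) (use belowQ in \<open>auto simp: below_def\<close>)
          qed (use u(1) Suc in simp)
          have yc: "y \<in> ochains r ?Q"
            unfolding y_def by (intro simp_chains_diff wz(2) simp_chains_smul uQ)
          have "simp_boundary (simp_boundary (cone_over l u)) = 0"
            by (rule boundary_boundary) (rule simp_cycles_chain_finite[OF cu])
          then have by_: "simp_boundary y = simp_boundary z" unfolding zy boundary_linear by simp
          obtain v a where va: "v \<in> ochains (Suc r) ?Q"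
            "y = simp_boundary v + (\<Sum>l\<in>at_rank ?Q r. smul (a l) (E l))"
            using IH[OF yc] less.prems(6) unfolding by_ by blast
          have set: "at_rank ?Q r = at_rank Q r" using ne by auto
          have "z = simp_boundary (cone_over l u + v) + (\<Sum>l\<in>at_rank Q r. smul (a l) (E l))"
            unfolding zy va(2) set boundary_linear by simp
          moreover have "cone_over l u + v \<in> ochains (Suc r) Q"
            using cu va(1) sub by (intro simp_chains_add) auto
          ultimately show ?thesis by blast
        qed
      qed
    qed
  qed
qed

text \<open>Induction on the rank. Up to a boundary a cycle \<open>w\<close> is a combination of the chains \<open>E m\<close>, with \<open>m\<close>
  of rank \<open>r\<close>. The boundary of this combination vanishes, and the chains \<open>E t\<close> one rank
  below are independent, so the coefficients form a cellular cycle. By exactness they are a cellular boundary, and the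
  combination is one of the chains \<open>Z u\<close>, which are the boundaries of \<open>E u\<close>. In the top dimension the
  only such \<open>u\<close> is \<open>l\<close> itself, whose \<open>E l\<close> is not a chain below \<open>l\<close>.\<close>

theorem sphere_like_all: "l \<in> P \<Longrightarrow> l \<noteq> bot \<Longrightarrow> sphere_like l"
proof (induction "rk l" arbitrary: l rule: less_induct)
  case less
  note lP = less.prems
  obtain n where n: "rk l = Suc n" using rk_pos[OF lP] by (cases "rk l") auto
  have finB: "finite (below l)" by (rule finite_subset[OF _ fin_below[OF lP(1)]]) (auto simp: below_def)
  have main: "if Suc r = rk l then \<exists>x. w = smul x (Z l)
      else \<exists>v\<in>ochains (Suc r) (below l). simp_boundary v = w"
    if w: "w \<in> ochains r (below l)" and cyc: "simp_boundary w = 0" for r w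
  proof -
    have rkb: "rk x \<le> n" if "x \<in> below l" for x
      using rk_mono[of x l] that lP n by (auto simp: below_def)
    have top: "c = 0" if "c \<in> ochains q (below l)" "n < q" for c :: "'p set \<Rightarrow>\<^sub>0 'k" and q
    proof -
      have "keys c = {}" using that chain_card_le[OF _ below_sub rkb] unfolding simp_chains_nat by fastforce
      then show ?thesis by simp
    qed
    have "\<exists>v\<in>ochains (Suc r) (below l). \<exists>a.
       w = simp_boundary v + (\<Sum>m\<in>at_rank (below l) r. smul (a m) (E m))"
    proof (rule relative_cycle_decomposition[OF finB below_sub])
      show "sphere_like m" if "m \<in> below l" for m
        by (rule less.hyps) (use that rk_mono[of m l] lP in \<open>auto simp: below_def\<close>)
    qed (use w cyc in \<open>auto simp: below_def\<close>)
    then obtain v a where v: "v \<in> ochains (Suc r) (below l)"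
      and va: "w = simp_boundary v + (\<Sum>m\<in>at_rank (below l) r. smul (a m) (E m))" by blast
    let ?R = "\<lambda>q. layer l (Suc q)"
    show ?thesis
    proof (cases "n < r")
      case True
      then have "w = 0" using top[OF w] by simp
      then show ?thesis using True n by (auto intro!: bexI[of _ 0] simp: boundary_linear)
    next
      case False
      then have rn: "r \<le> n" by simp
      have "bot < l" using lP by (simp add: bot.not_eq_extremum)
      then have RR: "at_rank (below l) r = ?R r"
        using bot_in rn n by (auto simp: below_def rank_layer_def le_less bot.not_eq_extremum)
      have bv: "simp_boundary (simp_boundary v) = 0"
        by (rule boundary_boundary) (rule simp_cycles_chain_finite[OF v])
      have s0: "(\<Sum>m\<in>?R r. smul (a m) (Z m)) = 0"
      proof -
        have "0 = simp_boundary w" using cyc by simp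
        also have "\<dots> = (\<Sum>m\<in>?R r. smul (a m) (simp_boundary (E m)))"
          unfolding va boundary_linear bv RR by simp
        also have "\<dots> = (\<Sum>m\<in>?R r. smul (a m) (Z m))"
          by (rule sum.cong) (auto simp: boundary_E_Z rank_layer_def)
        finally show ?thesis by simp
      qed
      have "\<exists>b. \<forall>t\<in>?R r. a t = (\<Sum>u\<in>?R (Suc r). b u * d u t)"
      proof (rule exact[OF lP])
        fix y assume y: "y \<in> layer l r"
        have "0 = (\<Sum>m\<in>?R r. \<Sum>t\<in>layer l r. smul (a m * d m t) (E t))"
          unfolding s0[symmetric]
          by (rule sum.cong) (use lP in \<open>auto simp: Z_layer[of l _ r] smul_sum rank_layer_def\<close>)
        also have "\<dots> = (\<Sum>t\<in>layer l r. smul (\<Sum>m\<in>?R r. a m * d m t) (E t))"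
          unfolding smul_sum by (rule sum.swap)
        finally have e: "(\<Sum>t\<in>layer l r. smul (\<Sum>m\<in>?R r. a m * d m t) (E t)) = 0" by simp
        show "(\<Sum>t\<in>?R r. a t * d t y) = 0"
          by (rule E_independent[OF finite_layer[OF lP(1)] _ _ _ e y, of "r - 1"]) (use E_nonzero in \<open>auto simp: rank_layer_def\<close>)
      qed
      then obtain b where b: "\<And>t. t \<in> ?R r \<Longrightarrow> a t = (\<Sum>u\<in>?R (Suc r). b u * d u t)" by blast
      have "(\<Sum>t\<in>?R r. smul (a t) (E t)) = (\<Sum>t\<in>?R r. \<Sum>u\<in>?R (Suc r). smul (b u * d u t) (E t))"
        by (rule sum.cong[OF refl]) (simp only: b smul_sum)
      also have "\<dots> = (\<Sum>u\<in>?R (Suc r). \<Sum>t\<in>?R r. smul (b u * d u t) (E t))" by (rule sum.swap)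
      also have "\<dots> = (\<Sum>u\<in>?R (Suc r). smul (b u) (Z u))"
        by (rule sum.cong[OF refl]) (use lP in \<open>auto simp: Z_layer[of l _ "Suc r"] smul_sum rank_layer_def\<close>)
      finally have aE: "(\<Sum>t\<in>?R r. smul (a t) (E t)) = (\<Sum>u\<in>?R (Suc r). smul (b u) (Z u))" .
      show ?thesis
      proof (cases "Suc r = rk l")
        case True
        have "?R (Suc r) = {l}" using True lP rk_mono[of _ l] by (force simp: rank_layer_def le_less)
        moreover have "v = 0" by (rule top[OF v]) (use True n in simp)
        ultimately have "w = smul (b l) (Z l)" unfolding va RR aE by (simp add: boundary_linear)
        then show ?thesis using True by auto
      next
        case ne: False
        have "(\<Sum>u\<in>?R (Suc r). smul (b u) (E u)) \<in> ochains (Suc r) (below l)"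
        proof (rule simp_chains_sum, rule simp_chains_smul, rule simp_chains_mono)
          fix u assume u: "u \<in> ?R (Suc r)"
          then have "u \<in> P" "u < l" "rk u = Suc r" using ne by (auto simp: rank_layer_def le_less)
          then show "order_complex {x \<in> P. bot < x \<and> x \<le> u} \<subseteq> order_complex (below l)"
            by (intro order_complex_mono) (auto simp: below_def)
          show "E u \<in> ochains (Suc r) {x \<in> P. bot < x \<and> x \<le> u}"
            using E_chain[of u] \<open>u \<in> P\<close> \<open>rk u = Suc r\<close> by simp
        qed
        moreover have "simp_boundary (\<Sum>u\<in>?R (Suc r). smul (b u) (E u)) = (\<Sum>u\<in>?R (Suc r). smul (b u) (Z u))"
          unfolding boundary_linear by (rule sum.cong) (auto simp: boundary_E_Z rank_layer_def)
        ultimately show ?thesis using v ne unfolding va RR aE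
          by (intro if_not_P[THEN iffD2]) (auto intro!: bexI[of _ "v + (\<Sum>u\<in>?R (Suc r). smul (b u) (E u))"] simp_chains_add simp: boundary_linear)
      qed
    qed
  qed
  show ?case unfolding sphere_like_def using main by blast
qed

end

section \<open>Cyclic modules and tensor products\<close>

text \<open>The operations of \<open>V\<close> are images of those of the ring, so \<open>V\<close> is a quotient of the ring itself. Both
  the lines and the zero modules among the summands are of this kind, and so are their tensor
  products with the polynomial ring; this transports all computations to polynomials.\<close>

locale cyclic_image =
  fixes V :: "('r::comm_ring_1, 'v, 'z) module_scheme" and \<rho> :: "'r \<Rightarrow> 'v"
  assumes carrier_eq: "carrier V = range \<rho>" and zero_eq: "\<zero>\<^bsub>V\<^esub> = \<rho> 0"
    and add_eq: "\<And>x y. \<rho> x \<oplus>\<^bsub>V\<^esub> \<rho> y = \<rho> (x + y)"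
    and smult_eq: "\<And>r x. r \<odot>\<^bsub>V\<^esub> \<rho> x = \<rho> (r * x)"
begin

lemma abelian_monoid_V: "abelian_monoid V"
  by (rule abelian_monoidI) (auto simp: carrier_eq zero_eq add_eq ac_simps)

lemma finsum_eq: "finsum V (\<lambda>b. \<rho> (f b)) A = \<rho> (sum f A)"
proof -
  interpret abelian_monoid V by (rule abelian_monoid_V)
  show ?thesis
  proof (induction A rule: infinite_finite_induct)
    case (infinite A)
    then show ?case by (simp add: zero_eq)
  next
    case empty
    then show ?case by (simp add: zero_eq)
  next
    case (insert a A)
    then show ?case by (subst finsum_insert) (auto simp: carrier_eq add_eq)
  qed
qed

lemma finsum_cong_eq: "(\<And>b. b \<in> A \<Longrightarrow> h b = \<rho> (f b)) \<Longrightarrow> finsum V h A = \<rho> (sum f A)"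
  using abelian_monoid.finsum_cong'[OF abelian_monoid_V refl, of "\<lambda>b. \<rho> (f b)" A h] finsum_eq[of f A]
  by (simp add: carrier_eq)

end

lemma vec_add_iff: fixes a l q :: "nat ^ 'n" shows "a = l + q \<longleftrightarrow> l \<le> a \<and> q = a - l"
  by (auto simp: vec_eq_iff less_eq_vec_def)

lemma lookup_times_mpol:
  fixes p r :: "('n::finite, 'k::comm_ring_1) mpol"
  shows "lookup (r * p) a = (\<Sum>b\<in>{b \<in> keys r. b \<le> a}. lookup r b * lookup p (a - b))"
proof -
  have inner: "Sum_any (\<lambda>q. lookup p q when a = l + q) = (if l \<le> a then lookup p (a - l) else 0)" for l
  proof (cases "l \<le> a")
    case True
    then have "(\<lambda>q. lookup p q when a = l + q) = (\<lambda>q. lookup p q when q = a - l)"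
      using vec_add_iff[of a l] by (auto simp: when_def)
    then have "Sum_any (\<lambda>q. lookup p q when a = l + q) = Sum_any (\<lambda>q. lookup p q when q = a - l)"
      by (rule arg_cong)
    also have "\<dots> = lookup p (a - l)" by (rule Sum_any_when_equal)
    finally show ?thesis using True by (simp only: if_True)
  next
    case False
    then have "(\<lambda>q. lookup p q when a = l + q) = (\<lambda>q. 0)"
      using vec_add_iff[of a l] by (auto simp: when_def)
    then have "Sum_any (\<lambda>q. lookup p q when a = l + q) = Sum_any (\<lambda>q::nat ^ 'n. 0::'k)"
      by (rule arg_cong)
    also have "Sum_any (\<lambda>q::nat ^ 'n. 0::'k) = 0" by simp
    finally show ?thesis using False by (simp only: if_False)
  qed
  have "lookup (r * p) a = Sum_any (\<lambda>l. lookup r l * (if l \<le> a then lookup p (a - l) else 0))"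
    by (simp add: lookup_mult inner)
  also have "\<dots> = (\<Sum>l\<in>keys r. lookup r l * (if l \<le> a then lookup p (a - l) else 0))"
    by (rule Sum_any.expand_superset) (auto simp: in_keys_iff)
  also have "\<dots> = (\<Sum>l\<in>{b \<in> keys r. b \<le> a}. lookup r l * lookup p (a - l))"
    by (rule sum.mono_neutral_cong_right) auto
  finally show ?thesis .
qed

lemma lookup_times_single:
  fixes p :: "('n::finite, 'k::comm_ring_1) mpol"
  shows "lookup (p * single m c) a = (if m \<le> a then lookup p (a - m) * c else 0)"
proof -
  have "lookup (single m c * p) a = (\<Sum>b\<in>{b \<in> {m}. b \<le> a}. lookup (single m c) b * lookup p (a - b))"
    unfolding lookup_times_mpol by (rule sum.mono_neutral_left) (auto simp: in_keys_iff lookup_single when_def split: if_splits)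
  also have "{b \<in> {m}. b \<le> a} = (if m \<le> a then {m} else {})" by auto
  finally show ?thesis by (simp add: mult.commute)
qed

definition tensor_of :: "('k \<Rightarrow> 'v) \<Rightarrow> ('n::finite, 'k::field) mpol \<Rightarrow> nat ^ 'n \<Rightarrow> 'v" where
  "tensor_of \<rho> p = (\<lambda>a. \<rho> (lookup p a))"

text \<open>The map \<open>tensor_of \<rho>\<close> is \<open>1 \<otimes> \<rho>\<close>: it applies \<open>\<rho>\<close> to each coefficient of a polynomial.\<close>

lemma tensor_cyclic_image:
  fixes V :: "('k::field, 'v) module"
  assumes V: "cyclic_image V \<rho>"
  shows "cyclic_image (mpol_tensor s V :: (('n::finite, 'k) mpol, nat ^ 'n \<Rightarrow> 'v, int ^ 'n) gmodule) (tensor_of \<rho>)"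
proof -
  interpret cyclic_image V \<rho> by fact
  let ?M = "mpol_tensor s V :: (('n, 'k) mpol, nat ^ 'n \<Rightarrow> 'v, int ^ 'n) gmodule"
  show ?thesis
  proof
    show "carrier ?M = range (tensor_of \<rho>)"
    proof (intro equalityI subsetI)
      fix u assume "u \<in> carrier ?M"
      then have u: "range u \<subseteq> range \<rho>" "finite {a. u a \<noteq> \<rho> 0}" by (auto simp: mpol_tensor_def Let_def carrier_eq zero_eq)
      define f where "f = (\<lambda>a. if u a = \<rho> 0 then 0 else SOME x. \<rho> x = u a)"
      have f: "\<rho> (f a) = u a" for a
      proof (cases "u a = \<rho> 0")
        case False
        have "\<exists>x. \<rho> x = u a" using u(1) by (metis rangeI rangeE subsetD)
        from someI_ex[OF this] show ?thesis using False by (simp add: f_def)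
      qed (simp add: f_def)
      have "{a. f a \<noteq> 0} \<subseteq> {a. u a \<noteq> \<rho> 0}" by (auto simp: f_def)
      then have "finite {a. f a \<noteq> 0}" using u(2) finite_subset by blast
      then have "lookup (Abs_poly_mapping f) = f" by (simp add: Abs_poly_mapping_inverse)
      then have "tensor_of \<rho> (Abs_poly_mapping f) = u" by (simp add: tensor_of_def f)
      then show "u \<in> range (tensor_of \<rho>)" by blast
    next
      fix u assume "u \<in> range (tensor_of \<rho> :: ('n, 'k) mpol \<Rightarrow> _)"
      then obtain p where p: "u = tensor_of \<rho> p" by blast
      have "{a. u a \<noteq> \<rho> 0} \<subseteq> keys p" by (auto simp: p tensor_of_def in_keys_iff)
      then have "finite {a. u a \<noteq> \<rho> 0}" using finite_subset finite_keys by blast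
      then show "u \<in> carrier ?M" by (auto simp: p mpol_tensor_def Let_def carrier_eq zero_eq tensor_of_def)
    qed
    show "\<zero>\<^bsub>?M\<^esub> = tensor_of \<rho> 0" by (simp add: mpol_tensor_def Let_def zero_eq tensor_of_def)
    show "tensor_of \<rho> x \<oplus>\<^bsub>?M\<^esub> tensor_of \<rho> y = tensor_of \<rho> (x + y)" for x y
      by (simp add: mpol_tensor_def Let_def add_eq tensor_of_def lookup_add)
    show "r \<odot>\<^bsub>?M\<^esub> tensor_of \<rho> x = tensor_of \<rho> (r * x)" for r x
      by (simp add: mpol_tensor_def Let_def tensor_of_def smult_eq finsum_eq lookup_times_mpol)
  qed
qed

lemma tensor_hcomp:
  fixes V :: "('k::field, 'v) module" and p :: "('n::finite, 'k) mpol"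
  assumes V: "cyclic_image V \<rho>" and inj: "inj \<rho>"
  shows "tensor_of \<rho> p \<in> hcomp (mpol_tensor s V) d \<longleftrightarrow> p \<in> hcomp (mpol_gmodule s) d"
proof -
  interpret cyclic_image V \<rho> by fact
  interpret T: cyclic_image "mpol_tensor s V :: (('n, 'k) mpol, nat ^ 'n \<Rightarrow> 'v, int ^ 'n) gmodule" "tensor_of \<rho>"
    by (rule tensor_cyclic_image[OF V])
  have "tensor_of \<rho> p \<in> carrier (mpol_tensor s V :: (('n, 'k) mpol, nat ^ 'n \<Rightarrow> 'v, int ^ 'n) gmodule)"
    by (simp add: T.carrier_eq)
  moreover have "tensor_of \<rho> p a \<noteq> \<rho> 0 \<longleftrightarrow> a \<in> keys p" for a
    using inj by (auto simp: tensor_of_def in_keys_iff inj_eq)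
  ultimately show ?thesis
    by (auto simp: mpol_tensor_def mpol_gmodule_def Let_def zero_eq)
qed

lemma tensor_inj: "inj \<rho> \<Longrightarrow> inj (tensor_of \<rho>)"
  by (rule injI) (auto simp: tensor_of_def fun_eq_iff inj_eq intro: poly_mapping_eqI)

lemma xpow_tensor_of:
  fixes W :: "('k::field, 'w) module" and p :: "('n::finite, 'k) mpol"
  assumes W: "cyclic_image W \<rho>'" and \<phi>: "\<And>x. \<phi> (\<rho> x) = \<rho>' (x * c)"
  shows "xpow_tensor W m \<phi> (tensor_of \<rho> p) = tensor_of \<rho>' (p * single m c)"
  by (auto simp: xpow_tensor_def tensor_of_def fun_eq_iff lookup_times_single \<phi> cyclic_image.zero_eq[OF W])

section \<open>Homology of the open intervals and the connecting maps\<close>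

lemma boundaries_subspace:
  "0 \<in> simp_boundaries p L" "a \<in> simp_boundaries p L \<Longrightarrow> b \<in> simp_boundaries p L \<Longrightarrow> a + b \<in> simp_boundaries p L"
  "a \<in> simp_boundaries p L \<Longrightarrow> smul r a \<in> simp_boundaries p L"
  "a \<in> simp_boundaries p L \<Longrightarrow> b \<in> simp_boundaries p L \<Longrightarrow> a - b \<in> simp_boundaries p L"
proof -
  show "0 \<in> simp_boundaries p L" unfolding simp_boundaries_def by (rule image_eqI[of _ _ 0]) (simp_all add: boundary_linear)
  show "a \<in> simp_boundaries p L \<Longrightarrow> b \<in> simp_boundaries p L \<Longrightarrow> a + b \<in> simp_boundaries p L"
    unfolding simp_boundaries_def by (auto simp flip: boundary_linear intro!: imageI simp_chains_add)
  show "a \<in> simp_boundaries p L \<Longrightarrow> b \<in> simp_boundaries p L \<Longrightarrow> a - b \<in> simp_boundaries p L"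
    unfolding simp_boundaries_def by (auto simp flip: boundary_linear intro!: imageI simp_chains_diff)
  show "a \<in> simp_boundaries p L \<Longrightarrow> smul r a \<in> simp_boundaries p L"
    unfolding simp_boundaries_def by (auto simp flip: boundary_linear intro!: imageI simp_chains_smul)
qed

lemma homology_class_eq_iff:
  "homology_class p L x = homology_class p L y \<longleftrightarrow> x - y \<in> simp_boundaries p L"
proof
  assume "homology_class p L x = homology_class p L y"
  moreover have "x \<in> homology_class p L x" unfolding homology_class_def using boundaries_subspace(1) by force
  ultimately obtain b where "x = y + b" "b \<in> simp_boundaries p L" unfolding homology_class_def by auto
  then show "x - y \<in> simp_boundaries p L" by simp
next
  assume xy: "x - y \<in> simp_boundaries p L"
  show "homology_class p L x = homology_class p L y"
  proof (intro equalityI subsetI)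
    fix z assume "z \<in> homology_class p L x"
    then obtain b where "z = x + b" "b \<in> simp_boundaries p L" unfolding homology_class_def by auto
    then have "z = y + ((x - y) + b)" "(x - y) + b \<in> simp_boundaries p L" using boundaries_subspace(2)[OF xy] by auto
    then show "z \<in> homology_class p L y" unfolding homology_class_def by blast
  next
    fix z assume "z \<in> homology_class p L y"
    then obtain b where "z = y + b" "b \<in> simp_boundaries p L" unfolding homology_class_def by auto
    then have "z = x + (b - (x - y))" "b - (x - y) \<in> simp_boundaries p L" using boundaries_subspace(4)[OF _ xy] by auto
    then show "z \<in> homology_class p L x" unfolding homology_class_def by blast
  qed
qed

text \<open>If the cycles are the multiples of one chain \<open>g\<close> up to boundaries, then the homology is spanned
  by the class of \<open>g\<close>.\<close>

lemma homology_cyclic: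
  fixes g :: "'p::order set \<Rightarrow>\<^sub>0 'k::field"
  assumes cyc: "\<And>z. z \<in> simp_cycles p L \<longleftrightarrow> (\<exists>x. z - smul x g \<in> simp_boundaries p L)"
  shows "cyclic_image (reduced_homology p L :: ('k, _) module) (\<lambda>x. homology_class p L (smul x g))"
proof
  let ?H = "reduced_homology p L :: ('k, ('p set \<Rightarrow>\<^sub>0 'k) set) module"
  let ?c = "\<lambda>x. homology_class p L (smul x g)"
  let ?B = "simp_boundaries p L"
  show "carrier ?H = range ?c"
  proof (intro equalityI subsetI)
    fix C assume "C \<in> carrier ?H"
    then obtain z where z: "z \<in> simp_cycles p L" "C = homology_class p L z" by (auto simp: reduced_homology_def)
    then obtain x where "z - smul x g \<in> ?B" using cyc by blast
    then have "C = ?c x" unfolding z(2) homology_class_eq_iff .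
    then show "C \<in> range ?c" by blast
  next
    fix C assume "C \<in> range ?c"
    then obtain x where x: "C = ?c x" by blast
    have "smul x g \<in> simp_cycles p L" unfolding cyc using boundaries_subspace(1) by (intro exI[of _ x]) simp
    then show "C \<in> carrier ?H" unfolding x by (simp add: reduced_homology_def)
  qed
  show "\<zero>\<^bsub>?H\<^esub> = ?c 0" by (simp add: reduced_homology_def homology_class_def)
  show "?c x \<oplus>\<^bsub>?H\<^esub> ?c y = ?c (x + y)" for x y
  proof -
    have "{a + b |a b. a \<in> ?c x \<and> b \<in> ?c y} = ?c (x + y)"
    proof (intro equalityI subsetI)
      fix z assume "z \<in> {a + b |a b. a \<in> ?c x \<and> b \<in> ?c y}"
      then obtain b b' where "z = (smul x g + b) + (smul y g + b')" "b \<in> ?B" "b' \<in> ?B" by (auto simp: homology_class_def)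
      then have "z = smul (x + y) g + (b + b')" "b + b' \<in> ?B" using boundaries_subspace(2) by (auto simp: smul_add)
      then show "z \<in> ?c (x + y)" unfolding homology_class_def by blast
    next
      fix z assume "z \<in> ?c (x + y)"
      then obtain b where b: "z = smul (x + y) g + b" "b \<in> ?B" by (auto simp: homology_class_def)
      then have "z = (smul x g + b) + (smul y g + 0)" by (simp add: smul_add)
      moreover have "smul x g + b \<in> ?c x" "smul y g + 0 \<in> ?c y"
        unfolding homology_class_def using b(2) boundaries_subspace(1) by blast+
      ultimately show "z \<in> {a + b |a b. a \<in> ?c x \<and> b \<in> ?c y}" by blast
    qed
    then show ?thesis by (simp add: reduced_homology_def)
  qed
  show "r \<odot>\<^bsub>?H\<^esub> ?c x = ?c (r * x)" for r x
  proof -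
    have "{smul r a + b |a b. a \<in> ?c x \<and> b \<in> ?B} = ?c (r * x)"
    proof (intro equalityI subsetI)
      fix z assume "z \<in> {smul r a + b |a b. a \<in> ?c x \<and> b \<in> ?B}"
      then obtain b b' where "z = smul r (smul x g + b) + b'" "b \<in> ?B" "b' \<in> ?B" by (auto simp: homology_class_def)
      then have "z = smul (r * x) g + (smul r b + b')" "smul r b + b' \<in> ?B"
        using boundaries_subspace(2)[OF boundaries_subspace(3)] by (auto simp: smul_add)
      then show "z \<in> ?c (r * x)" unfolding homology_class_def by blast
    next
      fix z assume "z \<in> ?c (r * x)"
      then obtain b where b: "z = smul (r * x) g + b" "b \<in> ?B" by (auto simp: homology_class_def)
      then have "z = smul r (smul x g + 0) + b" by simp
      moreover have "smul x g + 0 \<in> ?c x"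
        unfolding homology_class_def using boundaries_subspace(1) by blast
      ultimately show "z \<in> {smul r a + b |a b. a \<in> ?c x \<and> b \<in> ?B}" using b(2) by blast
    qed
    then show ?thesis by (simp add: reduced_homology_def smul_def)
  qed
qed

context graded_acyclic_poset begin

lemma Delta_open_below: "Delta_open P a = order_complex (below a)"
  by (simp add: Delta_open_def below_def)

text \<open>Generator, degree and complex of the homology that belongs to \<open>a\<close> in the \<open>i\<close>-th term of the poset
  sequence. The generator is \<open>0\<close> where the homology vanishes.\<close>

definition zgen :: "nat \<Rightarrow> 'p \<Rightarrow> ('p set \<Rightarrow>\<^sub>0 'k)" where
  "zgen i a = (if i = 0 then single {} 1 else if rk a = i then Z a else 0)"

definition zdeg :: "nat \<Rightarrow> int" where "zdeg i = (if i = 0 then -1 else int i - 2)"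

definition zcomplex :: "nat \<Rightarrow> 'p \<Rightarrow> 'p set set" where
  "zcomplex i a = (if i = 0 then {{}} else order_complex (below a))"

definition zclass :: "nat \<Rightarrow> 'p \<Rightarrow> 'k \<Rightarrow> ('p set \<Rightarrow>\<^sub>0 'k) set" where
  "zclass i a x = homology_class (zdeg i) (zcomplex i a) (smul x (zgen i a))"

lemma D_space_eq: "D_space P i a = (reduced_homology (zdeg i) (zcomplex i a) :: ('k, _) module)"
  by (simp add: D_space_def zdeg_def zcomplex_def Delta_open_below)

lemma below_rank: "a \<in> P \<Longrightarrow> rk a = Suc r \<Longrightarrow> x \<in> below a \<Longrightarrow> rk x \<le> r"
  using rk_mono[of x a] by (auto simp: below_def)

text \<open>The complex has no simplices in the next dimension, so that homology classes are single cycles.\<close>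

lemma no_boundaries:
  assumes "(i = 0 \<and> a = bot) \<or> (a \<in> P \<and> 0 < i \<and> rk a = i)"
  shows "(simp_boundaries (zdeg i) (zcomplex i a) :: ('p set \<Rightarrow>\<^sub>0 'k) set) = {0}"
proof -
  have "c = 0" if c: "c \<in> simp_chains (zdeg i + 1) (zcomplex i a)" for c :: "'p set \<Rightarrow>\<^sub>0 'k"
  proof -
    have "keys c = {}"
    proof (cases i)
      case 0
      then have "False" if "s \<in> keys c" for s using c that by (auto simp: simp_chains_def zdeg_def zcomplex_def)
      then show ?thesis by blast
    next
      case (Suc r)
      then have a: "a \<in> P" "rk a = Suc r" using assms by auto
      have "zdeg i + 1 = int (Suc r) - 1" using Suc by (simp add: zdeg_def)
      then have "\<forall>s\<in>keys c. s \<in> order_complex (below a) \<and> card s = Suc r"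
        using c unfolding zcomplex_def using Suc by (simp only: simp_chains_nat) simp
      then show ?thesis using chain_card_le[OF _ below_sub below_rank[OF a]] by fastforce
    qed
    then show ?thesis by simp
  qed
  then have "simp_chains (zdeg i + 1) (zcomplex i a) = {0 :: 'p set \<Rightarrow>\<^sub>0 'k}" by auto
  then show ?thesis by (simp add: simp_boundaries_def boundary_linear)
qed

lemma zclass_cyclic:
  assumes "(i = 0 \<and> a = bot) \<or> (a \<in> P \<and> a \<noteq> bot \<and> 0 < i)"
  shows "cyclic_image (D_space P i a :: ('k, _) module) (zclass i a)"
proof -
  let ?B = "simp_boundaries (zdeg i) (zcomplex i a) :: ('p set \<Rightarrow>\<^sub>0 'k) set"
  have "z \<in> simp_cycles (zdeg i) (zcomplex i a) \<longleftrightarrow> (\<exists>x. z - smul x (zgen i a) \<in> ?B)" for z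
  proof (cases "i = 0")
    case True
    have B: "?B = {0}" using no_boundaries[of i a] assms True by simp
    have "z \<in> simp_cycles (zdeg i) (zcomplex i a) \<longleftrightarrow> (\<forall>s\<in>keys z. s = {})" (is "_ = ?R")
    proof
      assume R: ?R
      have "simp_boundary z = lext (\<lambda>s. 0) z"
        unfolding simp_boundary_lext by (rule lext_cong) (use R in \<open>auto simp: face_sum_def\<close>)
      then show "z \<in> simp_cycles (zdeg i) (zcomplex i a)"
        using R True by (auto simp: simp_cycles_def simp_chains_def zdeg_def zcomplex_def lext_def)
    qed (use True in \<open>auto simp: simp_cycles_def simp_chains_def zdeg_def zcomplex_def\<close>)
    also have "\<dots> \<longleftrightarrow> (\<exists>x. z = single {} x)"
    proof
      assume R: "\<forall>s\<in>keys z. s = {}"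
      have "z = single {} (lookup z {})"
        by (rule poly_mapping_eqI) (use R in \<open>auto simp: lookup_single when_def in_keys_iff\<close>)
      then show "\<exists>x. z = single {} x" by blast
    qed (auto split: if_splits)
    finally show ?thesis unfolding B using True by (simp add: zgen_def)
  next
    case False
    then obtain r where r: "i = Suc r" by (cases i) auto
    have a: "a \<in> P" "a \<noteq> bot" using assms False by auto
    have dimr: "zdeg i = int r - 1" "zdeg i + 1 = int (Suc r) - 1" using r by (simp_all add: zdeg_def)
    have L: "zcomplex i a = order_complex (below a)" using r by (simp add: zcomplex_def)
    have sl: "sphere_like a" by (rule sphere_like_all[OF a])
    show ?thesis
    proof (cases "rk a = i")
      case True
      have B: "?B = {0}" using no_boundaries[of i a] a True r by simp
      show ?thesis
      proof
        assume "z \<in> simp_cycles (zdeg i) (zcomplex i a)"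
        then have "z \<in> ochains r (below a)" "simp_boundary z = 0"
          unfolding dimr L by (auto simp: simp_cycles_def)
        then obtain x where "z = smul x (Z a)" using sl True r unfolding sphere_like_def by metis
        then show "\<exists>x. z - smul x (zgen i a) \<in> ?B" using B True r by (auto simp: zgen_def)
      next
        assume "\<exists>x. z - smul x (zgen i a) \<in> ?B"
        then obtain x where "z = smul x (Z a)" using B True r by (auto simp: zgen_def)
        then show "z \<in> simp_cycles (zdeg i) (zcomplex i a)"
          unfolding dimr L using Z_chain[OF a(1), of r] True r boundary_Z[OF a(1)]
          by (auto simp: simp_cycles_def boundary_linear intro: simp_chains_smul)
      qed
    next
      case ne: False
      have h0: "zgen i a = 0" using r ne by (simp add: zgen_def)
      show ?thesis
      proof
        assume "z \<in> simp_cycles (zdeg i) (zcomplex i a)"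
        then have "z \<in> ochains r (below a)" "simp_boundary z = 0"
          unfolding dimr L by (auto simp: simp_cycles_def)
        then have "\<exists>v\<in>ochains (Suc r) (below a). simp_boundary v = z"
          using sl ne r unfolding sphere_like_def by metis
        then show "\<exists>x. z - smul x (zgen i a) \<in> ?B" unfolding h0 simp_boundaries_def dimr(2) L by auto
      next
        assume "\<exists>x. z - smul x (zgen i a) \<in> ?B"
        then have "z \<in> simp_boundary ` ochains (Suc r) (below a)"
          unfolding h0 simp_boundaries_def dimr(2) L by simp
        then obtain v where v: "v \<in> ochains (Suc r) (below a)" "z = simp_boundary v" by blast
        have "simp_boundary z = 0" unfolding v(2)
          by (rule boundary_boundary) (rule simp_cycles_chain_finite[OF v(1)])
        moreover have "z \<in> ochains r (below a)"
          unfolding simp_chains_nat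
        proof
          fix s assume "s \<in> keys z"
          then obtain t x where t: "t \<in> keys v" "x \<in> t" "s = t - {x}" using keys_boundary[of s v] v(2) by auto
          then have "t \<in> order_complex (below a)" "card t = Suc r" using v(1) unfolding simp_chains_nat by auto
          then show "s \<in> order_complex (below a) \<and> card s = r"
            using order_complex_subset[of t _ s] t by (auto simp: order_complex_def)
        qed
        ultimately show "z \<in> simp_cycles (zdeg i) (zcomplex i a)"
          unfolding dimr(1) L by (auto simp: simp_cycles_def)
      qed
    qed
  qed
  from homology_cyclic[of "zdeg i" "zcomplex i a" "zgen i a", OF this]
  show ?thesis unfolding D_space_eq zclass_def .
qed

lemma zclass_inj:
  assumes "(i = 0 \<and> a = bot) \<or> (a \<in> P \<and> 0 < i \<and> rk a = i)"
  shows "inj (zclass i a)"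
proof (rule injI)
  fix x y assume "zclass i a x = zclass i a y"
  then have "smul x (zgen i a) - smul y (zgen i a) \<in> {0}"
    unfolding zclass_def homology_class_eq_iff no_boundaries[OF assms] .
  then have e: "smul (x - y) (zgen i a) = 0" by (simp add: smul_diff)
  have "zgen i a \<noteq> 0"
  proof (cases i)
    case 0
    then show ?thesis unfolding zgen_def by (metis lookup_single_eq lookup_zero zero_neq_one)
  next
    case (Suc r)
    then show ?thesis using assms Z_nonzero[of a r] by (simp add: zgen_def)
  qed
  then obtain s where "lookup (zgen i a) s \<noteq> 0" by (metis poly_mapping_eqI lookup_zero)
  moreover have "(x - y) * lookup (zgen i a) s = 0" using e by (metis lookup_smul lookup_zero)
  ultimately show "x = y" by simp
qed

lemma zclass_const: "0 < i \<Longrightarrow> rk a \<noteq> i \<Longrightarrow> zclass i a x = zclass i a 0"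
  by (simp add: zclass_def zgen_def)

lemma covers_rank: "a \<in> P \<Longrightarrow> l \<in> lcovers a \<Longrightarrow> covers_in P a l"
proof -
  assume a: "a \<in> P" and l: "l \<in> lcovers a"
  have False if m: "\<mu> \<in> P" "l < \<mu>" "\<mu> < a" for \<mu>
    using rk_mono[of l \<mu>] rk_mono[of \<mu> a] m a l by (auto simp: lcovers_def)
  then show ?thesis using a l by (auto simp: covers_in_def lcovers_def)
qed

lemma D_map_zclass_1:
  assumes a: "a \<in> P" "rk a = 1"
  shows "D_map P 1 a bot (zclass 1 a x) = zclass 0 bot (x * d a bot)"
proof -
  have "below a = {}" using below_rank[OF a(1), of 0] a rk_pos by (force simp: below_def)
  then have L: "Delta_open P a = {{}}" by (simp add: Delta_open_below order_complex_empty)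
  have "a \<noteq> bot" using a rk_bot by auto
  then have "lcovers a = {bot}" using a rk_0 bot_in rk_bot rk_pos by (auto simp: lcovers_def bot.not_eq_extremum)
  then have "Z a = smul (d a bot) (single {} 1)" by (simp add: Z_def E_bot)
  then show ?thesis
    using L by (simp add: D_map_def zclass_def zgen_def zdeg_def zcomplex_def a Delta_open_below)
qed

text \<open>A multiple of \<open>Z a\<close> is a sum of multiples of the chains \<open>E m\<close>. The summand of \<open>l\<close> lies in the closed
  interval of \<open>l\<close>, with a multiple of \<open>Z l\<close> as its boundary, and the other summands lie in the closed
  intervals of the other elements covered by \<open>a\<close>.\<close>

lemma D_map_zclass:
  assumes a: "a \<in> P" "rk a = i" and i: "2 \<le> i" and cov: "covers_in P a l"
  shows "D_map P i a l (zclass i a x) = zclass (i - 1) l (x * d a l)"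
proof -
  have l: "l \<in> P" "l < a" using cov by (auto simp: covers_in_def)
  obtain r where r: "i = Suc (Suc r)" using i by (metis Suc_le_D numeral_2_eq_2 Suc_le_mono)
  have dimr: "zdeg i = int (Suc r) - 1" "zdeg (i - 1) = int r - 1" "int i - 2 = int (Suc r) - 1" "int i - 3 = int r - 1"
    "int i - 2 - 1 = int r - 1" using r by (simp_all add: zdeg_def)
  let ?K = "Delta_closed P l" and ?L = "Delta_others P a l"
  let ?p = "int (Suc r) - 1"
  have A: "zclass i a x = {smul x (Z a)}"
    unfolding zclass_def homology_class_def using no_boundaries[of i a] a r by (simp add: zgen_def)
  \<comment> \<open>If \<open>a\<close> covers \<open>l\<close> but the ranks differ by more than one, then the target is zero, and so is
    the part in the closed interval of \<open>l\<close>.\<close>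
  define a0 where "a0 = (if l \<in> lcovers a then smul (x * d a l) (E l) else 0)"
  define b0 where "b0 = (\<Sum>m\<in>lcovers a - {l}. smul (x * d a m) (E m))"
  have ab: "a0 + b0 = smul x (Z a)"
  proof -
    have "smul x (Z a) = (\<Sum>m\<in>lcovers a. smul (x * d a m) (E m))" by (simp add: Z_def smul_sum)
    also have "\<dots> = a0 + b0"
    proof (cases "l \<in> lcovers a")
      case True
      then show ?thesis unfolding a0_def b0_def using sum.remove[OF finite_lcovers[OF a(1)] True] by simp
    qed (simp add: a0_def b0_def)
    finally show ?thesis by simp
  qed
  have Ech: "E m \<in> simp_chains ?p (Delta_closed P m)" if "m \<in> lcovers a" for m
  proof -
    have "m \<in> P" "rk m = Suc r" using that a r by (auto simp: lcovers_def)
    then show ?thesis using E_chain[of m] by (simp add: Delta_closed_def)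
  qed
  have a0c: "a0 \<in> simp_chains ?p ?K" using Ech by (auto simp: a0_def intro: simp_chains_smul)
  have b0c: "b0 \<in> simp_chains ?p ?L" unfolding b0_def
  proof (rule simp_chains_sum, rule simp_chains_smul)
    fix m assume m: "m \<in> lcovers a - {l}"
    have "Delta_closed P m \<subseteq> ?L" using covers_rank[OF a(1), of m] m by (auto simp: Delta_others_def)
    then show "E m \<in> simp_chains ?p ?L" using Ech[of m] m simp_chains_mono by blast
  qed
  have mv: "mv_connecting ?p ?K ?L (zclass i a x) = homology_class (?p - 1) (?K \<inter> ?L) (simp_boundary a0)"
    unfolding mv_connecting_def
  proof (rule the_equality)
    show "\<exists>a'\<in>simp_chains ?p ?K. \<exists>b\<in>simp_chains ?p ?L. a' + b \<in> zclass i a x \<and> homology_class (?p - 1) (?K \<inter> ?L) (simp_boundary a0) = homology_class (?p - 1) (?K \<inter> ?L) (simp_boundary a')"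
      by (intro bexI[OF _ a0c] bexI[OF _ b0c]) (simp add: A ab)
    fix C assume "\<exists>a'\<in>simp_chains ?p ?K. \<exists>b\<in>simp_chains ?p ?L. a' + b \<in> zclass i a x \<and> C = homology_class (?p - 1) (?K \<inter> ?L) (simp_boundary a')"
    then obtain a1 b1 where 1: "a1 \<in> simp_chains ?p ?K" "b1 \<in> simp_chains ?p ?L" "a1 + b1 = smul x (Z a)"
      "C = homology_class (?p - 1) (?K \<inter> ?L) (simp_boundary a1)" unfolding A by blast
    \<comment> \<open>Two decompositions differ by a chain of the intersection.\<close>
    have "a1 - a0 = b0 - b1" using 1(3) ab by (simp add: algebra_simps)
    then have "a1 - a0 \<in> simp_chains ?p ?K" "a1 - a0 \<in> simp_chains ?p ?L"
      using simp_chains_diff[OF 1(1) a0c] simp_chains_diff[OF b0c 1(2)] by simp_all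
    then have "a1 - a0 \<in> simp_chains (?p - 1 + 1) (?K \<inter> ?L)" unfolding simp_chains_def by auto
    then have "simp_boundary a1 - simp_boundary a0 \<in> simp_boundaries (?p - 1) (?K \<inter> ?L)"
      unfolding simp_boundaries_def boundary_linear(2)[symmetric] by (rule imageI)
    then show "C = homology_class (?p - 1) (?K \<inter> ?L) (simp_boundary a0)" unfolding 1(4) homology_class_eq_iff .
  qed
  have KL: "?K \<inter> ?L \<subseteq> Delta_open P l"
  proof
    fix s assume s: "s \<in> ?K \<inter> ?L"
    then obtain \<beta> where \<beta>: "covers_in P a \<beta>" "\<beta> \<noteq> l" "s \<in> Delta_closed P \<beta>" by (auto simp: Delta_others_def)
    have "l \<notin> s"
    proof
      assume "l \<in> s"
      then have "l < \<beta>" using \<beta>(2,3) by (auto simp: Delta_closed_def order_complex_def le_less)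
      then show False using cov \<beta>(1) by (auto simp: covers_in_def)
    qed
    moreover have "finite s" "Complete_Partial_Order.chain (\<le>) s" "\<And>x. x \<in> s \<Longrightarrow> x \<in> P \<and> bot < x \<and> x \<le> l"
      using s by (auto simp: Delta_closed_def order_complex_def)
    ultimately show "s \<in> Delta_open P l"
      unfolding Delta_open_def order_complex_def using le_less by blast
  qed
  have Bsub: "(simp_boundaries (int r - 1) (?K \<inter> ?L) :: ('p set \<Rightarrow>\<^sub>0 'k) set) \<subseteq> simp_boundaries (int r - 1) (Delta_open P l)"
    unfolding simp_boundaries_def using simp_chains_mono[OF KL] by blast
  have incl: "inclusion_induced (int r - 1) (Delta_open P l) (homology_class (int r - 1) (?K \<inter> ?L) y) = homology_class (int r - 1) (Delta_open P l) y" for y :: "'p set \<Rightarrow>\<^sub>0 'k"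
  proof (intro equalityI subsetI)
    fix z assume "z \<in> inclusion_induced (int r - 1) (Delta_open P l) (homology_class (int r - 1) (?K \<inter> ?L) y)"
    then obtain b b' where "z = (y + b) + b'" "b \<in> simp_boundaries (int r - 1) (?K \<inter> ?L)" "b' \<in> simp_boundaries (int r - 1) (Delta_open P l)"
      by (auto simp: inclusion_induced_def homology_class_def)
    then have "z = y + (b + b')" "b + b' \<in> simp_boundaries (int r - 1) (Delta_open P l)"
      using boundaries_subspace(2)[OF subsetD[OF Bsub]] by (simp_all add: add.assoc)
    then show "z \<in> homology_class (int r - 1) (Delta_open P l) y" unfolding homology_class_def by blast
  next
    fix z assume "z \<in> homology_class (int r - 1) (Delta_open P l) y"
    then obtain b where b: "z = y + b" "b \<in> simp_boundaries (int r - 1) (Delta_open P l)" by (auto simp: homology_class_def)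
    have "y \<in> homology_class (int r - 1) (?K \<inter> ?L) y" unfolding homology_class_def using boundaries_subspace(1) by force
    then show "z \<in> inclusion_induced (int r - 1) (Delta_open P l) (homology_class (int r - 1) (?K \<inter> ?L) y)"
      using b unfolding inclusion_induced_def by blast
  qed
  have bd: "simp_boundary a0 = smul (x * d a l) (zgen (i - 1) l)"
  proof (cases "l \<in> lcovers a")
    case True
    then have "rk l = i - 1" using a r by (simp add: lcovers_def)
    then show ?thesis using True r boundary_E_Z[OF l(1)] by (simp add: a0_def boundary_linear zgen_def)
  next
    case False
    then have "rk l \<noteq> i - 1" using l a r by (auto simp: lcovers_def)
    then show ?thesis using False r by (simp add: a0_def boundary_linear zgen_def)
  qed
  have "D_map P i a l (zclass i a x) = inclusion_induced (int i - 3) (Delta_open P l) (mv_connecting (int i - 2) ?K ?L (zclass i a x))"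
    using r by (simp add: D_map_def)
  also have "\<dots> = homology_class (int r - 1) (Delta_open P l) (simp_boundary a0)"
    unfolding dimr mv using incl by simp
  also have "\<dots> = zclass (i - 1) l (x * d a l)"
    unfolding bd zclass_def dimr(2) zcomplex_def Delta_open_below using r by simp
  finally show ?thesis .
qed

end

section \<open>Discs\<close>

abbreviation disc_space :: "nat \<Rightarrow> (nat \<Rightarrow> real) topology" where
  "disc_space n \<equiv> subtopology (Euclidean_space n) (disc n)"

lemma disc_subset: "disc n \<subseteq> topspace (Euclidean_space n)"
  by (auto simp: disc_def)

lemma topspace_disc [simp]: "topspace (disc_space n) = disc n"
  using disc_subset by auto

lemma disc_split: "disc n = disc_interior n \<union> disc_boundary n" "disc_interior n \<inter> disc_boundary n = {}"
  by (auto simp: disc_def disc_interior_def disc_boundary_def)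

lemma disc_boundary_subset: "disc_boundary n \<subseteq> disc n" and disc_interior_subset: "disc_interior n \<subseteq> disc n"
  by (auto simp: disc_def disc_interior_def disc_boundary_def)

lemma zero_in_disc_interior: "(\<lambda>i. 0) \<in> disc_interior n"
  by (auto simp: disc_interior_def topspace_Euclidean_space)

lemma zero_in_disc: "(\<lambda>i. 0) \<in> disc n"
  using zero_in_disc_interior disc_interior_subset by blast

text \<open>The radial deformation of the punctured disc onto its boundary sphere: the identity for \<open>t = 1\<close> and
  the projection to the sphere for \<open>t = 0\<close>. On the sphere all maps \<open>radial n t\<close> are the identity.\<close>

definition radial :: "nat \<Rightarrow> real \<Rightarrow> (nat \<Rightarrow> real) \<Rightarrow> nat \<Rightarrow> real" where
  "radial n t x = (\<lambda>i. if i < n then ((1 - t) / sqrt (\<Sum>i<n. x i ^ 2) + t) * x i else 0)"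

lemma radial_sumsq:
  assumes "x \<in> disc n" "x \<noteq> (\<lambda>i. 0)"
  shows "(\<Sum>i<n. radial n t x i ^ 2) = ((1 - t) + t * sqrt (\<Sum>i<n. x i ^ 2))\<^sup>2"
    and "(\<Sum>i<n. x i ^ 2) > 0"
proof -
  let ?r = "\<Sum>i<n. x i ^ 2"
  show pos: "?r > 0"
  proof -
    obtain i where i: "x i \<noteq> 0" using assms(2) by auto
    have "i < n" using assms(1) i by (auto simp: disc_def topspace_Euclidean_space not_le[symmetric])
    then have "x i ^ 2 \<le> ?r" by (intro member_le_sum) auto
    moreover have "x i ^ 2 > 0" using i by simp
    ultimately show ?thesis by linarith
  qed
  have "(\<Sum>i<n. radial n t x i ^ 2) = ((1 - t) / sqrt ?r + t)\<^sup>2 * ?r"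
    by (simp add: radial_def power_mult_distrib sum_distrib_left)
  also have "\<dots> = ((1 - t) / sqrt ?r + t)\<^sup>2 * (sqrt ?r)\<^sup>2"
    using pos by simp
  also have "\<dots> = (((1 - t) / sqrt ?r + t) * sqrt ?r)\<^sup>2"
    by (simp add: power_mult_distrib)
  also have "((1 - t) / sqrt ?r + t) * sqrt ?r = (1 - t) + t * sqrt ?r"
    using pos by (simp add: field_simps)
  finally show "(\<Sum>i<n. radial n t x i ^ 2) = ((1 - t) + t * sqrt ?r)\<^sup>2" .
qed

lemma radial_props:
  assumes "x \<in> disc n - {\<lambda>i. 0}" "t \<in> {0..1}"
  shows "radial n t x \<in> disc n - {\<lambda>i. 0}" "radial n 1 x = x" "radial n 0 x \<in> disc_boundary n"
    "x \<in> disc_boundary n \<Longrightarrow> radial n t x = x"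
proof -
  let ?r = "\<Sum>i<n. x i ^ 2"
  have pos: "?r > 0" and le: "?r \<le> 1" using radial_sumsq(2) assms by (auto simp: disc_def)
  have s: "(\<Sum>i<n. radial n t x i ^ 2) = ((1 - t) + t * sqrt ?r)\<^sup>2" for t
    using radial_sumsq(1) assms by auto
  have tsp: "radial n t x \<in> topspace (Euclidean_space n)" for t
    by (auto simp: topspace_Euclidean_space radial_def)
  have sq: "0 < sqrt ?r" "sqrt ?r \<le> 1" using pos le by auto
  have "t * sqrt ?r \<le> t * 1" using assms(2) sq by (intro mult_left_mono) auto
  then have b1: "(1 - t) + t * sqrt ?r \<le> 1" by simp
  have b0: "0 < (1 - t) + t * sqrt ?r"
  proof (cases "t = 1")
    case False
    then have "0 < 1 - t" "0 \<le> t * sqrt ?r" using assms(2) sq by auto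
    then show ?thesis by linarith
  qed (use sq in auto)
  have "((1 - t) + t * sqrt ?r)\<^sup>2 \<le> 1" using b0 b1 by (simp add: power_le_one)
  moreover have "radial n t x \<noteq> (\<lambda>i. 0)"
  proof
    assume "radial n t x = (\<lambda>i. 0)"
    then have "((1 - t) + t * sqrt ?r)\<^sup>2 = 0" using s[of t] by simp
    then show False using b0 by simp
  qed
  ultimately show "radial n t x \<in> disc n - {\<lambda>i. 0}" using tsp s by (auto simp: disc_def)
  have x0: "\<not> i < n \<Longrightarrow> x i = 0" for i using assms(1) by (auto simp: disc_def topspace_Euclidean_space)
  then show "radial n 1 x = x" by (auto simp: radial_def fun_eq_iff)
  show "radial n 0 x \<in> disc_boundary n" using tsp s[of 0] by (auto simp: disc_boundary_def)
  show "radial n t x = x" if "x \<in> disc_boundary n"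
    using that x0 by (auto simp: radial_def fun_eq_iff disc_boundary_def)
qed

lemma continuous_map_Euclidean_coord: "continuous_map (Euclidean_space n) euclideanreal (\<lambda>x. x i)"
  unfolding Euclidean_space_def
  by (blast intro: continuous_map_from_subtopology [OF continuous_map_product_projection])

lemma continuous_map_radial:
  "continuous_map (prod_topology (top_of_set {0..1}) (subtopology (Euclidean_space n) (disc n - {\<lambda>i. 0})))
     (subtopology (Euclidean_space n) (disc n - {\<lambda>i. 0})) (\<lambda>(t,x). radial n t x)"
proof -
  let ?P = "prod_topology (top_of_set {0..1::real}) (subtopology (Euclidean_space n) (disc n - {\<lambda>i. 0}))"
  have c1: "continuous_map ?P euclideanreal (\<lambda>z. fst z)"
    using continuous_map_fst continuous_map_in_subtopology by blast
  have c2: "continuous_map ?P euclideanreal (\<lambda>z. snd z i)" for i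
  proof -
    have "continuous_map ?P (Euclidean_space n) snd"
      by (meson continuous_map_snd continuous_map_in_subtopology)
    from continuous_map_compose[OF this continuous_map_Euclidean_coord[of n i]]
    show ?thesis by (simp add: o_def)
  qed
  have "continuous_map ?P (Euclidean_space n) (\<lambda>z i. if i < n then ((1 - fst z) / sqrt (\<Sum>i<n. snd z i ^ 2) + fst z) * snd z i else 0)"
    unfolding continuous_map_componentwise_Euclidean_space
  proof (intro allI impI)
    fix i assume "i < n"
    have nz: "sqrt (\<Sum>i<n. snd z i ^ 2) \<noteq> 0" if "z \<in> topspace ?P" for z
    proof -
      have "snd z \<in> disc n" "snd z \<noteq> (\<lambda>i. 0)" using that by auto
      from radial_sumsq(2)[OF this] show ?thesis by simp
    qed
    have cs: "continuous_map ?P euclideanreal (\<lambda>z. sqrt (\<Sum>i<n. snd z i ^ 2))"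
      by (intro continuous_map_sqrt continuous_intros c2) auto
    show "continuous_map ?P euclideanreal (\<lambda>z. ((1 - fst z) / sqrt (\<Sum>i<n. snd z i ^ 2) + fst z) * snd z i)"
      by (intro continuous_map_real_mult continuous_map_add continuous_map_diff c1 c2 continuous_map_real_divide cs nz) auto
  qed
  then have "continuous_map ?P (Euclidean_space n) (\<lambda>(t,x). radial n t x)"
    by (simp add: radial_def case_prod_unfold)
  then show ?thesis
    using radial_props(1) by (auto simp: continuous_map_in_subtopology)
qed

section \<open>Attaching a closed cell\<close>

lemma iso_by_triple_trivial:
  assumes TS: "T \<subseteq> S" and tr: "\<And>p. trivial_group (relative_homology_group p (subtopology W S) T)"
  shows "hom_induced p W T W S id \<in> iso (relative_homology_group p W T) (relative_homology_group p W S)"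
proof (rule very_short_exact_sequence)
  show "exact_seq
         ([relative_homology_group(p - 1) (subtopology W S) T, relative_homology_group p W S, relative_homology_group p W T, relative_homology_group p (subtopology W S) T],
          [hom_relboundary p W S T, hom_induced p W T W S id, hom_induced p (subtopology W S) T W T id])"
    using homology_exactness_triple_1 [OF TS] homology_exactness_triple_3 [OF TS]
    by fastforce
qed (use tr in auto)

lemma iso_cancel:
  assumes "f \<in> iso G H" "group G" "group H" "group K" "g \<in> hom H K" "g \<circ> f \<in> iso G K"
  shows "g \<in> iso H K"
proof -
  have f: "bij_betw f (carrier G) (carrier H)" and gf: "bij_betw (g \<circ> f) (carrier G) (carrier K)"
    using assms by (auto simp: iso_def)
  then have "bij_betw g (carrier H) (carrier K)"
    using bij_betw_comp_iff by blast
  then show ?thesis using assms by (simp add: iso_def)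
qed

lemma iso_cancel_left:
  assumes "f \<in> hom G H" "group G" "group H" "group K" "g \<in> iso H K" "g \<circ> f \<in> iso G K"
  shows "f \<in> iso G H"
proof -
  have g: "bij_betw g (carrier H) (carrier K)" and gf: "bij_betw (g \<circ> f) (carrier G) (carrier K)"
    using assms by (auto simp: iso_def)
  moreover have "f ` carrier G \<subseteq> carrier H" using assms(1) by (auto simp: hom_def)
  ultimately have "bij_betw f (carrier G) (carrier H)"
    using bij_betw_comp_iff2 by blast
  then show ?thesis using assms by (simp add: iso_def)
qed

text \<open>A closed disc \<open>s\<close> in \<open>W\<close>, with chart \<open>h\<close>, is attached to a closed set \<open>A\<close> that it meets
  exactly in its boundary. The inclusion of \<open>s\<close> modulo its boundary into the union modulo \<open>A\<close> is compared, via the complement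
  of the centre of \<open>s\<close>, with the excision of \<open>A\<close>.\<close>

context
  fixes W :: "'a topology" and n :: nat and s :: "'a set" and h :: "(nat \<Rightarrow> real) \<Rightarrow> 'a"
  assumes W: "Hausdorff_space W" and h: "homeomorphic_map (disc_space n) (subtopology W s) h"
    and s: "s \<subseteq> topspace W" "closedin W s"
begin

abbreviation "centre \<equiv> h (\<lambda>i. 0)"

lemma char_surj: "h ` disc n = s"
  using homeomorphic_imp_surjective_map[OF h] s topspace_disc topspace_subtopology_subset by metis

lemma centre_not_in: assumes "A \<inter> s = h ` disc_boundary n" shows "centre \<notin> A"
proof
  assume "centre \<in> A"
  then have "centre \<in> h ` disc_boundary n" using assms char_surj zero_in_disc by blast
  then obtain y where y: "y \<in> disc_boundary n" "h y = centre" by force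
  have "inj_on h (disc n)" using homeomorphic_imp_injective_map[OF h] topspace_disc by metis
  then have "y = (\<lambda>i. 0)" using inj_onD y zero_in_disc disc_boundary_subset by (metis subsetD)
  then show False using y(1) zero_in_disc_interior disc_split(2) by blast
qed

text \<open>Without its centre, the disc retracts to its boundary; together with the identity on \<open>A\<close> this
  is a deformation of the union.\<close>

lemma trivial_homology_punctured_cell:
  assumes A: "closedin W A" and As: "A \<inter> s = h ` disc_boundary n"
  shows "trivial_group (relative_homology_group j (subtopology W (A \<union> (s - {centre}))) A)"
proof -
  let ?Z = "A \<union> (s - {centre})"
  let ?Y = "subtopology W ?Z"
  let ?E = "disc_space n"
  let ?Ep = "subtopology (Euclidean_space n) (disc n - {\<lambda>i. 0})"
  let ?I = "top_of_set {0..1::real}"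
  obtain g where hg: "homeomorphic_maps ?E (subtopology W s) h g"
    using h unfolding homeomorphic_map_maps by blast
  note hs = char_surj
  have gh: "g (h x) = x" if "x \<in> disc n" for x
    using hg that topspace_disc unfolding homeomorphic_maps_def by metis
  have hgx: "h (g x) = x" if "x \<in> s" for x
    using hg that s topspace_subtopology_subset unfolding homeomorphic_maps_def by metis
  have gs: "g x \<in> disc n" if "x \<in> s" for x
    using that hs gh by auto
  have pA: "centre \<notin> A" by (rule centre_not_in[OF As])
  have gA: "g x \<in> disc_boundary n" if "x \<in> A" "x \<in> s" for x
  proof -
    have "x \<in> h ` disc_boundary n" unfolding As[symmetric] using that by (rule IntI)
    then obtain y where y: "y \<in> disc_boundary n" "h y = x" by force
    have "g x = g (h y)" by (simp only: y(2))
    also have "\<dots> = y" by (rule gh[OF subsetD[OF disc_boundary_subset y(1)]])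
    finally have "g x = y" .
    then show ?thesis by (rule ssubst) (rule y(1))
  qed
  have g0: "g x \<in> disc n - {\<lambda>i. 0}" if "x \<in> s" "x \<noteq> centre" for x
    using that gs hgx by (metis Diff_iff singletonD)
  define H where "H = (\<lambda>(t,x). if x \<in> A then x else h (radial n t (g x)))"
  have ZX: "?Z \<subseteq> topspace W" using A s by (auto dest: closedin_subset)
  have HZ: "H (t,x) \<in> ?Z" if "x \<in> ?Z" "t \<in> {0..1}" for t x
  proof (cases "x \<in> A")
    case False
    then have "g x \<in> disc n - {\<lambda>i. 0}" using g0 that by auto
    from radial_props(1)[OF this that(2)]
    have r: "radial n t (g x) \<in> disc n - {\<lambda>i. 0}" .
    then have "h (radial n t (g x)) \<in> s" using hs by blast
    moreover have "h (radial n t (g x)) \<noteq> centre" using r gh zero_in_disc by (metis DiffE insertCI)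
    ultimately show ?thesis using False by (simp add: H_def)
  qed (simp add: H_def)
  have Hs: "H (t,x) = h (radial n t (g x))" if "x \<in> s" "x \<noteq> centre" "t \<in> {0..1}" for t x
  proof (cases "x \<in> A")
    case True
    from radial_props(4)[OF g0[OF that(1,2)] that(3) gA[OF True that(1)]]
    show ?thesis using True hgx that by (simp add: H_def)
  qed (simp add: H_def)
  have H0: "H (0,x) \<in> A" if "x \<in> ?Z" for x
  proof (cases "x \<in> A")
    case False
    then have "g x \<in> disc n - {\<lambda>i. 0}" using g0 that by auto
    from radial_props(3)[OF this, of 0] have "radial n 0 (g x) \<in> disc_boundary n" by auto
    then show ?thesis using False As by (auto simp: H_def)
  qed (simp add: H_def)
  have H1: "H (1,x) = x" if "x \<in> ?Z" for x
  proof (cases "x \<in> A")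
    case False
    then have "g x \<in> disc n - {\<lambda>i. 0}" using g0 that by auto
    from radial_props(2)[OF this, of 1] show ?thesis using False that hgx by (simp add: H_def)
  qed (simp add: H_def)
  let ?P = "prod_topology ?I ?Y"
  define C where "C = (\<lambda>b. if b then {0..1::real} \<times> A else {0..1} \<times> (s - {centre}))"
  define F where "F = (\<lambda>b. if b then snd else (\<lambda>(t,x). h (radial n t (g x))))"
  \<comment> \<open>The deformation is glued from its restrictions to the closed sets \<open>A\<close> and \<open>s\<close> without the centre.\<close>
  have contH: "continuous_map ?P W H"
  proof (rule pasting_lemma_closed[where I = UNIV and T = C and f = F])
    fix b :: bool
    have cA: "closedin ?Y A" using A by (metis Un_upper1 closedin_subset_topspace)
    have cs: "closedin ?Y (s - {centre})"
    proof -
      have "closedin ?Y (s \<inter> ?Z)" using s(2) by (metis closedin_subtopology)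
      moreover have "s \<inter> ?Z = s - {centre}" using pA by auto
      ultimately show ?thesis by simp
    qed
    show "closedin ?P (C b)"
      using cA cs by (simp add: C_def closedin_prod_Times_iff)
    show "continuous_map (subtopology ?P (C b)) W (F b)"
    proof (cases b)
      case True
      have "continuous_map ?P W snd"
        by (meson continuous_map_snd continuous_map_in_subtopology)
      then show ?thesis using True by (simp add: F_def continuous_map_from_subtopology)
    next
      case False
      let ?Q = "prod_topology ?I (subtopology W (s - {centre}))"
      have eq: "subtopology ?P (C b) = ?Q"
      proof -
        have 1: "subtopology ?P ({0..1} \<times> (s - {centre})) = prod_topology (subtopology ?I {0..1}) (subtopology ?Y (s - {centre}))"
          by (rule subtopology_Times)
        have 2: "subtopology ?I {0..1} = ?I" by (simp only: subtopology_subtopology Int_absorb)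
        have "?Z \<inter> (s - {centre}) = s - {centre}" by auto
        then have 3: "subtopology ?Y (s - {centre}) = subtopology W (s - {centre})" by (simp only: subtopology_subtopology)
        show ?thesis using False 1 unfolding C_def 2 3 by simp
      qed
      have cg: "continuous_map (subtopology W (s - {centre})) ?Ep g"
      proof -
        have "continuous_map (subtopology W s) ?E g" using hg by (simp add: homeomorphic_maps_def)
        then have "continuous_map (subtopology W (s - {centre})) (Euclidean_space n) g"
          using continuous_map_from_subtopology_mono continuous_map_in_subtopology by (metis Diff_subset)
        then show ?thesis using g0 by (auto simp: continuous_map_in_subtopology)
      qed
      have "continuous_map ?Q (prod_topology ?I ?Ep) (\<lambda>(t,x). (t, g x))"
        using cg by (simp add: continuous_map_prod_top)
      from continuous_map_compose[OF this continuous_map_radial]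
      have c1: "continuous_map ?Q ?Ep (\<lambda>(t,x). radial n t (g x))"
        by (simp add: o_def case_prod_unfold)
      have "continuous_map ?E W h" using hg by (simp add: homeomorphic_maps_def continuous_map_in_subtopology)
      then have "continuous_map ?Ep W h"
        using continuous_map_from_subtopology_mono by (metis Diff_subset)
      from continuous_map_compose[OF c1 this]
      have "continuous_map ?Q W (\<lambda>(t,x). h (radial n t (g x)))"
        by (simp add: o_def case_prod_unfold)
      then show ?thesis using False eq by (simp add: F_def)
    qed
    fix b' x assume x: "x \<in> topspace ?P \<inter> C b \<inter> C b'"
    then obtain t y where ty: "x = (t,y)" "t \<in> {0..1}" by (auto simp: C_def split: if_splits)
    have "y \<in> A \<Longrightarrow> y \<in> s - {centre} \<Longrightarrow> h (radial n t (g y)) = y"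
      using Hs[of y t] ty by (auto simp: H_def)
    then show "F b x = F b' x" using x ty by (auto simp: F_def C_def split: if_splits)
  next
    fix x assume x: "x \<in> topspace ?P"
    then obtain t y where ty: "x = (t,y)" "t \<in> {0..1}" "y \<in> ?Z" by (cases x) auto
    show "\<exists>j. j \<in> UNIV \<and> x \<in> C j \<and> H x = F j x"
    proof (cases "y \<in> A")
      case True
      then show ?thesis using ty by (intro exI[of _ True]) (auto simp: C_def F_def H_def)
    next
      case False
      then show ?thesis using ty Hs[of y t] by (intro exI[of _ False]) (auto simp: C_def F_def)
    qed
  qed auto
  have contHY: "continuous_map ?P ?Y H"
    unfolding continuous_map_in_subtopology using contH HZ ZX by (fastforce simp: image_subset_iff)
  let ?f = "\<lambda>x. H (0,x)"
  have cf: "continuous_map ?Y ?Y ?f"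
  proof -
    have "continuous_map ?Y ?P (\<lambda>x. (0,x))"
      by (simp add: continuous_map_pairwise o_def)
    from continuous_map_compose[OF this contHY] show ?thesis by (simp add: o_def)
  qed
  have "continuous_map ?Y (subtopology ?Y A) ?f"
    using cf H0 by (auto simp: continuous_map_in_subtopology)
  moreover have "homotopic_with (\<lambda>k. k ` A \<subseteq> A) ?Y ?Y ?f id"
  proof -
    have *: "(h ` A \<subseteq> A) = (k ` A \<subseteq> A)" if "\<And>x. x \<in> topspace ?Y \<Longrightarrow> h x = k x" for h k
    proof -
      have "h x = k x" if "x \<in> A" for x using that ZX \<open>\<And>x. x \<in> topspace ?Y \<Longrightarrow> h x = k x\<close> by auto
      then show ?thesis by (simp add: image_subset_iff)
    qed
    show ?thesis
      by (subst homotopic_with, erule *, rule exI[of _ H]) (use contHY H1 in \<open>auto simp: H_def\<close>)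
  qed
  ultimately show ?thesis
    by (rule trivial_relative_homology_group_alt)
qed

lemma attach_cell_iso_punctured:
  assumes A: "closedin W A" and As: "A \<inter> s = h ` disc_boundary n"
  shows "hom_induced j (subtopology W (A \<union> s)) A (subtopology W (A \<union> s)) (A \<union> (s - {centre})) id
     \<in> iso (relative_homology_group j (subtopology W (A \<union> s)) A)
           (relative_homology_group j (subtopology W (A \<union> s)) (A \<union> (s - {centre})))"
proof (rule iso_by_triple_trivial)
  have "(A \<union> s) \<inter> (A \<union> (s - {centre})) = A \<union> (s - {centre})" by auto
  then show "trivial_group (relative_homology_group p (subtopology (subtopology W (A \<union> s)) (A \<union> (s - {centre}))) A)" for p
    using trivial_homology_punctured_cell[OF assms] by (simp add: subtopology_subtopology)
qed auto

lemma attach_cell_excision: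
  assumes A: "closedin W A" and As: "A \<inter> s = h ` disc_boundary n"
  shows "hom_induced j (subtopology W (s - A)) (s - A - {centre}) (subtopology W (A \<union> s)) (A \<union> (s - {centre})) id
     \<in> iso (relative_homology_group j (subtopology W (s - A)) (s - A - {centre}))
           (relative_homology_group j (subtopology W (A \<union> s)) (A \<union> (s - {centre})))"
proof -
  let ?Y = "subtopology W (A \<union> s)"
  have AW: "A \<subseteq> topspace W" using A closedin_subset by auto
  note hs = char_surj
  then have ps: "centre \<in> s" using zero_in_disc by blast
  have pA: "centre \<notin> A" by (rule centre_not_in[OF As])
  have topY: "topspace ?Y = A \<union> s" using AW s by auto
  have "closedin ?Y A" using A by (metis Un_upper1 closedin_subset_topspace)
  then have c: "?Y closure_of A = A" by (simp add: closure_of_closedin)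
  have "Hausdorff_space ?Y" using W by (rule Hausdorff_space_subtopology)
  then have "closedin ?Y {centre}" using ps topY by (simp add: closedin_Hausdorff_singleton)
  then have "openin ?Y (topspace ?Y - {centre})" by blast
  moreover have "topspace ?Y - {centre} = A \<union> (s - {centre})" using topY pA by auto
  ultimately have o: "?Y interior_of (A \<union> (s - {centre})) = A \<union> (s - {centre})" by (simp add: interior_of_openin)
  have "hom_induced j (subtopology ?Y ((A \<union> s) - A)) (A \<union> (s - {centre}) - A) (subtopology ?Y (A \<union> s)) (A \<union> (s - {centre})) id
    \<in> iso (relative_homology_group j (subtopology ?Y ((A \<union> s) - A)) (A \<union> (s - {centre}) - A))
          (relative_homology_group j (subtopology ?Y (A \<union> s)) (A \<union> (s - {centre})))"
    by (rule homology_excision_axiom) (use c o in auto)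
  moreover have "(A \<union> s) \<inter> ((A \<union> s) - A) = s - A" "A \<union> (s - {centre}) - A = s - A - {centre}" by auto
  ultimately show ?thesis by (simp add: subtopology_subtopology)
qed

text \<open>The groups of the pairs \<open>(s, boundary)\<close> and \<open>(A \<union> s, A)\<close> do not change when the punctured disc is added
  to the subspace; after that, excising the boundary and \<open>A\<close> leads to the same pair.\<close>

lemma attach_cell_iso:
  assumes A: "closedin W A" and As: "A \<inter> s = h ` disc_boundary n"
    and Bc: "closedin W (h ` disc_boundary n)"
  shows "hom_induced j (subtopology W s) (h ` disc_boundary n) (subtopology W (A \<union> s)) A id
     \<in> iso (relative_homology_group j (subtopology W s) (h ` disc_boundary n))
           (relative_homology_group j (subtopology W (A \<union> s)) A)"
proof -
  let ?B = "h ` disc_boundary n"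
  note hs = char_surj
  have Bs: "?B \<subseteq> s" using hs disc_boundary_subset by blast
  then have BAs: "?B \<inter> s = ?B" and u: "?B \<union> s = s" by auto
  have sA: "s - ?B = s - A" using As by auto
  note 1 = attach_cell_excision[OF A As, of j]
  note 2 = attach_cell_excision[OF Bc BAs, of j, unfolded u sA]
  note 3 = attach_cell_iso_punctured[OF A As, of j]
  note 4 = attach_cell_iso_punctured[OF Bc BAs, of j, unfolded u]
  have cid: "continuous_map (subtopology W U) (subtopology W V) id" if "U \<subseteq> V" for U V
    using that by (metis continuous_map_id continuous_map_from_subtopology_mono continuous_map_in_subtopology continuous_map_id_subt image_id id_apply continuous_map_into_subtopology image_subset_iff_funcset inf.coboundedI2 topspace_subtopology)
  let ?mid = "hom_induced j (subtopology W s) (?B \<union> (s - {centre})) (subtopology W (A \<union> s)) (A \<union> (s - {centre})) id"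
  have sub: "?B \<union> (s - {centre}) \<subseteq> A \<union> (s - {centre})" using As by auto
  have mid: "?mid \<in> iso (relative_homology_group j (subtopology W s) (?B \<union> (s - {centre})))
                        (relative_homology_group j (subtopology W (A \<union> s)) (A \<union> (s - {centre})))"
  proof (rule iso_cancel[OF 2])
    have "?mid \<circ> hom_induced j (subtopology W (s - A)) (s - A - {centre}) (subtopology W s) (?B \<union> (s - {centre})) id
        = hom_induced j (subtopology W (s - A)) (s - A - {centre}) (subtopology W (A \<union> s)) (A \<union> (s - {centre})) (id \<circ> id)"
      by (rule hom_induced_compose[symmetric]) (use cid sub in auto)
    then show "?mid \<circ> hom_induced j (subtopology W (s - A)) (s - A - {centre}) (subtopology W s) (?B \<union> (s - {centre})) id \<in> iso
       (relative_homology_group j (subtopology W (s - A)) (s - A - {centre}))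
       (relative_homology_group j (subtopology W (A \<union> s)) (A \<union> (s - {centre})))"
      using 1 by simp
  qed (auto simp: hom_induced_hom)
  let ?l = "hom_induced j (subtopology W s) ?B (subtopology W (A \<union> s)) A id"
  have "hom_induced j (subtopology W (A \<union> s)) A (subtopology W (A \<union> s)) (A \<union> (s - {centre})) id \<circ> ?l
     = hom_induced j (subtopology W s) ?B (subtopology W (A \<union> s)) (A \<union> (s - {centre})) (id \<circ> id)"
    by (rule hom_induced_compose[symmetric]) (use cid As in auto)
  also have "\<dots> = ?mid \<circ> hom_induced j (subtopology W s) ?B (subtopology W s) (?B \<union> (s - {centre})) id"
    by (rule hom_induced_compose) (use cid sub in auto)
  also have "\<dots> \<in> iso (relative_homology_group j (subtopology W s) ?B) (relative_homology_group j (subtopology W (A \<union> s)) (A \<union> (s - {centre})))"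
    by (rule iso_set_trans[OF 4 mid])
  finally show ?thesis
    by (rule iso_cancel_left[rotated -1]) (use 3 in \<open>auto simp: hom_induced_hom\<close>)
qed

end

section \<open>Topology of discs and spheres\<close>

lemma compactin_disc: "compactin (Euclidean_space n) (disc n)"
proof -
  let ?B = "PiE UNIV (\<lambda>i. {-1..1::real}) :: (nat \<Rightarrow> real) set"
  have cB: "compactin (powertop_real UNIV) ?B" by (simp add: compactin_PiE)
  have "closedin (Euclidean_space n) {x \<in> topspace (Euclidean_space n). (\<Sum>i<n. x i ^ 2) \<in> {..1}}"
    by (rule closedin_continuous_map_preimage)
       (auto intro!: continuous_map_sum continuous_map_real_pow continuous_map_Euclidean_coord)
  moreover have "{x \<in> topspace (Euclidean_space n). (\<Sum>i<n. x i ^ 2) \<in> {..1}} = disc n"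
    by (auto simp: disc_def)
  ultimately have cl: "closedin (Euclidean_space n) (disc n)" by simp
  then have cl': "closedin (powertop_real UNIV) (disc n)"
    unfolding Euclidean_space_def using closedin_Euclidean_space closedin_trans_full topspace_Euclidean_space by metis
  have "disc n \<subseteq> ?B"
  proof
    fix x assume x: "x \<in> disc n"
    have "x i ^ 2 \<le> 1" for i
    proof (cases "i < n")
      case True
      then have "x i ^ 2 \<le> (\<Sum>i<n. x i ^ 2)" by (intro member_le_sum) auto
      then show ?thesis using x by (auto simp: disc_def)
    next
      case False
      then show ?thesis using x by (auto simp: disc_def topspace_Euclidean_space)
    qed
    then show "x \<in> ?B" by (auto simp: abs_square_le_1 abs_le_iff)
  qed
  then have "compactin (powertop_real UNIV) (disc n)"
    using closed_compactin[OF cB _ cl'] by blast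
  then show ?thesis
    using disc_subset[of n] unfolding Euclidean_space_def compactin_subtopology topspace_Euclidean_space by (auto simp: Euclidean_space_def)
qed

lemma contractible_disc: "contractible_space (disc_space n)"
proof -
  let ?D = "disc_space n"
  let ?P = "prod_topology (top_of_set {0..1::real}) ?D"
  let ?h = "\<lambda>z i. if i < n then (1 - fst z) * snd z i else (0::real)"
  have c1: "continuous_map ?P euclideanreal (\<lambda>z. fst z)"
    using continuous_map_fst continuous_map_in_subtopology by blast
  have c2: "continuous_map ?P euclideanreal (\<lambda>z. snd z i)" for i
  proof -
    have "continuous_map ?P (Euclidean_space n) snd"
      by (meson continuous_map_snd continuous_map_in_subtopology)
    from continuous_map_compose[OF this continuous_map_Euclidean_coord[of n i]]
    show ?thesis by (simp add: o_def)
  qed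
  have c: "continuous_map ?P (Euclidean_space n) ?h"
    unfolding continuous_map_componentwise_Euclidean_space
    by (intro allI impI continuous_map_real_mult continuous_map_add continuous_map_diff c1 c2) auto
  have im: "?h (t,x) \<in> disc n" if "t \<in> {0..1}" "x \<in> disc n" for t x
  proof -
    have "(\<Sum>i<n. (?h (t,x) i)\<^sup>2) = (1 - t)\<^sup>2 * (\<Sum>i<n. x i ^ 2)"
      by (simp add: sum_distrib_left power_mult_distrib)
    also have "\<dots> \<le> 1 * 1"
      using that by (intro mult_mono) (auto simp: disc_def power_le_one sum_nonneg)
    finally show ?thesis by (auto simp: disc_def topspace_Euclidean_space)
  qed
  have "continuous_map ?P ?D ?h"
    unfolding continuous_map_in_subtopology using c im by fastforce
  moreover have "?h (0,x) = x" if "x \<in> disc n" for x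
    using that by (auto simp: disc_def topspace_Euclidean_space fun_eq_iff)
  moreover have "?h (1,x) = (\<lambda>i. 0)" for x by auto
  ultimately have "homotopic_with (\<lambda>x. True) ?D ?D id (\<lambda>x. (\<lambda>i. 0))"
    by (subst homotopic_with) (auto intro!: exI[of _ ?h] simp del: topspace_subtopology simp: topspace_disc)
  then show ?thesis unfolding contractible_space_def by blast
qed

lemma disc_boundary_0: "disc_boundary 0 = {}" and disc_0: "disc 0 = {\<lambda>i. 0}"
  by (auto simp: disc_boundary_def disc_def topspace_Euclidean_space)

lemma disc_boundary_nsphere: "subtopology (Euclidean_space (Suc n)) (disc_boundary (Suc n)) = nsphere n"
proof -
  have "topspace (Euclidean_space (Suc n)) \<inter> disc_boundary (Suc n) = topspace (Euclidean_space (Suc n)) \<inter> {x. (\<Sum>i\<le>n. x i ^ 2) = 1}"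
    by (auto simp: disc_boundary_def lessThan_Suc_atMost)
  then show ?thesis
    unfolding nsphere_def by (metis subtopology_restrict)
qed

text \<open>The disc is contractible, so its homology modulo the boundary is the reduced homology of the
  boundary sphere in the next lower degree. In dimension \<open>0\<close> the boundary is empty.\<close>

lemma relative_homology_disc:
  "relative_homology_group (int n) (disc_space n) (disc_boundary n) \<cong> integer_group"
  "j \<noteq> int n \<Longrightarrow> trivial_group (relative_homology_group j (disc_space n) (disc_boundary n))"
proof -
  let ?D = "disc_space n"
  have top: "topspace ?D = disc n" by (rule topspace_disc)
  have *: "relative_homology_group (int n) ?D (disc_boundary n) \<cong> integer_group \<and>
    (j \<noteq> int n \<longrightarrow> trivial_group (relative_homology_group j ?D (disc_boundary n)))"
  proof (cases n)
    case 0
    have "topspace ?D = {\<lambda>i. 0}" using top 0 by (simp add: disc_0)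
    then show ?thesis using homology_coefficients[of ?D] homology_dimension_axiom[of ?D _ j] 0
      by (simp add: disc_boundary_0)
  next
    case (Suc m)
    have eq: "subtopology ?D (disc_boundary n) = nsphere m"
      using disc_boundary_nsphere[of m] disc_boundary_subset[of n] Suc
      by (simp add: subtopology_subtopology Int_absorb1 Int_absorb2)
    have "(\<lambda>i. if i = 0 then 1 else 0) \<in> topspace ?D \<inter> disc_boundary n"
      unfolding top using disc_boundary_subset[of n] Suc
      by (auto simp: disc_boundary_def disc_def topspace_Euclidean_space if_distrib[of "\<lambda>x. x ^ 2"] cong: if_cong)
    then have ne: "topspace ?D \<inter> disc_boundary n \<noteq> {}" by blast
    have i: "relative_homology_group j ?D (disc_boundary n) \<cong> reduced_homology_group (j - 1) (nsphere m)" for j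
      using isomorphic_group_relative_homology_of_contractible[OF contractible_disc ne, of j] eq by simp
    have "relative_homology_group (int n) ?D (disc_boundary n) \<cong> integer_group"
      using iso_trans[OF i[of "int n"]] reduced_homology_group_nsphere(1)[of m] Suc by auto
    moreover have "trivial_group (relative_homology_group j ?D (disc_boundary n))" if "j \<noteq> int n"
      using isomorphic_group_triviality[OF i[of j]] reduced_homology_group_nsphere(2)[of "j - 1" m] Suc that by auto
    ultimately show ?thesis by blast
  qed
  then show "relative_homology_group (int n) ?D (disc_boundary n) \<cong> integer_group" by blast
  from * show "trivial_group (relative_homology_group j ?D (disc_boundary n))" if "j \<noteq> int n" using that by blast
qed

text \<open>Invariance of domain in \<open>\<real>\<^sup>m\<^sup>+\<^sup>1\<close>, applied to the open cone over \<open>U\<close>: a point \<open>x\<close> of the cone is sent to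
  the pair that consists of \<open>f\<close> of its direction and of its length. The image of \<open>f\<close> is the slice of
  the image at length \<open>1\<close>.\<close>

lemma invariance_of_domain_nsphere:
  assumes U: "openin (nsphere m) U"
    and f: "continuous_map (subtopology (nsphere m) U) (Euclidean_space m) f" and inj: "inj_on f U"
  shows "openin (Euclidean_space m) (f ` U)"
proof -
  let ?E = "Euclidean_space (Suc m)"
  define r where "r = (\<lambda>x::nat\<Rightarrow>real. sqrt (\<Sum>i\<le>m. x i ^ 2))"
  define N where "N = (\<lambda>x i. if i < Suc m then x i / r x else 0)"
  define V0 where "V0 = topspace ?E - {\<lambda>i. 0}"
  define V where "V = {x \<in> topspace (subtopology ?E V0). N x \<in> U}"
  have rpos: "r x > 0" if x: "x \<in> V0" for x
  proof -
    obtain i where i: "x i \<noteq> 0" using x by (auto simp: V0_def fun_eq_iff)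
    have "i \<le> m" using x i by (auto simp: V0_def topspace_Euclidean_space not_le[symmetric])
    then have "x i ^ 2 \<le> (\<Sum>i\<le>m. x i ^ 2)" by (intro member_le_sum) auto
    moreover have "x i ^ 2 > 0" using i by simp
    ultimately have "0 < (\<Sum>i\<le>m. x i ^ 2)" by linarith
    then show ?thesis unfolding r_def by simp
  qed
  have cr: "continuous_map ?E euclideanreal r"
    unfolding r_def by (intro continuous_map_sqrt continuous_map_sum continuous_map_real_pow continuous_map_Euclidean_coord) auto
  then have cr0: "continuous_map (subtopology ?E V0) euclideanreal r" by (rule continuous_map_from_subtopology)
  have cN: "continuous_map (subtopology ?E V0) ?E N"
    unfolding N_def continuous_map_componentwise_Euclidean_space
    by (intro allI impI continuous_map_real_divide continuous_map_from_subtopology[OF continuous_map_Euclidean_coord] cr0)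
       (use rpos in force)
  have Nsq: "(\<Sum>i\<le>m. N x i ^ 2) = 1" if "x \<in> V0" for x
  proof -
    have "(\<Sum>i\<le>m. N x i ^ 2) = (\<Sum>i\<le>m. x i ^ 2) / (r x)\<^sup>2"
      by (simp add: N_def power_divide sum_divide_distrib)
    also have "(\<Sum>i\<le>m. x i ^ 2) = (r x)\<^sup>2" by (simp add: r_def sum_nonneg)
    finally show ?thesis using rpos[OF that] by simp
  qed
  have cN': "continuous_map (subtopology ?E V0) (nsphere m) N"
    unfolding nsphere_def continuous_map_in_subtopology using cN Nsq by auto
  have o0: "openin ?E V0"
  proof -
    have "closedin ?E {\<lambda>i. 0}"
      by (rule closedin_Hausdorff_singleton[OF Hausdorff_Euclidean_space]) (simp add: topspace_Euclidean_space)
    then show ?thesis unfolding V0_def by blast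
  qed
  have "openin (subtopology ?E V0) V"
    unfolding V_def by (rule openin_continuous_map_preimage[OF cN' U])
  then have oV: "openin ?E V" using o0 openin_trans_full by blast
  have VV0: "V \<subseteq> V0" by (auto simp: V_def)
  define F where "F = (\<lambda>x i. if i < Suc m then (if i < m then f (N x) i else r x) else 0)"
  have cNV: "continuous_map (subtopology ?E V) (subtopology (nsphere m) U) N"
    unfolding continuous_map_in_subtopology
    using continuous_map_from_subtopology_mono[OF cN' VV0] by (auto simp: V_def)
  have cfN: "continuous_map (subtopology ?E V) (Euclidean_space m) (f \<circ> N)"
    by (rule continuous_map_compose[OF cNV f])
  have cF: "continuous_map (subtopology ?E V) ?E F"
    unfolding F_def continuous_map_componentwise_Euclidean_space
  proof (intro allI impI)
    fix i assume "i < Suc m"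
    show "continuous_map (subtopology ?E V) euclideanreal (\<lambda>x. if i < m then f (N x) i else r x)"
      using continuous_map_compose[OF cfN continuous_map_Euclidean_coord[of m i]]
        continuous_map_from_subtopology_mono[OF cr0 VV0]
      by (cases "i < m") (simp_all add: o_def)
  qed
  have fE: "f y \<in> topspace (Euclidean_space m)" if "y \<in> U" for y
    using f that openin_subset[OF U] by (auto simp: continuous_map_def Pi_iff)
  have injF: "inj_on F V"
  proof (rule inj_onI)
    fix x y assume xy: "x \<in> V" "y \<in> V" "F x = F y"
    have N: "N x \<in> U" "N y \<in> U" using xy by (auto simp: V_def)
    have "f (N x) i = f (N y) i" for i
    proof (cases "i < m")
      case True then show ?thesis using fun_cong[OF xy(3), of i] by (simp add: F_def)
    next
      case False then show ?thesis using fE[OF N(1)] fE[OF N(2)] by (simp add: topspace_Euclidean_space)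
    qed
    then have "N x = N y" using inj N by (meson ext inj_onD)
    moreover have "r x = r y" using fun_cong[OF xy(3), of m] by (simp add: F_def)
    moreover have "r x > 0" using rpos xy VV0 by auto
    ultimately have "x i = y i" for i
    proof (cases "i < Suc m")
      case True
      have "x i / r x = y i / r y" using fun_cong[OF \<open>N x = N y\<close>, of i] True by (simp add: N_def)
      then show ?thesis using \<open>r x = r y\<close> \<open>r x > 0\<close> by simp
    next
      case False
      have "x \<in> topspace ?E" "y \<in> topspace ?E" using xy VV0 by (auto simp: V0_def)
      then show ?thesis using False by (simp add: topspace_Euclidean_space)
    qed
    then show "x = y" by blast
  qed
  have oF: "openin ?E (F ` V)" by (rule invariance_of_domain_Euclidean_space[OF oV cF injF])
  define e where "e = (\<lambda>y i. if i < Suc m then (if i < m then y i else 1) else (0::real))"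
  have ce: "continuous_map (Euclidean_space m) ?E e"
    unfolding e_def continuous_map_componentwise_Euclidean_space
  proof (intro allI impI)
    fix i assume "i < Suc m"
    show "continuous_map (Euclidean_space m) euclideanreal (\<lambda>x. if i < m then x i else 1)"
      by (cases "i < m") (simp_all add: continuous_map_Euclidean_coord)
  qed
  have "f ` U = {y \<in> topspace (Euclidean_space m). e y \<in> F ` V}"
  proof (intro equalityI subsetI)
    fix z assume "z \<in> f ` U"
    then obtain y where y: "y \<in> U" "z = f y" by auto
    have yS: "y \<in> topspace ?E" "(\<Sum>i\<le>m. y i ^ 2) = 1"
      using openin_subset[OF U] y by (auto simp: nsphere_def)
    have r1: "r y = 1" using yS by (simp add: r_def)
    have Ny: "N y = y" using r1 yS(1) by (auto simp: N_def topspace_Euclidean_space fun_eq_iff)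
    have "y \<noteq> (\<lambda>i. 0)" using yS(2) by auto
    then have yV: "y \<in> V" using yS y Ny by (auto simp: V_def V0_def)
    have "e z = F y" using r1 Ny y by (auto simp: e_def F_def)
    then show "z \<in> {y \<in> topspace (Euclidean_space m). e y \<in> F ` V}" using fE y yV by auto
  next
    fix z assume "z \<in> {y \<in> topspace (Euclidean_space m). e y \<in> F ` V}"
    then obtain y where z: "z \<in> topspace (Euclidean_space m)" and y: "y \<in> V" "e z = F y" by auto
    have NU: "N y \<in> U" using y by (auto simp: V_def)
    have "z i = f (N y) i" for i
    proof (cases "i < m")
      case True then show ?thesis using fun_cong[OF y(2), of i] by (simp add: F_def e_def)
    next
      case False then show ?thesis using fE[OF NU] z by (simp add: topspace_Euclidean_space)
    qed
    then show "z \<in> f ` U" using NU by blast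
  qed
  then show ?thesis using openin_continuous_map_preimage[OF ce oF] by simp
qed

text \<open>Composed with the inclusion of \<open>\<real>\<^sup>k\<close> into \<open>\<real>\<^sup>m\<close>, the map would have an open image in which the \<open>k\<close>-th
  coordinate is constantly \<open>0\<close>.\<close>

lemma no_embedding_nsphere_lower:
  assumes U: "openin (nsphere m) U" "U \<noteq> {}" and k: "k < m"
    and f: "continuous_map (subtopology (nsphere m) U) (Euclidean_space k) f" and inj: "inj_on f U"
  shows False
proof -
  have "continuous_map (Euclidean_space k) (Euclidean_space m) id"
    using k by (auto simp: Euclidean_space_def continuous_map_in_subtopology continuous_map_from_subtopology)
  from continuous_map_compose[OF f this] have f': "continuous_map (subtopology (nsphere m) U) (Euclidean_space m) f" by simp
  have o: "openin (Euclidean_space m) (f ` U)" by (rule invariance_of_domain_nsphere[OF U(1) f' inj])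
  obtain z where z: "z \<in> f ` U" using U(2) by auto
  have zk: "y i = 0" if "y \<in> f ` U" "i \<ge> k" for y i
    using that f openin_subset[OF U(1)] by (auto simp: continuous_map_def Pi_iff topspace_Euclidean_space)
  define g where "g = (\<lambda>t::real. \<lambda>i. if i < m then (if i = k then t else z i) else 0)"
  have cg: "continuous_map euclideanreal (Euclidean_space m) g"
    unfolding g_def continuous_map_componentwise_Euclidean_space
  proof (intro allI impI)
    fix i assume "i < m"
    show "continuous_map euclideanreal euclideanreal (\<lambda>x. if i = k then x else z i)"
      by (cases "i = k") simp_all
  qed
  have "g 0 = z" using zk[OF z] k by (auto simp: g_def fun_eq_iff)
  have "openin euclideanreal {t \<in> topspace euclideanreal. g t \<in> f ` U}"
    by (rule openin_continuous_map_preimage[OF cg o])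
  then have "open {t. g t \<in> f ` U}" by simp
  moreover have "{t. g t \<in> f ` U} = {0}"
  proof (intro equalityI subsetI)
    fix t assume "t \<in> {t. g t \<in> f ` U}"
    then have "g t k = 0" using zk by blast
    then show "t \<in> {0}" using k by (simp add: g_def)
  qed (use z \<open>g 0 = z\<close> in auto)
  ultimately show False using not_open_singleton[of "0::real"] by simp
qed

lemma disc_subset_closedin:
  assumes C: "closedin (Euclidean_space m) C" and sub: "disc_interior m \<subseteq> C"
  shows "disc m \<subseteq> C"
proof
  fix z assume z: "z \<in> disc m"
  define g where "g = (\<lambda>t::real. \<lambda>i. if i < m then t * z i else 0)"
  have cg: "continuous_map euclideanreal (Euclidean_space m) g"
    unfolding g_def continuous_map_componentwise_Euclidean_space
    by (intro allI impI continuous_map_real_mult) auto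
  have "closedin euclideanreal {t \<in> topspace euclideanreal. g t \<in> C}"
    by (rule closedin_continuous_map_preimage[OF cg C])
  then have cl: "closed {t. g t \<in> C}" by simp
  have "{0<..<1} \<subseteq> {t. g t \<in> C}"
  proof
    fix t :: real assume t: "t \<in> {0<..<1}"
    have "(\<Sum>i<m. (g t i)\<^sup>2) = t\<^sup>2 * (\<Sum>i<m. z i ^ 2)"
      by (simp add: g_def sum_distrib_left power_mult_distrib)
    also have "\<dots> \<le> t\<^sup>2 * 1" using z by (intro mult_left_mono) (auto simp: disc_def)
    also have "\<dots> < 1" using t by (simp add: power_less_one_iff)
    finally have "g t \<in> disc_interior m" by (auto simp: disc_interior_def topspace_Euclidean_space g_def)
    then show "t \<in> {t. g t \<in> C}" using sub by auto
  qed
  then have "closure {0<..<1} \<subseteq> {t. g t \<in> C}" using cl by (rule closure_minimal)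
  moreover have "(1::real) \<in> closure {0<..<1}" by (simp add: closure_greaterThanLessThan)
  ultimately have "g 1 \<in> C" by blast
  moreover have "g 1 = z" using z by (auto simp: g_def disc_def topspace_Euclidean_space fun_eq_iff)
  ultimately show "z \<in> C" by simp
qed

lemma connectedin_disc_interior: "connectedin (Euclidean_space m) (disc_interior m)"
proof -
  have "path_connectedin (Euclidean_space m) (disc_interior m)"
  proof (rule lemma_iod[of "disc_interior m"])
    show "disc_interior m \<subseteq> topspace (Euclidean_space m)" by (auto simp: disc_interior_def)
    fix a b and u :: real assume ab: "a \<in> disc_interior m" "b \<in> disc_interior m" and u: "0 < u" "u < 1"
    have conv: "((1 - u) * x + u * y)\<^sup>2 \<le> (1 - u) * x\<^sup>2 + u * y\<^sup>2" for x y :: real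
    proof -
      have "(1 - u) * x\<^sup>2 + u * y\<^sup>2 - ((1 - u) * x + u * y)\<^sup>2 = u * (1 - u) * (x - y)\<^sup>2"
        by (simp add: power2_eq_square algebra_simps)
      also have "\<dots> \<ge> 0" using u by simp
      finally show ?thesis by simp
    qed
    have "(\<Sum>i<m. ((1 - u) * a i + u * b i)\<^sup>2) \<le> (\<Sum>i<m. (1 - u) * (a i)\<^sup>2 + u * (b i)\<^sup>2)"
      by (intro sum_mono conv)
    also have "\<dots> = (1 - u) * (\<Sum>i<m. (a i)\<^sup>2) + u * (\<Sum>i<m. (b i)\<^sup>2)"
      by (simp add: sum.distrib sum_distrib_left)
    also have "\<dots> < (1 - u) * 1 + u * 1"
      using ab u by (intro add_strict_mono mult_strict_left_mono) (auto simp: disc_interior_def)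
    finally show "(\<lambda>i. (1 - u) * a i + u * b i) \<in> disc_interior m"
      using ab by (auto simp: disc_interior_def topspace_Euclidean_space)
  qed (use zero_in_disc_interior in auto)
  then show ?thesis by (rule path_connectedin_imp_connectedin)
qed

lemma interior_of_finite_Union_empty:
  assumes "finite I" "\<And>i. i \<in> I \<Longrightarrow> closedin W (C i)" "\<And>i. i \<in> I \<Longrightarrow> W interior_of (C i) = {}"
  shows "W interior_of (\<Union>i\<in>I. C i) = {}"
  using assms
proof (induction I rule: finite_induct)
  case (insert i I)
  then show ?case by (simp add: interior_of_union_eq_empty)
qed auto

section \<open>Regular CW complexes: closed cells are unions of open cells\<close>

locale regular_cw =
  fixes K :: "'x cell_complex"
  assumes regular: "regular_cw_complex K"
begin

abbreviation "W \<equiv> cw_space K"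
abbreviation "cells \<equiv> cw_cells K"
abbreviation "dm \<equiv> cw_dim K"
abbreviation "zdim s \<equiv> int (cw_dim K s)"
abbreviation "bnd \<equiv> cell_boundary K"

lemma Hausdorff: "Hausdorff_space W"
  using regular by (simp add: regular_cw_complex_def cw_complex_def)

lemma char_homeo:
  "s \<in> cells \<Longrightarrow> homeomorphic_map (disc_space (dm s)) (subtopology W s) (cw_char K s)"
  using regular by (simp add: regular_cw_complex_def)

lemma char_continuous:
  "s \<in> cells \<Longrightarrow> continuous_map (disc_space (dm s)) W (cw_char K s)"
  using regular by (simp add: regular_cw_complex_def cw_complex_def)

lemma char_image: "s \<in> cells \<Longrightarrow> cw_char K s ` disc (dm s) = s"
  using regular by (simp add: regular_cw_complex_def cw_complex_def)

lemma boundary_finite_cover: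
  "s \<in> cells \<Longrightarrow> \<exists>T\<subseteq>cells. finite T \<and> (\<forall>t\<in>T. dm t < dm s) \<and> bnd s \<subseteq> (\<Union>t\<in>T. open_cell K t)"
  using regular by (simp add: regular_cw_complex_def cw_complex_def)

lemma open_cells_cover: "(\<Union>s\<in>cells. open_cell K s) = topspace W"
  using regular by (simp add: regular_cw_complex_def cw_complex_def)

lemma open_cells_disjoint: "s \<in> cells \<Longrightarrow> t \<in> cells \<Longrightarrow> x \<in> open_cell K s \<Longrightarrow> x \<in> open_cell K t \<Longrightarrow> s = t"
  using regular unfolding regular_cw_complex_def cw_complex_def by blast

lemma weak_topology:
  "A \<subseteq> topspace W \<Longrightarrow> (\<And>s. s \<in> cells \<Longrightarrow> closedin W (A \<inter> s)) \<Longrightarrow> closedin W A"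
  using regular by (simp add: regular_cw_complex_def cw_complex_def)

lemma char_inj: "s \<in> cells \<Longrightarrow> inj_on (cw_char K s) (disc (dm s))"
  using homeomorphic_imp_injective_map[OF char_homeo] topspace_disc by metis

lemma cell_compact: assumes "s \<in> cells" shows "compactin W s"
proof -
  have "compactin (disc_space (dm s)) (disc (dm s))"
    using compactin_disc by (simp add: compactin_subtopology)
  from image_compactin[OF this char_continuous[OF assms]] show ?thesis
    using char_image[OF assms] by simp
qed

lemma cell_subset: "s \<in> cells \<Longrightarrow> s \<subseteq> topspace W"
  using cell_compact compactin_subset_topspace by blast

lemma cell_closed: "s \<in> cells \<Longrightarrow> closedin W s"
  using cell_compact compactin_imp_closedin[OF Hausdorff] by blast

lemma cell_split: "s \<in> cells \<Longrightarrow> s = open_cell K s \<union> bnd s"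
  using char_image[of s] disc_split(1)[of "dm s"] by (simp add: open_cell_def cell_boundary_def image_Un)

lemma cell_split_disjoint: "s \<in> cells \<Longrightarrow> open_cell K s \<inter> bnd s = {}"
  unfolding open_cell_def cell_boundary_def
  using inj_on_image_Int[OF char_inj disc_interior_subset disc_boundary_subset] disc_split(2) by (metis image_empty)

lemma open_cell_subset: "s \<in> cells \<Longrightarrow> open_cell K s \<subseteq> s" and cell_boundary_subset: "s \<in> cells \<Longrightarrow> bnd s \<subseteq> s"
  using cell_split by blast+

lemma open_cell_nonempty: "open_cell K s \<noteq> {}"
  using zero_in_disc_interior by (auto simp: open_cell_def)

lemma cell_nonempty: "s \<in> cells \<Longrightarrow> s \<noteq> {}"
  using open_cell_nonempty open_cell_subset by blast

lemma compactin_disc_boundary: "compactin (Euclidean_space n) (disc_boundary n)"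
proof -
  have "closedin (Euclidean_space n) {x \<in> topspace (Euclidean_space n). (\<Sum>i<n. x i ^ 2) \<in> {1}}"
    by (rule closedin_continuous_map_preimage)
       (auto intro!: continuous_map_sum continuous_map_real_pow continuous_map_Euclidean_coord)
  moreover have "{x \<in> topspace (Euclidean_space n). (\<Sum>i<n. x i ^ 2) \<in> {1}} = disc_boundary n"
    by (auto simp: disc_boundary_def)
  ultimately show ?thesis
    using closed_compactin[OF compactin_disc disc_boundary_subset] by simp
qed

lemma cell_boundary_closed: assumes "s \<in> cells" shows "closedin W (bnd s)"
proof -
  have "compactin (disc_space (dm s)) (disc_boundary (dm s))"
    using compactin_disc_boundary disc_boundary_subset by (simp add: compactin_subtopology)
  from image_compactin[OF this char_continuous[OF assms]] show ?thesis
    using compactin_imp_closedin[OF Hausdorff] by (simp add: cell_boundary_def)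
qed

lemma boundary_lower_dim:
  assumes "s \<in> cells" "t \<in> cells" "x \<in> bnd s" "x \<in> open_cell K t"
  shows "dm t < dm s"
proof -
  obtain T where T: "T \<subseteq> cells" "\<forall>t\<in>T. dm t < dm s" "bnd s \<subseteq> (\<Union>t\<in>T. open_cell K t)"
    using boundary_finite_cover[OF assms(1)] by blast
  then obtain e where e: "e \<in> T" "x \<in> open_cell K e" using assms(3) by blast
  then have "e = t" using open_cells_disjoint assms T(1) by blast
  then show ?thesis using e T by blast
qed

lemma in_closed_cell_open:
  assumes "s \<in> cells" "t \<in> cells" "x \<in> s" "x \<in> open_cell K t"
  shows "t = s \<or> (x \<in> bnd s \<and> dm t < dm s)"
  using assms cell_split[OF assms(1)] boundary_lower_dim open_cells_disjoint by blast

text \<open>Induction on the dimension \<open>m + 1\<close> of \<open>s\<close>: it suffices that \<open>x\<close> lies in an \<open>m\<close>-cell that is contained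
  in the boundary sphere of \<open>s\<close>. The sphere is covered by finitely many closed cells of dimension at
  most \<open>m\<close>. Those of dimension below \<open>m\<close> are nowhere dense in it, so that the others cover it as well.
  An \<open>m\<close>-cell whose interior meets the sphere lies in the sphere, because the part of the
  interior on the sphere is closed in the interior and, by invariance of domain, open.\<close>

lemma cell_face_subset:
  assumes "s \<in> cells" "t \<in> cells" "x \<in> s" "x \<in> open_cell K t"
  shows "t \<subseteq> s"
  using assms
proof (induction "dm s" arbitrary: s x rule: less_induct)
  case less
  show ?case
  proof (cases "x \<in> open_cell K s")
    case True
    then show ?thesis using less.prems open_cells_disjoint by blast
  next
    case False
    then have xb: "x \<in> bnd s" using less.prems cell_split by blast
    define h where "h = cw_char K s"
    have "disc_boundary (dm s) \<noteq> {}" using xb by (auto simp: cell_boundary_def)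
    then obtain m where m: "dm s = Suc m" using disc_boundary_0 by (cases "dm s") auto
    let ?B = "disc_boundary (Suc m)"
    let ?S = "nsphere m"
    have topS: "topspace ?S = ?B"
      using disc_boundary_nsphere[of m] disc_boundary_subset[of "Suc m"] disc_subset[of "Suc m"]
      by (metis dual_order.trans topspace_subtopology_subset)
    have bnd: "bnd s = h ` ?B" by (simp add: cell_boundary_def h_def m)
    have contS: "continuous_map ?S W h"
      using continuous_map_from_subtopology_mono[OF char_continuous[OF less.prems(1)], of ?B] disc_boundary_subset[of "Suc m"]
      unfolding m h_def disc_boundary_nsphere by simp
    have injS: "inj_on h ?B"
      using char_inj[OF less.prems(1)] disc_boundary_subset[of "Suc m"] unfolding m h_def by (rule inj_on_subset)
    obtain T where T: "T \<subseteq> cells" "finite T" "\<And>e. e \<in> T \<Longrightarrow> dm e < Suc m" "bnd s \<subseteq> (\<Union>e\<in>T. open_cell K e)"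
      using boundary_finite_cover[OF less.prems(1)] m by auto
    define U where "U = (\<lambda>e. {y \<in> topspace ?S. h y \<in> e})"
    have Ucl: "closedin ?S (U e)" if "e \<in> T" for e
      unfolding U_def using closedin_continuous_map_preimage[OF contS] cell_closed T(1) that by blast
    have inT: "\<exists>e\<in>T. h y \<in> open_cell K e" if "y \<in> ?B" for y
      using T(4) that bnd by blast
    \<comment> \<open>Where the sphere meets the closed cell \<open>e\<close>, the chart of \<open>e\<close> embeds it into Euclidean space.\<close>
    have chart: "\<exists>f. continuous_map (subtopology ?S (U e)) (Euclidean_space (dm e)) f \<and> inj_on f (U e) \<and>
        (\<forall>y\<in>U e. f y \<in> disc (dm e) \<and> cw_char K e (f y) = h y)" if e: "e \<in> T" for e
    proof -
      have ec: "e \<in> cells" using e T by auto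
      obtain g where g: "homeomorphic_maps (disc_space (dm e)) (subtopology W e) (cw_char K e) g"
        using char_homeo[OF ec] unfolding homeomorphic_map_maps by blast
      have gm: "continuous_map (subtopology W e) (disc_space (dm e)) g"
        using g by (simp add: homeomorphic_maps_def)
      have cg: "cw_char K e (g y) = y" if "y \<in> e" for y
        using g that topspace_subtopology_subset[OF cell_subset[OF ec]] unfolding homeomorphic_maps_def by metis
      have gd: "g y \<in> disc (dm e)" if "y \<in> e" for y
        using gm that topspace_subtopology_subset[OF cell_subset[OF ec]] topspace_disc unfolding continuous_map_def
        by (metis PiE)
      have "continuous_map (subtopology ?S (U e)) (subtopology W e) h"
        unfolding continuous_map_in_subtopology using contS by (auto simp: U_def continuous_map_from_subtopology)
      from continuous_map_compose[OF this gm]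
      have "continuous_map (subtopology ?S (U e)) (Euclidean_space (dm e)) (g \<circ> h)"
        by (simp add: continuous_map_in_subtopology)
      moreover have "inj_on (g \<circ> h) (U e)"
      proof (rule inj_onI)
        fix y y' assume y: "y \<in> U e" "y' \<in> U e" "(g \<circ> h) y = (g \<circ> h) y'"
        then have "h y \<in> e" "h y' \<in> e" "y \<in> ?B" "y' \<in> ?B" using topS by (auto simp: U_def)
        moreover from this have "h y = h y'" using cg y(3) by (metis comp_apply)
        ultimately show "y = y'" using injS by (meson inj_onD)
      qed
      ultimately show ?thesis using cg gd by (intro exI[of _ "g \<circ> h"]) (auto simp: U_def)
    qed
    \<comment> \<open>An open subset of the sphere does not embed into a Euclidean space of lower dimension.\<close>
    have thin: "?S interior_of (U e) = {}" if e: "e \<in> T" "dm e < m" for e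
    proof (rule ccontr)
      let ?V = "?S interior_of (U e)"
      assume ne: "?V \<noteq> {}"
      obtain f where f: "continuous_map (subtopology ?S (U e)) (Euclidean_space (dm e)) f" "inj_on f (U e)"
        using chart[OF e(1)] by blast
      have sub: "?V \<subseteq> U e" by (rule interior_of_subset)
      show False
        by (rule no_embedding_nsphere_lower[OF openin_interior_of ne e(2) continuous_map_from_subtopology_mono[OF f(1) sub] inj_on_subset[OF f(2) sub]])
    qed
    \<comment> \<open>The part \<open>U0\<close> of the sphere in the open cell misses only finitely many closed cells, so it is
       open. In the chart of \<open>e\<close> its image is therefore open and closed in the interior of the disc.\<close>
    have thick: "e \<subseteq> bnd s" if e: "e \<in> T" "dm e = m" and y0: "y0 \<in> ?B" "h y0 \<in> open_cell K e" for e y0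
    proof -
      have ec: "e \<in> cells" using e T by auto
      define U0 where "U0 = {y \<in> topspace ?S. h y \<in> open_cell K e}"
      have U0U: "U0 \<subseteq> U e" using open_cell_subset[OF ec] by (auto simp: U0_def U_def)
      have "U0 = topspace ?S - (\<Union>e'\<in>T-{e}. U e')"
      proof (intro equalityI subsetI)
        fix y assume y: "y \<in> U0"
        have "y \<notin> U e'" if "e' \<in> T - {e}" for e'
        proof
          assume "y \<in> U e'"
          then have "h y \<in> e'" by (simp add: U_def)
          moreover have "e' \<in> cells" "h y \<in> open_cell K e" using T that y by (auto simp: U0_def)
          ultimately have "e = e' \<or> dm e < dm e'" using in_closed_cell_open ec by blast
          then show False using that T(3)[of e'] e(2) by auto
        qed
        then show "y \<in> topspace ?S - (\<Union>e'\<in>T-{e}. U e')" using y by (auto simp: U0_def)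
      next
        fix y assume y: "y \<in> topspace ?S - (\<Union>e'\<in>T-{e}. U e')"
        then have "y \<in> ?B" using topS by auto
        then obtain e' where e': "e' \<in> T" "h y \<in> open_cell K e'" using inT by blast
        then have "h y \<in> e'" using open_cell_subset[of e'] T(1) by auto
        then have "e' = e" using y e' by (auto simp: U_def)
        then show "y \<in> U0" using y e' by (auto simp: U0_def)
      qed
      moreover have "closedin ?S (\<Union>e'\<in>T-{e}. U e')" using Ucl T(2) by (intro closedin_Union) auto
      ultimately have U0o: "openin ?S U0" by auto
      obtain f where f: "continuous_map (subtopology ?S (U e)) (Euclidean_space m) f" "inj_on f (U e)"
        and fd: "\<And>y. y \<in> U e \<Longrightarrow> f y \<in> disc m \<and> cw_char K e (f y) = h y"
        using chart[OF e(1)] e(2) by blast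
      have fo: "openin (Euclidean_space m) (f ` U0)"
        by (rule invariance_of_domain_nsphere[OF U0o continuous_map_from_subtopology_mono[OF f(1) U0U] inj_on_subset[OF f(2) U0U]])
      define C where "C = {z \<in> topspace (disc_space m). cw_char K e z \<in> bnd s}"
      have "closedin (disc_space m) C"
        unfolding C_def using closedin_continuous_map_preimage[OF char_continuous[OF ec] cell_boundary_closed[OF less.prems(1)]] e(2) by simp
      then have Ccl: "closedin (Euclidean_space m) C"
        using closedin_trans_full compactin_imp_closedin[OF Hausdorff_Euclidean_space compactin_disc] by blast
      have Ci: "f ` U0 = C \<inter> disc_interior m"
      proof (intro equalityI subsetI)
        fix z assume "z \<in> f ` U0"
        then obtain y where y: "y \<in> U0" "z = f y" by auto
        then have z: "z \<in> disc m" "cw_char K e z = h y" using fd U0U by auto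
        have "h y \<in> bnd s" "h y \<in> open_cell K e" using y topS bnd by (auto simp: U0_def)
        then obtain z' where z': "z' \<in> disc_interior m" "cw_char K e z' = h y" using e(2) by (auto simp: open_cell_def)
        have "z' = z" using inj_onD[OF char_inj[OF ec]] z z' e(2) disc_interior_subset by (metis subsetD)
        then show "z \<in> C \<inter> disc_interior m" using z z' \<open>h y \<in> bnd s\<close> topspace_disc by (auto simp: C_def)
      next
        fix z assume z: "z \<in> C \<inter> disc_interior m"
        then obtain y where y: "y \<in> ?B" "cw_char K e z = h y" using bnd by (auto simp: C_def)
        have "h y \<in> open_cell K e" using z y e(2) unfolding open_cell_def by (metis IntD2 imageI)
        then have "y \<in> U0" using y topS by (simp add: U0_def)
        moreover have "f y = z" using fd[of y] U0U calculation y z inj_onD[OF char_inj[OF ec]] e(2) disc_interior_subset by (metis IntD2 subsetD)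
        ultimately show "z \<in> f ` U0" by blast
      qed
      have ne: "f ` U0 \<noteq> {}" using y0 topS by (auto simp: U0_def)
      have "disc_interior m \<subseteq> C"
      proof (rule ccontr)
        assume "\<not> disc_interior m \<subseteq> C"
        then have n2: "(topspace (Euclidean_space m) - C) \<inter> disc_interior m \<noteq> {}"
          by (auto simp: disc_interior_def)
        have o2: "openin (Euclidean_space m) (topspace (Euclidean_space m) - C)" using Ccl by blast
        from connectedin_disc_interior[of m] fo o2 n2 ne Ci show False
          unfolding connectedin by (auto simp: disc_interior_def)
      qed
      then have "disc m \<subseteq> C" by (rule disc_subset_closedin[OF Ccl])
      then have "cw_char K e ` disc m \<subseteq> bnd s" by (auto simp: C_def)
      then show ?thesis using char_image[OF ec] e(2) by simp
    qed
    \<comment> \<open>The part of the sphere outside its \<open>m\<close>-cells is open and covered by cells of lower dimension,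
       hence empty.\<close>
    obtain y where y: "y \<in> ?B" "x = h y" using xb bnd by auto
    have "\<exists>e\<in>T. x \<in> e \<and> dm e = m \<and> e \<subseteq> bnd s"
    proof (rule ccontr)
      assume neg: "\<not> ?thesis"
      define T1 where "T1 = {e \<in> T. dm e = m \<and> e \<subseteq> bnd s}"
      define V where "V = topspace ?S - (\<Union>e\<in>T1. U e)"
      have "openin ?S V" unfolding V_def using Ucl T(2) by (auto simp: T1_def intro!: openin_diff closedin_Union)
      moreover have "V \<subseteq> (\<Union>e\<in>{e \<in> T. dm e < m}. U e)"
      proof
        fix y' assume y': "y' \<in> V"
        then have B: "y' \<in> ?B" using topS by (auto simp: V_def)
        obtain e where e: "e \<in> T" "h y' \<in> open_cell K e" using inT[OF B] by blast
        have U: "y' \<in> U e" using e open_cell_subset T B topS by (auto simp: U_def)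
        have "dm e \<noteq> m"
        proof
          assume "dm e = m"
          then have "e \<in> T1" using thick[OF e(1) _ B e(2)] e by (auto simp: T1_def)
          then show False using y' U by (auto simp: V_def)
        qed
        then show "y' \<in> (\<Union>e\<in>{e \<in> T. dm e < m}. U e)" using e(1) T(3)[OF e(1)] U by auto
      qed
      ultimately have "V \<subseteq> ?S interior_of (\<Union>e\<in>{e \<in> T. dm e < m}. U e)" by (simp add: interior_of_maximal)
      also have "\<dots> = {}" by (rule interior_of_finite_Union_empty) (use T(2) Ucl thin in auto)
      finally have "V = {}" by simp
      moreover have "y \<in> V" using neg y topS by (auto simp: V_def T1_def U_def)
      ultimately show False by simp
    qed
    then obtain e where e: "e \<in> T" "x \<in> e" "dm e = m" "e \<subseteq> bnd s" by blast
    have "t \<subseteq> e" using less.hyps[of e x] e m T less.prems by auto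
    then show ?thesis using e(4) cell_boundary_subset[OF less.prems(1)] by blast
  qed
qed

end

section \<open>Integral linear combinations in multiplicative notation\<close>

definition lincomb :: "('a, 'b) monoid_scheme \<Rightarrow> ('i \<Rightarrow> 'a) \<Rightarrow> ('i \<Rightarrow> int) \<Rightarrow> 'i set \<Rightarrow> 'a" where
  "lincomb G g a A = finprod G (\<lambda>s. g s [^]\<^bsub>G\<^esub> a s) A"

lemma (in comm_group) lincomb_closed: "g \<in> A \<rightarrow> carrier G \<Longrightarrow> lincomb G g a A \<in> carrier G"
  unfolding lincomb_def by (intro finprod_closed) (auto simp: Pi_iff)

lemma (in comm_group) lincomb_cong:
  assumes "\<And>s. s \<in> A \<Longrightarrow> g s = g' s" "\<And>s. s \<in> A \<Longrightarrow> a s = a' s" "g' \<in> A \<rightarrow> carrier G"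
  shows "lincomb G g a A = lincomb G g' a' A"
  unfolding lincomb_def by (intro finprod_cong') (use assms in \<open>auto simp: Pi_iff\<close>)

lemma (in comm_group) lincomb_add:
  assumes "g \<in> A \<rightarrow> carrier G"
  shows "lincomb G g (\<lambda>s. a s + b s) A = lincomb G g a A \<otimes> lincomb G g b A"
proof -
  have "finprod G (\<lambda>s. g s [^] (a s + b s)) A = finprod G (\<lambda>s. g s [^] a s \<otimes> g s [^] b s) A"
    using assms by (intro finprod_cong'[OF refl]) (auto simp: Pi_iff int_pow_mult)
  also have "\<dots> = finprod G (\<lambda>s. g s [^] a s) A \<otimes> finprod G (\<lambda>s. g s [^] b s) A"
    using assms by (intro finprod_multf) (auto simp: Pi_iff)
  finally show ?thesis unfolding lincomb_def .
qed

lemma (in comm_group) lincomb_zero: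
  "(\<And>s. s \<in> A \<Longrightarrow> a s = 0) \<Longrightarrow> lincomb G g a A = \<one>"
  unfolding lincomb_def by (rule finprod_one_eqI) auto

lemma (in comm_group) lincomb_insert:
  "finite A \<Longrightarrow> s \<notin> A \<Longrightarrow> g \<in> insert s A \<rightarrow> carrier G \<Longrightarrow> lincomb G g a (insert s A) = g s [^] a s \<otimes> lincomb G g a A"
  unfolding lincomb_def by (subst finprod_insert) (auto simp: Pi_iff)

lemma (in comm_group) lincomb_smult:
  assumes "finite A" "g \<in> A \<rightarrow> carrier G"
  shows "lincomb G g (\<lambda>s. k * a s) A = lincomb G g a A [^] (k :: int)"
  using assms
proof (induction A rule: finite_induct)
  case empty
  then show ?case by (simp add: lincomb_def)
next
  case (insert s A)
  then have g: "g s \<in> carrier G" "g \<in> A \<rightarrow> carrier G" by auto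
  have "g s [^] (k * a s) = (g s [^] a s) [^] k" using g by (simp add: int_pow_pow mult.commute)
  then show ?case using insert g by (simp add: lincomb_insert int_pow_distrib lincomb_closed)
qed

lemma (in comm_group) lincomb_lincomb:
  assumes "finite B" "finite A" "g \<in> A \<rightarrow> carrier G"
  shows "lincomb G (\<lambda>v. lincomb G g (c v) A) b B = lincomb G g (\<lambda>s. \<Sum>v\<in>B. b v * c v s) A"
  using assms(1)
proof (induction B rule: finite_induct)
  case empty
  then show ?case by (simp add: lincomb_zero) (simp add: lincomb_def)
next
  case (insert v B)
  have "lincomb G (\<lambda>v. lincomb G g (c v) A) b (insert v B) = lincomb G g (c v) A [^] b v \<otimes> lincomb G g (\<lambda>s. \<Sum>v\<in>B. b v * c v s) A"
    using insert assms by (subst lincomb_insert) (auto simp: lincomb_closed)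
  also have "\<dots> = lincomb G g (\<lambda>s. b v * c v s + (\<Sum>v\<in>B. b v * c v s)) A"
    using assms by (simp add: lincomb_smult lincomb_add)
  finally show ?case using insert by simp
qed

lemma hom_lincomb:
  assumes G: "comm_group G" and H: "comm_group H" and h: "h \<in> hom G H" and fin: "finite A" and g: "g \<in> A \<rightarrow> carrier G"
  shows "h (lincomb G g a A) = lincomb H (\<lambda>s. h (g s)) a A"
  using fin g
proof (induction A rule: finite_induct)
  case empty
  interpret G: comm_group G by fact
  interpret H: comm_group H by fact
  show ?case using hom_one[OF h] by (simp add: lincomb_def G.group_axioms H.group_axioms)
next
  case (insert s A)
  interpret G: comm_group G by fact
  interpret H: comm_group H by fact
  have hc: "h x \<in> carrier H" if "x \<in> carrier G" for x using h that by (auto simp: hom_def)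
  have g: "g s \<in> carrier G" "g \<in> A \<rightarrow> carrier G" using insert by auto
  have hg: "(\<lambda>s. h (g s)) \<in> insert s A \<rightarrow> carrier H" using insert.prems hc by auto
  have "h (lincomb G g a (insert s A)) = h (g s [^]\<^bsub>G\<^esub> a s) \<otimes>\<^bsub>H\<^esub> h (lincomb G g a A)"
    using insert by (simp add: G.lincomb_insert hom_mult[OF h] g G.lincomb_closed)
  also have "h (g s [^]\<^bsub>G\<^esub> a s) = h (g s) [^]\<^bsub>H\<^esub> a s"
    by (rule hom_int_pow[OF h g(1) G.group_axioms H.group_axioms])
  also have "h (lincomb G g a A) = lincomb H (\<lambda>s. h (g s)) a A" using insert g by simp
  finally show ?case using H.lincomb_insert[OF insert.hyps(1,2) hg] by simp
qed

lemma (in comm_group) lincomb_superset: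
  assumes "finite B" "A \<subseteq> B" "\<And>s. s \<in> B - A \<Longrightarrow> a s = 0" "g \<in> B \<rightarrow> carrier G"
  shows "lincomb G g a A = lincomb G g a B"
  unfolding lincomb_def
  by (rule finprod_mono_neutral_cong_left) (use assms in \<open>auto simp: Pi_iff\<close>)

lemma (in comm_group) lincomb_single:
  assumes "finite A" "t \<in> A" "\<And>s. s \<in> A - {t} \<Longrightarrow> g s = \<one>" "g t \<in> carrier G"
  shows "lincomb G g a A = g t [^] a t"
proof -
  have "lincomb G g a A = lincomb G g a (insert t (A - {t}))" using assms(2) by (simp add: insert_absorb)
  also have "\<dots> = g t [^] a t \<otimes> lincomb G g a (A - {t})"
  proof (rule lincomb_insert)
    show "g \<in> insert t (A - {t}) \<rightarrow> carrier G"
    proof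
      fix x assume "x \<in> insert t (A - {t})"
      then show "g x \<in> carrier G" using assms(3)[of x] assms(4) by (cases "x = t") auto
    qed
  qed (use assms(1) in auto)
  also have "lincomb G g a (A - {t}) = \<one>"
    unfolding lincomb_def by (rule finprod_one_eqI) (use assms(3) in simp)
  finally show ?thesis using assms(4) by simp
qed

lemma infinite_cyclic_generator:
  assumes "group G" "G \<cong> integer_group"
  shows "\<exists>w \<in> carrier G. generate G {w} = carrier G"
proof -
  interpret group G by fact
  have gZ: "group integer_group" by simp
  obtain f where f: "f \<in> iso integer_group G"
    using iso_sym[OF assms(2)] by (auto simp: is_iso_def)
  then have h: "f \<in> hom integer_group G" and bij: "bij_betw f UNIV (carrier G)" by (auto simp: iso_def)
  let ?w = "f 1"
  have w: "?w \<in> carrier G" using bij by (auto simp: bij_betw_def)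
  have fk: "f k = ?w [^]\<^bsub>G\<^esub> (k::int)" for k
    using hom_int_pow[OF h _ gZ group_axioms, of 1 k] by simp
  have "carrier G \<subseteq> generate G {?w}"
  proof
    fix x assume "x \<in> carrier G"
    then obtain k where "x = f k" using bij by (metis bij_betw_imp_surj_on imageE)
    then have "x = ?w [^]\<^bsub>G\<^esub> k" by (rule trans[OF _ fk])
    then show "x \<in> generate G {?w}" unfolding generate_pow[OF w] by blast
  qed
  then show ?thesis using w generate_incl[of "{?w}"] by auto
qed

lemma infinite_cyclic_pow_inj:
  assumes "group G" "G \<cong> integer_group" "w \<in> carrier G" "generate G {w} = carrier G" "w [^]\<^bsub>G\<^esub> (a::int) = w [^]\<^bsub>G\<^esub> b"
  shows "a = b"
proof -
  interpret group G by fact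
  obtain f where f: "f \<in> iso G integer_group" using assms by (auto simp: is_iso_def)
  then have h: "f \<in> hom G integer_group" and bij: "bij_betw f (carrier G) UNIV" by (auto simp: iso_def)
  have p: "f (w [^]\<^bsub>G\<^esub> (k::int)) = k * f w" for k
    using hom_int_pow[OF h assms(3) group_axioms, of k] by simp
  obtain x where x: "x \<in> carrier G" "f x = 1" using bij by (metis UNIV_I bij_betw_imp_surj_on imageE)
  have "x \<in> {w [^]\<^bsub>G\<^esub> (k::int) | k. k \<in> UNIV}"
    by (rule eqset_imp_iff[THEN iffD1, OF trans[OF assms(4)[symmetric] generate_pow[OF assms(3)]] x(1)])
  then obtain k :: int where "x = w [^]\<^bsub>G\<^esub> k" by (elim CollectE exE conjE) (rule that)
  then have nz: "f w \<noteq> 0" using x p[of k] by auto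
  have "a * f w = f (w [^]\<^bsub>G\<^esub> a)" by (rule p[symmetric])
  also have "\<dots> = b * f w" unfolding assms(5) by (rule p)
  finally show ?thesis using nz by simp
qed

section \<open>Relative homology of subspaces\<close>

text \<open>All pairs of spaces consist of subsets of one ambient space, all maps between them are
  inclusions, and the subsets are the parameters. This keeps the exact sequences of triples in a
  form that can be used element by element.\<close>

abbreviation HG :: "'a topology \<Rightarrow> int \<Rightarrow> 'a set \<Rightarrow> 'a set \<Rightarrow> 'a chain set monoid" where
  "HG W p A B \<equiv> relative_homology_group p (subtopology W A) B"

definition incl :: "'a topology \<Rightarrow> int \<Rightarrow> 'a set \<Rightarrow> 'a set \<Rightarrow> 'a set \<Rightarrow> 'a set \<Rightarrow> 'a chain set \<Rightarrow> 'a chain set" where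
  "incl W p A B A' B' = hom_induced p (subtopology W A) B (subtopology W A') B' id"

definition relbd :: "'a topology \<Rightarrow> int \<Rightarrow> 'a set \<Rightarrow> 'a set \<Rightarrow> 'a set \<Rightarrow> 'a chain set \<Rightarrow> 'a chain set" where
  "relbd W p A B C = hom_relboundary p (subtopology W A) B C"

lemma comm_HG: "comm_group (HG W p A B)" by simp
lemma grp_HG: "group (HG W p A B)" by simp

lemma incl_hom: "incl W p A B A' B' \<in> hom (HG W p A B) (HG W p A' B')"
  by (simp add: incl_def hom_induced_hom)

lemma incl_carrier: "incl W p A B A' B' x \<in> carrier (HG W p A' B')"
  by (simp add: incl_def hom_induced_carrier)

lemma continuous_map_id_mono: "A \<subseteq> A' \<Longrightarrow> continuous_map (subtopology W A) (subtopology W A') id"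
  unfolding continuous_map_in_subtopology by (auto simp: continuous_map_from_subtopology)

lemma incl_incl:
  assumes "A \<subseteq> A'" "A' \<subseteq> A''" "B \<subseteq> B'" "B' \<subseteq> B''"
  shows "incl W p A' B' A'' B'' (incl W p A B A' B' x) = incl W p A B A'' B'' x"
proof -
  have "hom_induced p (subtopology W A) B (subtopology W A'') B'' (id \<circ> id)
     = hom_induced p (subtopology W A') B' (subtopology W A'') B'' id \<circ> hom_induced p (subtopology W A) B (subtopology W A') B' id"
    by (rule hom_induced_compose) (use assms continuous_map_id_mono in auto)
  then show ?thesis by (simp add: incl_def fun_eq_iff)
qed

lemma subtopology_sub: "B \<subseteq> A \<Longrightarrow> subtopology (subtopology W A) B = subtopology W B"
  by (simp add: subtopology_subtopology Int_absorb1)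

lemma relbd_hom: "B \<subseteq> A \<Longrightarrow> relbd W p A B C \<in> hom (HG W p A B) (HG W (p - 1) B C)"
  using group_homomorphism_hom_relboundary[of p "subtopology W A" B C] by (simp add: relbd_def subtopology_sub)

lemma relbd_carrier: "B \<subseteq> A \<Longrightarrow> relbd W p A B C x \<in> carrier (HG W (p - 1) B C)"
  using hom_relboundary[of p "subtopology W A" B C x] by (simp add: relbd_def subtopology_sub)

lemma relbd_natural:
  assumes "A \<subseteq> A'" "B \<subseteq> B'" "C \<subseteq> C'" "B \<subseteq> A" "B' \<subseteq> A'"
  shows "relbd W p A' B' C' (incl W p A B A' B' x) = incl W (p - 1) B C B' C' (relbd W p A B C x)"
proof -
  have "hom_relboundary p (subtopology W A') B' C' \<circ> hom_induced p (subtopology W A) B (subtopology W A') B' id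
    = hom_induced (p - 1) (subtopology (subtopology W A) B) C (subtopology (subtopology W A') B') C' id \<circ> hom_relboundary p (subtopology W A) B C"
    by (rule naturality_hom_induced_relboundary) (use assms continuous_map_id_mono in auto)
  then show ?thesis using assms by (simp add: incl_def relbd_def subtopology_sub fun_eq_iff)
qed

lemma kernel_eq_imageD:
  assumes "kernel G H h = f ` A"
  shows "x \<in> carrier G \<Longrightarrow> h x = \<one>\<^bsub>H\<^esub> \<Longrightarrow> \<exists>y\<in>A. f y = x" "y \<in> A \<Longrightarrow> h (f y) = \<one>\<^bsub>H\<^esub>"
proof -
  show "\<exists>y\<in>A. f y = x" if "x \<in> carrier G" "h x = \<one>\<^bsub>H\<^esub>"
  proof -
    have "x \<in> kernel G H h" using that by (simp add: kernel_def)
    then show ?thesis unfolding assms by blast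
  qed
  show "h (f y) = \<one>\<^bsub>H\<^esub>" if "y \<in> A"
  proof -
    have "f y \<in> kernel G H h" unfolding assms using that by blast
    then show ?thesis by (simp add: kernel_def)
  qed
qed

lemma trivial_HG_I: "(\<And>x. x \<in> carrier (HG W p A B) \<Longrightarrow> x = \<one>\<^bsub>HG W p A B\<^esub>) \<Longrightarrow> trivial_group (HG W p A B)"
  by (subst group.trivial_group_subset[OF grp_HG]) blast

lemma trivial_group_D: "trivial_group G \<Longrightarrow> x \<in> carrier G \<Longrightarrow> x = \<one>\<^bsub>G\<^esub>"
  by (simp add: trivial_group_def)

lemma incl_one: "incl W p A B A' B' \<one>\<^bsub>HG W p A B\<^esub> = \<one>\<^bsub>HG W p A' B'\<^esub>"
  by (rule hom_one[OF incl_hom grp_HG grp_HG])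

lemma relbd_one: "B \<subseteq> A \<Longrightarrow> relbd W p A B C \<one>\<^bsub>HG W p A B\<^esub> = \<one>\<^bsub>HG W (p - 1) B C\<^esub>"
  by (rule hom_one[OF relbd_hom grp_HG grp_HG])

text \<open>Exactness of the sequence of a triple at its three groups, element by element.\<close>

lemma triple_exact1:
  assumes "C \<subseteq> B" "B \<subseteq> A"
  shows "\<lbrakk>x \<in> carrier (HG W p A B); relbd W p A B C x = \<one>\<^bsub>HG W (p - 1) B C\<^esub>\<rbrakk> \<Longrightarrow> \<exists>y\<in>carrier (HG W p A C). incl W p A C A B y = x"
    "y \<in> carrier (HG W p A C) \<Longrightarrow> relbd W p A B C (incl W p A C A B y) = \<one>\<^bsub>HG W (p - 1) B C\<^esub>"
proof -
  have k: "kernel (HG W p A B) (HG W (p - 1) B C) (relbd W p A B C) = incl W p A C A B ` carrier (HG W p A C)"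
    using homology_exactness_triple_1[OF assms(1), of p "subtopology W A"] assms by (simp add: incl_def relbd_def subtopology_sub)
  show "\<lbrakk>x \<in> carrier (HG W p A B); relbd W p A B C x = \<one>\<^bsub>HG W (p - 1) B C\<^esub>\<rbrakk> \<Longrightarrow> \<exists>y\<in>carrier (HG W p A C). incl W p A C A B y = x"
    by (rule kernel_eq_imageD(1)[OF k])
  show "y \<in> carrier (HG W p A C) \<Longrightarrow> relbd W p A B C (incl W p A C A B y) = \<one>\<^bsub>HG W (p - 1) B C\<^esub>"
    by (rule kernel_eq_imageD(2)[OF k])
qed

lemma triple_exact2:
  assumes "C \<subseteq> B" "B \<subseteq> A" "x \<in> carrier (HG W (p - 1) B C)" "incl W (p - 1) B C A C x = \<one>\<^bsub>HG W (p - 1) A C\<^esub>"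
  shows "\<exists>w\<in>carrier (HG W p A B). relbd W p A B C w = x"
proof -
  have "kernel (HG W (p - 1) B C) (HG W (p - 1) A C) (incl W (p - 1) B C A C) = relbd W p A B C ` carrier (HG W p A B)"
    using homology_exactness_triple_2[OF assms(1), of p "subtopology W A"] assms by (simp add: incl_def relbd_def subtopology_sub)
  from kernel_eq_imageD(1)[OF this assms(3,4)] show ?thesis .
qed

lemma triple_exact3:
  assumes "C \<subseteq> B" "B \<subseteq> A" "x \<in> carrier (HG W p A C)" "incl W p A C A B x = \<one>\<^bsub>HG W p A B\<^esub>"
  shows "\<exists>y\<in>carrier (HG W p B C). incl W p B C A C y = x"
proof -
  have "kernel (HG W p A C) (HG W p A B) (incl W p A C A B) = incl W p B C A C ` carrier (HG W p B C)"
    using homology_exactness_triple_3[OF assms(1), of p "subtopology W A"] assms by (simp add: incl_def subtopology_sub)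
  from kernel_eq_imageD(1)[OF this assms(3,4)] show ?thesis .
qed

lemma triple_trivial_mid:
  assumes "C \<subseteq> B" "B \<subseteq> A" "trivial_group (HG W p B C)" "trivial_group (HG W p A B)"
  shows "trivial_group (HG W p A C)"
proof (rule trivial_HG_I)
  fix x assume x: "x \<in> carrier (HG W p A C)"
  have "incl W p A C A B x = \<one>\<^bsub>HG W p A B\<^esub>"
    by (rule trivial_group_D[OF assms(4) incl_carrier])
  from triple_exact3[OF assms(1,2) x this] obtain y where y: "y \<in> carrier (HG W p B C)" "incl W p B C A C y = x" by blast
  then show "x = \<one>\<^bsub>HG W p A C\<^esub>" using trivial_group_D[OF assms(3) y(1)] incl_one by metis
qed

lemma triple_trivial_left:
  assumes "C \<subseteq> B" "B \<subseteq> A" "trivial_group (HG W (p - 1) A C)" "trivial_group (HG W p A B)"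
  shows "trivial_group (HG W (p - 1) B C)"
proof (rule trivial_HG_I)
  fix x assume x: "x \<in> carrier (HG W (p - 1) B C)"
  have "incl W (p - 1) B C A C x = \<one>\<^bsub>HG W (p - 1) A C\<^esub>"
    by (rule trivial_group_D[OF assms(3) incl_carrier])
  from triple_exact2[OF assms(1,2) x this] obtain y where y: "y \<in> carrier (HG W p A B)" "relbd W p A B C y = x" by blast
  then show "x = \<one>\<^bsub>HG W (p - 1) B C\<^esub>" using trivial_group_D[OF assms(4) y(1)] relbd_one[OF assms(2)] by metis
qed

lemma triple_trivial_right:
  assumes "C \<subseteq> B" "B \<subseteq> A" "trivial_group (HG W p A C)" "trivial_group (HG W (p - 1) B C)"
  shows "trivial_group (HG W p A B)"
proof (rule trivial_HG_I)
  fix x assume x: "x \<in> carrier (HG W p A B)"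
  have "relbd W p A B C x = \<one>\<^bsub>HG W (p - 1) B C\<^esub>"
    by (rule trivial_group_D[OF assms(4) relbd_carrier[OF assms(2)]])
  from triple_exact1(1)[OF assms(1,2) x this] obtain y where y: "y \<in> carrier (HG W p A C)" "incl W p A C A B y = x" by blast
  then show "x = \<one>\<^bsub>HG W p A B\<^esub>" using trivial_group_D[OF assms(3) y(1)] incl_one by metis
qed

text \<open>The first boundary factors through the homology of \<open>B\<close> relative to \<open>D\<close>, and the composite of two
  consecutive maps in the sequence of the triple \<open>(B, C, D)\<close> is zero.\<close>

lemma relbd_relbd:
  assumes "D \<subseteq> C" "C \<subseteq> B" "B \<subseteq> A"
  shows "relbd W (p - 1) B C D (relbd W p A B C x) = \<one>\<^bsub>HG W (p - 1 - 1) C D\<^esub>"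
proof -
  have "relbd W p A B C x = incl W (p - 1) B D B C (relbd W p A B D x)"
  proof -
    have "hom_induced (p-1) (subtopology W B) {} (subtopology W B) C (id \<circ> id)
       = hom_induced (p-1) (subtopology W B) D (subtopology W B) C id \<circ> hom_induced (p-1) (subtopology W B) {} (subtopology W B) D id"
      by (rule hom_induced_compose) (use assms in auto)
    then show ?thesis using assms by (simp add: relbd_def hom_relboundary_def incl_def subtopology_sub fun_eq_iff)
  qed
  then show ?thesis using triple_exact1(2)[OF assms(1,2)] relbd_carrier[OF assms(3)] by metis
qed

section \<open>Homology of finite subcomplexes\<close>

context regular_cw
begin

abbreviation "H \<equiv> HG W"
abbreviation "inc \<equiv> incl W"
abbreviation "bdy \<equiv> relbd W"

lemma proper_face_in_boundary:
  assumes "s \<in> cells" "t \<in> cells" "t \<subset> s" shows "open_cell K t \<subseteq> bnd s" "dm t < dm s"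
proof -
  have *: "x \<in> bnd s \<and> dm t < dm s" if x: "x \<in> open_cell K t" for x
    using in_closed_cell_open[OF assms(1,2) _ x] open_cell_subset[OF assms(2)] assms(3) x by blast
  then show "open_cell K t \<subseteq> bnd s" by blast
  show "dm t < dm s" using * open_cell_nonempty[of t] by blast
qed

lemma finite_faces: assumes "s \<in> cells" shows "finite {t \<in> cells. t \<subseteq> s}"
proof -
  obtain T where T: "T \<subseteq> cells" "finite T" "bnd s \<subseteq> (\<Union>t\<in>T. open_cell K t)"
    using boundary_finite_cover[OF assms] by blast
  have "t \<in> insert s T" if t: "t \<in> cells" "t \<subseteq> s" for t
  proof (cases "t = s")
    case False
    then have "open_cell K t \<subseteq> bnd s" using proper_face_in_boundary assms t by blast
    moreover obtain x where x: "x \<in> open_cell K t" using open_cell_nonempty by blast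
    ultimately obtain e where "e \<in> T" "x \<in> open_cell K e" using T(3) by blast
    then have "t = e" using open_cells_disjoint[OF t(1) _ x] T(1) by auto
    then show ?thesis using \<open>e \<in> T\<close> by simp
  qed simp
  then have "{t \<in> cells. t \<subseteq> s} \<subseteq> insert s T" by blast
  then show ?thesis by (rule finite_subset) (use T(2) in simp)
qed

lemma in_some_open_cell: "x \<in> topspace W \<Longrightarrow> \<exists>t\<in>cells. x \<in> open_cell K t"
  using open_cells_cover by blast

lemma boundary_face:
  assumes "s \<in> cells" "x \<in> bnd s"
  shows "\<exists>t\<in>cells. t \<subset> s \<and> x \<in> open_cell K t"
proof -
  have xs: "x \<in> s" using assms cell_boundary_subset by blast
  then obtain t where t: "t \<in> cells" "x \<in> open_cell K t" using in_some_open_cell cell_subset[OF assms(1)] by blast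
  have "t \<subseteq> s" by (rule cell_face_subset[OF assms(1) t(1) xs t(2)])
  moreover have "t \<noteq> s" using t(2) assms cell_split_disjoint by blast
  ultimately show ?thesis using t by blast
qed

text \<open>The finite subcomplexes. Both inductions below remove a cell of maximal dimension among
  those that have to be removed.\<close>

definition lower :: "'x set set \<Rightarrow> bool" where
  "lower S \<longleftrightarrow> S \<subseteq> cells \<and> finite S \<and> (\<forall>s\<in>S. \<forall>t\<in>cells. t \<subseteq> s \<longrightarrow> t \<in> S)"

lemma lower_faces: "s \<in> cells \<Longrightarrow> lower {t \<in> cells. t \<subseteq> s}"
  unfolding lower_def using finite_faces by auto

lemma lower_closed: "lower S \<Longrightarrow> closedin W (\<Union>S)"
  unfolding lower_def using cell_closed by (auto intro!: closedin_Union)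

lemma lower_sub: "lower S \<Longrightarrow> \<Union>S \<subseteq> topspace W"
  using lower_closed closedin_subset by blast

lemma lower_dim: "lower S \<Longrightarrow> lower {s \<in> S. zdim s \<le> k}"
proof -
  assume S: "lower S"
  have "t \<in> {s \<in> S. zdim s \<le> k}" if st: "s \<in> {s \<in> S. zdim s \<le> k}" "t \<in> cells" "t \<subseteq> s" for s t
  proof -
    have "s \<in> cells" using S st unfolding lower_def by auto
    then have "dm t \<le> dm s" using proper_face_in_boundary(2)[of s t] st by (cases "t = s") (auto simp: psubset_eq)
    moreover have "t \<in> S" using S st unfolding lower_def by auto
    ultimately show ?thesis using st(1) by auto
  qed
  then have "\<forall>s\<in>{s \<in> S. zdim s \<le> k}. \<forall>t\<in>cells. t \<subseteq> s \<longrightarrow> t \<in> {s \<in> S. zdim s \<le> k}" by blast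
  moreover have "{s \<in> S. zdim s \<le> k} \<subseteq> cells" "finite {s \<in> S. zdim s \<le> k}"
    using S unfolding lower_def by auto
  ultimately show ?thesis unfolding lower_def by blast
qed

lemma lower_inter_cell:
  assumes S: "lower S" and s: "s \<in> cells" "s \<notin> S" and faces: "\<And>t. t \<in> cells \<Longrightarrow> t \<subset> s \<Longrightarrow> t \<in> S"
  shows "\<Union>S \<inter> s = bnd s"
proof (intro equalityI subsetI)
  fix x assume "x \<in> \<Union>S \<inter> s"
  then obtain r where r: "r \<in> S" "x \<in> r" "x \<in> s" by auto
  show "x \<in> bnd s"
  proof (rule ccontr)
    assume "x \<notin> bnd s"
    then have "x \<in> open_cell K s" using r cell_split s by blast
    then have "s \<subseteq> r" using cell_face_subset[of r s x] r S s unfolding lower_def by blast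
    then show False using S r s unfolding lower_def by blast
  qed
next
  fix x assume x: "x \<in> bnd s"
  obtain t where t: "t \<in> cells" "t \<subset> s" "x \<in> open_cell K t" using boundary_face[OF s(1) x] by blast
  then show "x \<in> \<Union>S \<inter> s" using faces[OF t(1,2)] open_cell_subset[OF t(1)] by blast
qed

lemma attach_iso:
  assumes s: "s \<in> cells" and A: "closedin W A" "A \<inter> s = bnd s"
  shows "inc j s (bnd s) (A \<union> s) A \<in> iso (H j s (bnd s)) (H j (A \<union> s) A)"
  using attach_cell_iso[OF Hausdorff char_homeo[OF s] cell_subset[OF s] cell_closed[OF s] A(1)] A(2) cell_boundary_closed[OF s]
  unfolding incl_def cell_boundary_def by blast

lemma cell_homology:
  assumes s: "s \<in> cells"
  shows "H (zdim s) s (bnd s) \<cong> integer_group"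
    "j \<noteq> zdim s \<Longrightarrow> trivial_group (H j s (bnd s))"
proof -
  let ?D = "disc_space (dm s)"
  have i: "relative_homology_group j ?D (disc_boundary (dm s)) \<cong> H j s (bnd s)" for j
  proof (rule is_isoI)
    show "hom_induced j ?D (disc_boundary (dm s)) (subtopology W s) (bnd s) (cw_char K s)
      \<in> iso (relative_homology_group j ?D (disc_boundary (dm s))) (H j s (bnd s))"
      by (rule homeomorphic_map_relative_homology_iso[OF char_homeo[OF s]])
        (use disc_boundary_subset topspace_disc in \<open>auto simp: cell_boundary_def\<close>)
  qed
  show "H (zdim s) s (bnd s) \<cong> integer_group"
    using group.iso_sym[OF _ i[of "zdim s"]] relative_homology_disc(1)[of "dm s"] iso_trans by fastforce
  show "trivial_group (H j s (bnd s))" if "j \<noteq> zdim s"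
    using isomorphic_group_triviality[OF i[of j]] relative_homology_disc(2)[OF that] by simp
qed

text \<open>A cell of maximal dimension outside \<open>S\<close> is not a proper face of any cell of \<open>S'\<close>: by maximality
  that cell would lie in \<open>S\<close>, which contains all faces of its cells.\<close>

lemma lower_remove_top:
  assumes S: "lower S" and S': "lower S'" and sub: "S \<subset> S'"
  obtains s where "s \<in> S'" "s \<notin> S" "lower (S' - {s})" "S \<subseteq> S' - {s}"
    "\<Union>S' = \<Union>(S' - {s}) \<union> s" "\<Union>(S' - {s}) \<inter> s = bnd s"
proof -
  have fin: "finite (S' - S)" "S' - S \<noteq> {}" using S' sub unfolding lower_def by auto
  then have "Max (dm ` (S' - S)) \<in> dm ` (S' - S)" by (intro Max_in) auto
  then obtain s where s: "s \<in> S' - S" "dm s = Max (dm ` (S' - S))" by (metis imageE)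
  have mx: "dm t \<le> dm s" if "t \<in> S' - S" for t using s(2) fin that by simp
  have sc: "s \<in> cells" using s S' unfolding lower_def by blast
  have l: "lower (S' - {s})"
    unfolding lower_def
  proof (intro conjI ballI impI)
    fix r t assume rt: "r \<in> S' - {s}" "t \<in> cells" "t \<subseteq> r"
    have rc: "r \<in> cells" using rt S' unfolding lower_def by blast
    have "t \<noteq> s"
    proof
      assume ts: "t = s"
      then have "s \<subset> r" using rt by auto
      then have "dm s < dm r" using proper_face_in_boundary(2)[OF rc sc] by blast
      then have "r \<in> S" using mx[of r] rt by auto
      then show False using S s ts rt unfolding lower_def by blast
    qed
    then show "t \<in> S' - {s}" using rt S' unfolding lower_def by blast
  qed (use S' in \<open>auto simp: lower_def\<close>)
  show thesis
  proof (rule that[of s])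
    show "\<Union>(S' - {s}) \<inter> s = bnd s"
      by (rule lower_inter_cell[OF l sc]) (use S' s in \<open>auto simp: lower_def\<close>)
  qed (use s l sub in auto)
qed

lemma trivial_HG_same: "A \<subseteq> topspace W \<Longrightarrow> trivial_group (H j A A)"
  using trivial_relative_homology_group_topspace[of j "subtopology W A"] by (simp add: topspace_subtopology_subset Int_absorb1)

text \<open>Each cell adds homology in its own dimension only.\<close>

lemma lower_homology_trivial:
  assumes "lower S" "lower S'" "S \<subseteq> S'" "\<And>s. s \<in> S' - S \<Longrightarrow> zdim s \<noteq> j"
  shows "trivial_group (H j (\<Union>S') (\<Union>S))"
  using assms(2-4)
proof (induction "card S'" arbitrary: S' rule: less_induct)
  case less
  show ?case
  proof (cases "S = S'")
    case True
    then show ?thesis using trivial_HG_same lower_sub less.prems by simp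
  next
    case False
    then obtain s where s: "s \<in> S'" "s \<notin> S" "lower (S' - {s})" "S \<subseteq> S' - {s}"
      "\<Union>S' = \<Union>(S' - {s}) \<union> s" "\<Union>(S' - {s}) \<inter> s = bnd s"
      using lower_remove_top[OF assms(1) less.prems(1)] less.prems(2) by blast
    have sc: "s \<in> cells" using s less.prems(1) unfolding lower_def by blast
    have "finite S'" using less.prems(1) unfolding lower_def by blast
    then have "card (S' - {s}) < card S'" using s(1) by (rule card_Diff1_less)
    then have 1: "trivial_group (H j (\<Union>(S' - {s})) (\<Union>S))"
      using less.hyps[of "S' - {s}"] s less.prems by blast
    have "trivial_group (H j s (bnd s))"
      by (rule cell_homology(2)[OF sc]) (use less.prems(3)[of s] s in auto)
    moreover have "H j s (bnd s) \<cong> H j (\<Union>S') (\<Union>(S' - {s}))"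
      using attach_iso[OF sc lower_closed[OF s(3)] s(6)] unfolding s(5)[symmetric] by (rule is_isoI)
    ultimately have 2: "trivial_group (H j (\<Union>S') (\<Union>(S' - {s})))"
      using isomorphic_group_triviality by (metis grp_HG)
    show ?thesis
      by (rule triple_trivial_mid[OF _ _ 1 2]) (use s in blast)+
  qed
qed

end

locale oriented_cw = regular_cw K for K :: "'x cell_complex" +
  fixes \<omega> :: "'x set \<Rightarrow> 'x chain set"
  assumes orient: "orientation K \<omega>"
begin

lemma omega_generates:
  assumes "s \<in> cells"
  shows "\<omega> s \<in> carrier (H (zdim s) s (bnd s))"
    "generate (H (zdim s) s (bnd s)) {\<omega> s} = carrier (H (zdim s) s (bnd s))"
  using orient assms unfolding orientation_def Let_def by auto

text \<open>The image of the oriented cell \<open>s\<close> in the homology of the pair \<open>(A, B)\<close>.\<close>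

definition gen :: "int \<Rightarrow> 'x set \<Rightarrow> 'x set \<Rightarrow> 'x set \<Rightarrow> 'x chain set" where
  "gen p A B s = inc p s (bnd s) A B (\<omega> s)"

lemma gen_carrier: "gen p A B s \<in> carrier (H p A B)"
  by (simp add: gen_def incl_carrier)

lemma incl_gen:
  assumes "s \<subseteq> A" "A \<subseteq> A'" "bnd s \<subseteq> B" "B \<subseteq> B'"
  shows "inc p A B A' B' (gen p A B s) = gen p A' B' s"
  unfolding gen_def by (rule incl_incl[OF assms])

abbreviation comb :: "int \<Rightarrow> 'x set \<Rightarrow> 'x set \<Rightarrow> ('x set \<Rightarrow> int) \<Rightarrow> 'x set set \<Rightarrow> 'x chain set" where
  "comb p A B \<equiv> lincomb (H p A B) (gen p A B)"

lemma incl_comb: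
  assumes "finite T" "\<And>t. t \<in> T \<Longrightarrow> t \<subseteq> A \<and> bnd t \<subseteq> B" "A \<subseteq> A'" "B \<subseteq> B'"
  shows "inc p A B A' B' (comb p A B a T) = comb p A' B' a T"
proof -
  have "inc p A B A' B' (comb p A B a T) = lincomb (H p A' B') (\<lambda>t. inc p A B A' B' (gen p A B t)) a T"
    by (rule hom_lincomb[OF comm_HG comm_HG incl_hom assms(1)]) (rule funcsetI, rule gen_carrier)
  also have "\<dots> = comb p A' B' a T"
  proof (rule comm_group.lincomb_cong[OF comm_HG])
    show "inc p A B A' B' (gen p A B t) = gen p A' B' t" if "t \<in> T" for t
      by (rule incl_gen) (use assms that in auto)
  qed (auto intro: gen_carrier)
  finally show ?thesis .
qed

lemma cell_homology_pow:
  assumes s: "s \<in> cells" and x: "x \<in> carrier (H (zdim s) s (bnd s))"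
  shows "\<exists>k::int. x = \<omega> s [^]\<^bsub>H (zdim s) s (bnd s)\<^esub> k"
proof -
  interpret group "H (zdim s) s (bnd s)" by simp
  show ?thesis using x unfolding omega_generates(2)[OF s, symmetric] generate_pow[OF omega_generates(1)[OF s]] by blast
qed

text \<open>Modulo the subcomplex without the last cell \<open>s\<close>, an element is a multiple of the class of
  \<open>s\<close>. After subtraction of this multiple it comes from the smaller subcomplex. The boundaries
  of all new cells lie in \<open>\<Union>S\<close>, since their proper faces have lower dimension.\<close>

lemma lower_homology_generated:
  assumes "lower S" "lower S'" "S \<subseteq> S'" "\<And>s. s \<in> S' - S \<Longrightarrow> zdim s = j"
    "x \<in> carrier (H j (\<Union>S') (\<Union>S))"
  shows "\<exists>a. x = comb j (\<Union>S') (\<Union>S) a (S' - S)"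
  using assms(2-5)
proof (induction "card S'" arbitrary: S' x rule: less_induct)
  case less
  show ?case
  proof (cases "S = S'")
    case True
    then have "x = \<one>\<^bsub>H j (\<Union>S') (\<Union>S)\<^esub>"
      using trivial_group_D[OF trivial_HG_same[OF lower_sub[OF assms(1)]]] less.prems by auto
    then show ?thesis using comm_group.lincomb_zero[OF comm_HG, of "S' - S" "\<lambda>_. 0"] by metis
  next
    case False
    then obtain s where s: "s \<in> S'" "s \<notin> S" "lower (S' - {s})" "S \<subseteq> S' - {s}"
      "\<Union>S' = \<Union>(S' - {s}) \<union> s" "\<Union>(S' - {s}) \<inter> s = bnd s"
      using lower_remove_top[OF assms(1) less.prems(1)] less.prems(2) by blast
    let ?A = "\<Union>S'" and ?B = "\<Union>(S' - {s})" and ?C = "\<Union>S"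
    have CB: "?C \<subseteq> ?B" and BA: "?B \<subseteq> ?A" using s by blast+
    have sc: "s \<in> cells" using s less.prems(1) unfolding lower_def by blast
    have dj: "j = zdim s" using less.prems(3)[of s] s by auto
    have sb: "bnd s \<subseteq> ?B" using s(6) by blast
    have sbC: "bnd t \<subseteq> ?C" if t: "t \<in> S' - S" for t
    proof
      fix x assume x: "x \<in> bnd t"
      have tc: "t \<in> cells" using t less.prems(1) unfolding lower_def by blast
      obtain r where r: "r \<in> cells" "r \<subset> t" "x \<in> open_cell K r" using boundary_face[OF tc x] by blast
      have "dm r < dm t" by (rule proper_face_in_boundary(2)[OF tc r(1,2)])
      then have "zdim r \<noteq> j" using less.prems(3)[OF t] by auto
      moreover have "r \<in> S'" using r t less.prems(1) unfolding lower_def by blast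
      ultimately have "r \<in> S" using less.prems(3)[of r] by blast
      then show "x \<in> ?C" using r open_cell_subset by blast
    qed
    let ?G = "H j ?A ?C"
    interpret G: comm_group ?G by (rule comm_HG)
    have iso: "inc j s (bnd s) ?A ?B \<in> iso (H j s (bnd s)) (H j ?A ?B)"
      using attach_iso[OF sc lower_closed[OF s(3)] s(6)] unfolding s(5)[symmetric] .
    then have surj: "inc j s (bnd s) ?A ?B ` carrier (H j s (bnd s)) = carrier (H j ?A ?B)"
      unfolding iso_def bij_betw_def by simp
    have "inc j ?A ?C ?A ?B x \<in> inc j s (bnd s) ?A ?B ` carrier (H j s (bnd s))"
      unfolding surj by (rule incl_carrier)
    then obtain y where y: "y \<in> carrier (H j s (bnd s))"
      "inc j s (bnd s) ?A ?B y = inc j ?A ?C ?A ?B x"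
      by (elim imageE) (rule that, assumption, rule sym, assumption)
    obtain k :: int where k: "y = \<omega> s [^]\<^bsub>H j s (bnd s)\<^esub> k"
      using cell_homology_pow[OF sc] y(1) unfolding dj by blast
    have gs: "gen j ?A ?C s \<in> carrier ?G" by (rule gen_carrier)
    have "inc j ?A ?C ?A ?B (gen j ?A ?C s [^]\<^bsub>?G\<^esub> k) = gen j ?A ?B s [^]\<^bsub>H j ?A ?B\<^esub> k"
    proof -
      have "inc j ?A ?C ?A ?B (gen j ?A ?C s) = gen j ?A ?B s"
        by (rule incl_gen) (use s(1,2) sbC[of s] CB in auto)
      then show ?thesis using hom_int_pow[OF incl_hom gs grp_HG grp_HG, of ?A ?B k] by simp
    qed
    also have "\<dots> = inc j s (bnd s) ?A ?B y"
      unfolding k gen_def by (rule hom_int_pow[OF incl_hom _ grp_HG grp_HG, symmetric]) (use omega_generates(1)[OF sc] dj in simp)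
    finally have e1: "inc j ?A ?C ?A ?B (gen j ?A ?C s [^]\<^bsub>?G\<^esub> k) = inc j ?A ?C ?A ?B x" using y(2) by simp
    define z where "z = x \<otimes>\<^bsub>?G\<^esub> inv\<^bsub>?G\<^esub> (gen j ?A ?C s [^]\<^bsub>?G\<^esub> k)"
    have zc: "z \<in> carrier ?G" using less.prems(4) gs by (simp add: z_def)
    interpret h: group_hom ?G "H j ?A ?B" "inc j ?A ?C ?A ?B"
      by (simp add: group_hom_def group_hom_axioms_def incl_hom)
    have "inc j ?A ?C ?A ?B z = \<one>\<^bsub>H j ?A ?B\<^esub>"
      using less.prems(4) gs by (simp add: z_def e1 incl_carrier)
    from triple_exact3[OF CB BA zc this] obtain u where u: "u \<in> carrier (H j ?B ?C)" "inc j ?B ?C ?A ?C u = z" by blast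
    have fin: "finite S'" using less.prems(1) unfolding lower_def by blast
    then have "card (S' - {s}) < card S'" using s(1) by (rule card_Diff1_less)
    then obtain a where a: "u = comb j ?B ?C a (S' - {s} - S)"
      using less.hyps[of "S' - {s}" u] s less.prems u(1) by blast
    have "z = comb j ?A ?C a (S' - {s} - S)"
      unfolding u(2)[symmetric] a by (rule incl_comb) (use fin sbC BA in auto)
    also have "\<dots> = comb j ?A ?C (a(s := k)) (S' - {s} - S)"
      by (rule G.lincomb_cong) (auto intro: gen_carrier)
    finally have z: "z = comb j ?A ?C (a(s := k)) (S' - {s} - S)" .
    have ins: "insert s (S' - {s} - S) = S' - S" using s by auto
    have "x = gen j ?A ?C s [^]\<^bsub>?G\<^esub> k \<otimes>\<^bsub>?G\<^esub> z"
      using less.prems(4) gs by (simp add: z_def G.m_ac(1)[symmetric] G.m_comm[of "gen j ?A ?C s [^]\<^bsub>?G\<^esub> k"] G.m_assoc)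
    also have "\<dots> = comb j ?A ?C (a(s := k)) (insert s (S' - {s} - S))"
      unfolding z by (subst G.lincomb_insert) (use fin gen_carrier in auto)
    finally show ?thesis unfolding ins by blast
  qed
qed

end

section \<open>The augmentation\<close>

text \<open>The sum of the coefficients of a \<open>0\<close>-chain, in the form of a linear extension, which makes it
  obviously additive.\<close>

definition augc :: "'a chain \<Rightarrow> int" where
  "augc c = Poly_Mapping.lookup (frag_extend (\<lambda>_. frag_of ()) c) ()"

lemma augc_sum: "augc c = (\<Sum>s\<in>Poly_Mapping.keys c. Poly_Mapping.lookup c s)"
  by (simp add: augc_def frag_extend_def lookup_sum)

lemma augc_add: "augc (a + b) = augc a + augc b" and augc_diff: "augc (a - b) = augc a - augc b"
  and augc_zero [simp]: "augc 0 = 0" and augc_of [simp]: "augc (frag_of f) = 1"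
  by (simp_all add: augc_def frag_extend_add frag_extend_diff lookup_add lookup_minus)

lemma augc_chain_boundary: "augc (chain_boundary (Suc 0) c) = 0"
proof (rule frag_induction[of c UNIV])
  fix x show "augc (chain_boundary (Suc 0) (frag_of x)) = 0"
    by (simp add: chain_boundary_of augc_add augc_diff)
qed (auto simp: chain_boundary_diff augc_diff)

lemma augc_chain_map: "augc (chain_map p f c) = augc c"
proof (rule frag_induction[of c UNIV])
qed (auto simp: chain_map_diff augc_diff)

lemma augc_homologous:
  assumes "C \<in> carrier (homology_group 0 V)" "z \<in> C" "z' \<in> C"
  shows "augc z = augc z'"
proof -
  obtain a where C: "C = homologous_rel_set 0 V {} a"
    using assms(1) by (auto simp: carrier_relative_homology_group_0)
  have "augc a = augc y" if "y \<in> C" for y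
  proof -
    have "singular_relboundary 0 V {} (a - y)" using that C by (simp add: homologous_rel_def)
    then obtain d where "chain_boundary (Suc 0) d = a - y" by (auto simp: singular_boundary)
    then have "augc (a - y) = 0" using augc_chain_boundary by metis
    then show ?thesis by (simp add: augc_diff)
  qed
  then show ?thesis using assms by metis
qed

definition aug :: "'a chain set \<Rightarrow> int" where "aug C = augc (SOME z. z \<in> C)"

lemma aug_eq: "C \<in> carrier (homology_group 0 V) \<Longrightarrow> z \<in> C \<Longrightarrow> aug C = augc z"
  unfolding aug_def by (rule augc_homologous) (auto intro: someI)

lemma aug_class: "singular_relcycle 0 V {} z \<Longrightarrow> aug (homologous_rel_set 0 V {} z) = augc z"
  by (rule aug_eq[of _ V]) (auto simp: carrier_relative_homology_group_0)

lemma class_obtain: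
  assumes "C \<in> carrier (homology_group 0 V)"
  obtains z where "singular_relcycle 0 V {} z" "C = homologous_rel_set 0 V {} z" "z \<in> C"
  using assms by (auto simp: carrier_relative_homology_group_0)

lemma aug_hom: "aug \<in> hom (homology_group 0 V) integer_group"
proof (rule homI)
  fix C D assume CD: "C \<in> carrier (homology_group 0 V)" "D \<in> carrier (homology_group 0 V)"
  interpret comm_group "homology_group 0 V" by simp
  obtain z where z: "z \<in> C" using CD(1) class_obtain by metis
  obtain w where w: "w \<in> D" using CD(2) class_obtain by metis
  have "z + w \<in> C \<otimes>\<^bsub>homology_group 0 V\<^esub> D"
    using mult_relative_homology_group[of 0 V "{}"] z w by auto
  then have "aug (C \<otimes>\<^bsub>homology_group 0 V\<^esub> D) = augc (z + w)"
    using aug_eq[OF m_closed[OF CD]] by blast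
  then show "aug (C \<otimes>\<^bsub>homology_group 0 V\<^esub> D) = aug C \<otimes>\<^bsub>integer_group\<^esub> aug D"
    using aug_eq[OF CD(1) z] aug_eq[OF CD(2) w] by (simp add: augc_add)
qed simp

lemma aug_lincomb:
  assumes "finite A" "g \<in> A \<rightarrow> carrier (homology_group 0 V)"
  shows "aug (lincomb (homology_group 0 V) g a A) = (\<Sum>s\<in>A. a s * aug (g s))"
proof -
  have "aug (lincomb (homology_group 0 V) g a A) = lincomb integer_group (\<lambda>s. aug (g s)) a A"
    by (rule hom_lincomb[OF _ abelian_integer_group aug_hom assms]) simp
  also have "\<dots> = (\<Sum>s\<in>A. a s * aug (g s))"
    using assms(1)
  proof (induction A rule: finite_induct)
    case empty
    then show ?case by (simp add: lincomb_def comm_monoid.finprod_empty[OF comm_group.axioms(1)[OF abelian_integer_group]])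
  next
    case (insert s A)
    then show ?case by (subst comm_group.lincomb_insert[OF abelian_integer_group]) auto
  qed
  finally show ?thesis .
qed

lemma aug_incl:
  assumes "A \<subseteq> B" "C \<in> carrier (HG W 0 A {})"
  shows "aug (incl W 0 A {} B {} C) = aug C"
proof -
  obtain z where z: "singular_relcycle 0 (subtopology W A) {} z" "C = homologous_rel_set 0 (subtopology W A) {} z" "z \<in> C"
    using class_obtain[OF assms(2)] .
  have "incl W 0 A {} B {} C = homologous_rel_set 0 (subtopology W B) {} (chain_map 0 id z)"
    unfolding incl_def z(2) using hom_induced_chain_map[OF continuous_map_id_mono[OF assms(1)] _ z(1), of "{}"] by simp
  then have "chain_map 0 id z \<in> incl W 0 A {} B {} C" by simp
  then have "aug (incl W 0 A {} B {} C) = augc (chain_map 0 id z)"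
    by (rule aug_eq[OF incl_carrier])
  then show ?thesis using aug_eq[OF assms(2) z(3)] by (simp add: augc_chain_map)
qed

lemma aug_relbd:
  assumes "B \<subseteq> A" "w \<in> carrier (HG W 1 A B)"
  shows "aug (relbd W 1 A B {} w) = 0"
proof -
  have "w \<in> carrier (relative_homology_group (int 1) (subtopology W A) B)" using assms by simp
  then obtain c where c: "singular_relcycle 1 (subtopology W A) B c" "w = homologous_rel_set 1 (subtopology W A) B c"
    unfolding carrier_relative_homology_group by blast
  have "relbd W 1 A B {} w = homologous_rel_set 0 (subtopology (subtopology W A) B) {} (chain_boundary 1 c)"
    unfolding relbd_def hom_relboundary_empty c(2) using hom_boundary_chain_boundary[OF c(1)] by simp
  then have "chain_boundary (Suc 0) c \<in> relbd W 1 A B {} w" by simp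
  moreover have "relbd W 1 A B {} w \<in> carrier (HG W 0 B {})" using relbd_carrier[OF assms(1), of W 1 "{}" w] by simp
  ultimately show ?thesis using aug_eq augc_chain_boundary by metis
qed

text \<open>In a path-connected space the zeroth homology is infinite cyclic, generated by the class of a
  point, which has augmentation \<open>1\<close>.\<close>

lemma aug_path_connected:
  assumes "path_connected_space V" "a \<in> topspace V" "x \<in> carrier (homology_group 0 V)"
  shows "aug x = 0 \<Longrightarrow> x = \<one>\<^bsub>homology_group 0 V\<^esub>"
    and "generate (homology_group 0 V) {x} = carrier (homology_group 0 V) \<Longrightarrow> aug x * aug x = 1"
proof -
  let ?H = "homology_group 0 V"
  interpret group ?H by simp
  define f where "f = restrict (\<lambda>_. a) (standard_simplex 0)"
  have f: "singular_simplex 0 V f"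
    unfolding singular_simplex_def f_def using assms(2) by (auto intro: continuous_map_eq[OF continuous_map_const[THEN iffD2]])
  let ?q = "homologous_rel_set 0 V {} (frag_of f)"
  have rc: "singular_relcycle 0 V {} (frag_of f)"
    by (simp add: chain_boundary_def f singular_chain_of singular_cycle)
  have q: "?q \<in> carrier ?H" using rc by (simp add: carrier_relative_homology_group_0)
  have aq: "aug ?q = 1" using aug_class[OF rc] by simp
  have ap: "aug (y [^]\<^bsub>?H\<^esub> (n::int)) = n * aug y" if "y \<in> carrier ?H" for y n
    using hom_int_pow[OF aug_hom that] by simp
  have surj: "\<exists>n::int. y = ?q [^]\<^bsub>?H\<^esub> n" if "y \<in> carrier ?H" for y
  proof -
    have "pow ?H ?q ` (UNIV :: int set) = carrier ?H"
      using iso_integer_zeroth_homology_group[OF assms(1) f] by (simp add: iso_def bij_betw_def)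
    then show ?thesis using that by blast
  qed
  show "x = \<one>\<^bsub>?H\<^esub>" if "aug x = 0"
  proof -
    obtain n :: int where n: "x = ?q [^]\<^bsub>?H\<^esub> n" using surj[OF assms(3)] by blast
    then have "n = 0" using ap[OF q, of n] aq that by simp
    then show ?thesis using n by simp
  qed
  show "aug x * aug x = 1" if "generate ?H {x} = carrier ?H"
  proof -
    have "?q \<in> {x [^]\<^bsub>?H\<^esub> (k::int) | k. k \<in> UNIV}"
      by (rule eqset_imp_iff[THEN iffD1, OF trans[OF that[symmetric] generate_pow[OF assms(3)]] q])
    then obtain k :: int where k: "?q = x [^]\<^bsub>?H\<^esub> k" by (elim CollectE exE conjE) (rule that)
    have "k * aug x = aug (x [^]\<^bsub>?H\<^esub> k)" by (rule ap[OF assms(3), symmetric])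
    also have "\<dots> = 1" unfolding k[symmetric] by (rule aq)
    finally have "aug x dvd 1" by (metis dvd_triv_right)
    then show ?thesis by (auto simp: zdvd1_eq abs_if split: if_splits)
  qed
qed

section \<open>Independence of the cells of one dimension\<close>

context regular_cw begin

lemma dim0_boundary: "dm v = 0 \<Longrightarrow> bnd v = {}"
  by (simp add: cell_boundary_def disc_boundary_0)

lemma cell_contractible: "s \<in> cells \<Longrightarrow> contractible_space (subtopology W s)"
  using contractible_disc homeomorphic_space_contractibility char_homeo homeomorphic_map_imp_homeomorphic_space by metis

lemma cell_acyclic: assumes "s \<in> cells" "p \<noteq> 0" shows "trivial_group (H p s {})"
  using trivial_reduced_homology_group_contractible_space[OF cell_contractible[OF assms(1)], of p]
    un_reduced_homology_group[OF assms(2), of "subtopology W s"] by simp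

lemma cell_path_connected: "s \<in> cells \<Longrightarrow> path_connected_space (subtopology W s)"
  using cell_contractible contractible_imp_path_connected_space by blast

lemma cell_topspace: "s \<in> cells \<Longrightarrow> topspace (subtopology W s) = s"
  by (rule topspace_subtopology_subset[OF cell_subset])

abbreviation "SK \<equiv> skeleton K"

text \<open>The skeleton without the open cell \<open>t\<close>; relative to it, all other cells of the dimension of \<open>t\<close>
  become trivial.\<close>

definition other_cells :: "int \<Rightarrow> 'x set \<Rightarrow> 'x set" where
  "other_cells n t = \<Union>{s \<in> cells. zdim s \<le> n \<and> s \<noteq> t}"

lemma not_in_open_cell_other:
  assumes t: "t \<in> cells" and s: "s \<in> cells" "zdim s \<le> zdim t" "s \<noteq> t"
  shows "open_cell K t \<inter> s = {}"
proof (rule ccontr)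
  assume "open_cell K t \<inter> s \<noteq> {}"
  then obtain x where "x \<in> open_cell K t" "x \<in> s" by blast
  then have "t \<subset> s" using cell_face_subset[OF s(1) t] s(3) by blast
  then show False using proper_face_in_boundary(2)[OF s(1) t] s(2) by simp
qed

lemma other_cells_closed:
  assumes t: "t \<in> cells" shows "closedin W (other_cells (zdim t) t)"
proof (rule weak_topology)
  let ?n = "zdim t"
  show "other_cells ?n t \<subseteq> topspace W" unfolding other_cells_def using cell_subset by blast
  fix s assume s: "s \<in> cells"
  have "other_cells ?n t \<inter> s = \<Union>{r \<in> cells. r \<subseteq> s \<and> zdim r \<le> ?n \<and> r \<noteq> t}"
  proof (intro equalityI subsetI)
    fix x assume "x \<in> other_cells ?n t \<inter> s"
    then obtain u where u: "u \<in> cells" "zdim u \<le> ?n" "u \<noteq> t" "x \<in> u" "x \<in> s" by (auto simp: other_cells_def)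
    then obtain r where r: "r \<in> cells" "x \<in> open_cell K r" using in_some_open_cell cell_subset by blast
    have ru: "r \<subseteq> u" and rs: "r \<subseteq> s" using cell_face_subset u r s by blast+
    have "r \<noteq> t" using not_in_open_cell_other[OF t u(1-3)] r u by blast
    moreover have "dm r \<le> dm u" using proper_face_in_boundary(2)[OF u(1) r(1)] ru by (cases "r = u") (auto simp: psubset_eq)
    ultimately have "r \<in> {r \<in> cells. r \<subseteq> s \<and> zdim r \<le> ?n \<and> r \<noteq> t}" using r u rs by auto
    then show "x \<in> \<Union>{r \<in> cells. r \<subseteq> s \<and> zdim r \<le> ?n \<and> r \<noteq> t}" using r open_cell_subset by blast
  qed (auto simp: other_cells_def)
  moreover have "closedin W (\<Union>{r \<in> cells. r \<subseteq> s \<and> zdim r \<le> ?n \<and> r \<noteq> t})"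
    by (rule closedin_Union) (use finite_faces[OF s] cell_closed in \<open>auto elim: rev_finite_subset\<close>)
  ultimately show "closedin W (other_cells ?n t \<inter> s)" by simp
qed

lemma other_cells_inter:
  assumes t: "t \<in> cells" shows "other_cells (zdim t) t \<inter> t = bnd t"
proof (intro equalityI subsetI)
  fix x assume "x \<in> other_cells (zdim t) t \<inter> t"
  then obtain u where u: "u \<in> cells" "zdim u \<le> zdim t" "u \<noteq> t" "x \<in> u" "x \<in> t" by (auto simp: other_cells_def)
  then have "x \<notin> open_cell K t" using not_in_open_cell_other[OF t u(1-3)] by blast
  then show "x \<in> bnd t" using u cell_split[OF t] by blast
next
  fix x assume x: "x \<in> bnd t"
  obtain r where r: "r \<in> cells" "r \<subset> t" "x \<in> open_cell K r" using boundary_face[OF t x] by blast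
  then have "zdim r \<le> zdim t" "r \<noteq> t" "x \<in> r" using proper_face_in_boundary(2)[OF t r(1,2)] open_cell_subset by auto
  then show "x \<in> other_cells (zdim t) t \<inter> t" using r by (auto simp: other_cells_def)
qed

lemma other_cells_union: "t \<in> cells \<Longrightarrow> other_cells (zdim t) t \<union> t = SK (zdim t)"
  unfolding other_cells_def skeleton_def by auto

lemma skeleton_mono: "a \<le> b \<Longrightarrow> SK a \<subseteq> SK b"
  unfolding skeleton_def by (auto intro: order_trans)

lemma cell_in_skeleton: "s \<in> cells \<Longrightarrow> zdim s \<le> n \<Longrightarrow> s \<subseteq> SK n"
  unfolding skeleton_def by auto

lemma boundary_in_skeleton:
  assumes s: "s \<in> cells" "zdim s \<le> n" shows "bnd s \<subseteq> SK (n - 1)"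
proof
  fix x assume x: "x \<in> bnd s"
  obtain r where r: "r \<in> cells" "r \<subset> s" "x \<in> open_cell K r" using boundary_face[OF s(1) x] by blast
  then have "zdim r \<le> n - 1" using proper_face_in_boundary(2)[OF s(1) r(1,2)] s(2) by auto
  then show "x \<in> SK (n - 1)" using r open_cell_subset by (auto simp: skeleton_def)
qed

lemma skeleton_lower_in_other:
  assumes "t \<in> cells" shows "SK (zdim t - 1) \<subseteq> other_cells (zdim t) t"
  unfolding skeleton_def other_cells_def by auto

lemma exists_orientation: "\<exists>\<omega>. orientation K \<omega>"
proof -
  have "\<exists>w. w \<in> carrier (H (zdim s) s (bnd s)) \<and>
     generate (H (zdim s) s (bnd s)) {w} = carrier (H (zdim s) s (bnd s))" if "s \<in> cells" for s
    using infinite_cyclic_generator[OF grp_HG cell_homology(1)[OF that]] by blast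
  then show ?thesis unfolding orientation_def Let_def by metis
qed

end

context oriented_cw begin

lemma gen_in_cell_trivial:
  assumes "s \<subseteq> B" "B \<subseteq> A" "B \<subseteq> topspace W" "bnd s \<subseteq> B"
  shows "gen p A B s = \<one>\<^bsub>H p A B\<^esub>"
proof -
  have "gen p A B s = inc p B B A B (gen p B B s)"
    by (rule incl_gen[symmetric]) (use assms in auto)
  also have "gen p B B s = \<one>\<^bsub>H p B B\<^esub>"
    by (rule trivial_group_D[OF trivial_HG_same[OF assms(3)] gen_carrier])
  finally show ?thesis by (simp add: incl_one)
qed

text \<open>Pass from the skeleton modulo the lower skeleton to the skeleton modulo all cells other
  than \<open>t\<close>. Only the summand of \<open>t\<close> survives, and by excision the group is the infinite cyclic
  homology of the cell \<open>t\<close> modulo its boundary.\<close>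

lemma skeleton_independent:
  assumes T: "finite T" "T \<subseteq> cells" "\<And>t. t \<in> T \<Longrightarrow> zdim t = n"
    and eq: "comb n (SK n) (SK (n - 1)) a T
           = comb n (SK n) (SK (n - 1)) b T"
    and t: "t \<in> T"
  shows "a t = b t"
proof -
  have tc: "t \<in> cells" and n: "n = zdim t" using T t by auto
  let ?A = "other_cells n t"
  let ?G = "H n (SK n) ?A"
  interpret G: comm_group ?G by (rule comm_HG)
  have sub: "SK (n - 1) \<subseteq> ?A" "?A \<union> t = SK n" "?A \<subseteq> topspace W"
    using skeleton_lower_in_other[OF tc] other_cells_union[OF tc] closedin_subset[OF other_cells_closed[OF tc]] by (simp_all add: n)
  have img: "inc n (SK n) (SK (n - 1)) (SK n) ?A (comb n (SK n) (SK (n - 1)) a T)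
      = gen n (SK n) ?A t [^]\<^bsub>?G\<^esub> a t" for a
  proof -
    have "inc n (SK n) (SK (n - 1)) (SK n) ?A (comb n (SK n) (SK (n - 1)) a T) = comb n (SK n) ?A a T"
    proof (rule incl_comb[OF T(1)])
      show "s \<subseteq> SK n \<and> bnd s \<subseteq> SK (n - 1)" if "s \<in> T" for s
        using cell_in_skeleton[of s n] boundary_in_skeleton[of s n] T that by auto
    qed (use sub in auto)
    also have "\<dots> = gen n (SK n) ?A t [^]\<^bsub>?G\<^esub> a t"
    proof (rule G.lincomb_single[OF T(1) t])
      fix s assume s: "s \<in> T - {t}"
      then have sA: "s \<subseteq> ?A" using T by (auto simp: other_cells_def)
      then show "gen n (SK n) ?A s = \<one>\<^bsub>?G\<^esub>"
      proof (rule gen_in_cell_trivial)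
        show "bnd s \<subseteq> ?A"
          by (rule subset_trans[OF cell_boundary_subset sA]) (use s T(2) in blast)
      qed (use sub in auto)
    qed (rule gen_carrier)
    finally show ?thesis .
  qed
  have iso: "inc n t (bnd t) (SK n) ?A \<in> iso (H n t (bnd t)) ?G"
    using attach_iso[OF tc other_cells_closed[OF tc] other_cells_inter[OF tc], of n] other_cells_union[OF tc] by (simp add: n)
  have om: "\<omega> t \<in> carrier (H n t (bnd t))" using omega_generates(1)[OF tc] by (simp add: n)
  have p: "gen n (SK n) ?A t [^]\<^bsub>?G\<^esub> k = inc n t (bnd t) (SK n) ?A (\<omega> t [^]\<^bsub>H n t (bnd t)\<^esub> k)" for k :: int
    unfolding gen_def by (rule hom_int_pow[OF incl_hom om grp_HG grp_HG, symmetric])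
  have "gen n (SK n) ?A t [^]\<^bsub>?G\<^esub> a t = gen n (SK n) ?A t [^]\<^bsub>?G\<^esub> b t"
    using img[of a] img[of b] eq by simp
  then have "\<omega> t [^]\<^bsub>H n t (bnd t)\<^esub> a t = \<omega> t [^]\<^bsub>H n t (bnd t)\<^esub> b t"
  proof -
    assume eq': "gen n (SK n) ?A t [^]\<^bsub>?G\<^esub> a t = gen n (SK n) ?A t [^]\<^bsub>?G\<^esub> b t"
    have "inj_on (inc n t (bnd t) (SK n) ?A) (carrier (H n t (bnd t)))"
      using iso unfolding iso_def bij_betw_def by simp
    from inj_onD[OF this _ group.int_pow_closed[OF grp_HG om, of "a t"] group.int_pow_closed[OF grp_HG om, of "b t"]]
    show ?thesis using eq' unfolding p by blast
  qed
  then show ?thesis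
    using infinite_cyclic_pow_inj[OF grp_HG cell_homology(1)[OF tc] omega_generates[OF tc]] by (simp add: n)
qed

end

section \<open>Incidence numbers\<close>

context regular_cw begin

definition proper_faces :: "'x set \<Rightarrow> 'x set set" where
  "proper_faces s = {t \<in> cells. t \<subset> s}"

definition facets :: "'x set \<Rightarrow> 'x set set" where
  "facets s = {t \<in> cells. t \<subset> s \<and> dm s = dm t + 1}"

definition dim_upto :: "'x set set \<Rightarrow> int \<Rightarrow> 'x set" where
  "dim_upto S k = \<Union>{s \<in> S. zdim s \<le> k}"

definition of_dim :: "'x set set \<Rightarrow> int \<Rightarrow> 'x set set" where
  "of_dim S k = {s \<in> S. zdim s = k}"

lemma lower_proper_faces: assumes "s \<in> cells" shows "lower (proper_faces s)" "\<Union>(proper_faces s) = bnd s"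
proof -
  show "lower (proper_faces s)"
    unfolding lower_def
  proof (intro conjI)
    show "finite (proper_faces s)" by (rule finite_subset[OF _ finite_faces[OF assms]]) (auto simp: proper_faces_def)
  qed (auto simp: proper_faces_def)
  show "\<Union>(proper_faces s) = bnd s"
  proof (intro equalityI subsetI)
    fix x assume "x \<in> \<Union>(proper_faces s)"
    then obtain t where t: "t \<in> cells" "t \<subset> s" "x \<in> t" by (auto simp: proper_faces_def)
    have "x \<notin> open_cell K s"
    proof
      assume "x \<in> open_cell K s"
      then have "s \<subseteq> t" using cell_face_subset[OF t(1) assms t(3)] by blast
      then show False using t by blast
    qed
    then show "x \<in> bnd s" using t cell_split[OF assms] by blast
  next
    fix x assume x: "x \<in> bnd s"
    obtain r where r: "r \<in> cells" "r \<subset> s" "x \<in> open_cell K r" using boundary_face[OF assms x] by blast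
    then show "x \<in> \<Union>(proper_faces s)" using open_cell_subset by (auto simp: proper_faces_def)
  qed
qed

lemma finite_facets: "s \<in> cells \<Longrightarrow> finite (facets s)"
  by (rule finite_subset[OF _ finite_faces]) (auto simp: facets_def)

lemma facets_boundary:
  assumes "s \<in> cells" "t \<in> facets s"
  shows "t \<subseteq> bnd s" "bnd t \<subseteq> dim_upto (proper_faces s) (zdim s - 2)"
proof -
  have t: "t \<in> cells" "t \<subset> s" "dm s = dm t + 1" using assms by (auto simp: facets_def)
  show "t \<subseteq> bnd s" using lower_proper_faces(2)[OF assms(1)] t by (auto simp: proper_faces_def)
  show "bnd t \<subseteq> dim_upto (proper_faces s) (zdim s - 2)"
  proof
    fix x assume x: "x \<in> bnd t"
    obtain r where r: "r \<in> cells" "r \<subset> t" "x \<in> open_cell K r" using boundary_face[OF t(1) x] by blast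
    have "zdim r \<le> zdim s - 2" using proper_face_in_boundary(2)[OF t(1) r(1,2)] t(3) by auto
    moreover have "r \<subset> s" using r(2) t(2) by (rule psubset_trans)
    moreover have "x \<in> r" using r(3) open_cell_subset[OF r(1)] by blast
    ultimately show "x \<in> dim_upto (proper_faces s) (zdim s - 2)"
      using r(1) unfolding dim_upto_def proper_faces_def by blast
  qed
qed

lemma skeleton_triple:
  assumes s: "s \<in> cells"
  shows "s \<subseteq> SK (zdim s)" "bnd s \<subseteq> SK (zdim s - 1)"
    "dim_upto (proper_faces s) (zdim s - 2) \<subseteq> SK (zdim s - 2)"
    "SK (zdim s - 2) \<subseteq> SK (zdim s - 1)" "SK (zdim s - 1) \<subseteq> SK (zdim s)"
proof -
  show "s \<subseteq> SK (zdim s)" by (rule cell_in_skeleton[OF s]) simp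
  show "bnd s \<subseteq> SK (zdim s - 1)" by (rule boundary_in_skeleton[OF s]) simp
  show "dim_upto (proper_faces s) (zdim s - 2) \<subseteq> SK (zdim s - 2)"
    unfolding dim_upto_def proper_faces_def skeleton_def by blast
qed (rule skeleton_mono, simp)+

lemma dim_upto_subset_boundary: "s \<in> cells \<Longrightarrow> dim_upto (proper_faces s) k \<subseteq> bnd s"
  using lower_proper_faces(2) by (auto simp: dim_upto_def)

end

context oriented_cw begin

text \<open>The boundary of the oriented cell \<open>s\<close> lies in the homology of the boundary sphere modulo its faces of
  codimension two, which is generated by the facets. By naturality the same coefficients work
  in all larger triples, in particular in skeleta and in every subcomplex that contains \<open>s\<close>.\<close>

lemma boundary_formula_exists:
  assumes s: "s \<in> cells"
  shows "\<exists>c. \<forall>A B C. s \<subseteq> A \<longrightarrow> bnd s \<subseteq> B \<longrightarrow> dim_upto (proper_faces s) (zdim s - 2) \<subseteq> C \<longrightarrow> C \<subseteq> B \<longrightarrow> B \<subseteq> A \<longrightarrow>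
    bdy (zdim s) A B C (gen (zdim s) A B s)
      = comb (zdim s - 1) B C c (facets s)"
proof -
  let ?d = "zdim s"
  let ?b = "bnd s" and ?u = "dim_upto (proper_faces s) (?d - 2)"
  let ?P = "proper_faces s" and ?P' = "{t \<in> proper_faces s. zdim t \<le> ?d - 2}"
  have l: "lower ?P" "lower ?P'" using lower_proper_faces[OF s] lower_dim by auto
  have u: "\<Union>?P = ?b" "\<Union>?P' = ?u" using lower_proper_faces[OF s] by (auto simp: dim_upto_def)
  have diff: "?P - ?P' = facets s"
    using proper_face_in_boundary(2)[OF s] by (fastforce simp: proper_faces_def facets_def)
  have ub: "?u \<subseteq> ?b" by (rule dim_upto_subset_boundary[OF s])
  have bs: "?b \<subseteq> s" by (rule cell_boundary_subset[OF s])
  have "bdy ?d s ?b ?u (\<omega> s) \<in> carrier (H (?d - 1) (\<Union>?P) (\<Union>?P'))"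
    unfolding u by (rule relbd_carrier[OF bs])
  from lower_homology_generated[OF l(2,1) _ _ this] obtain c where
    c: "bdy ?d s ?b ?u (\<omega> s) = comb (?d - 1) ?b ?u c (facets s)"
    unfolding u diff using diff by (auto simp: facets_def)
  show ?thesis
  proof (rule exI[of _ c], intro allI impI)
    fix A B C assume sub: "s \<subseteq> A" "?b \<subseteq> B" "?u \<subseteq> C" "C \<subseteq> B" "B \<subseteq> A"
    interpret G: comm_group "H (?d - 1) B C" by (rule comm_HG)
    have "bdy ?d A B C (gen ?d A B s) = inc (?d - 1) ?b ?u B C (bdy ?d s ?b ?u (\<omega> s))"
      unfolding gen_def by (rule relbd_natural) (use sub bs in auto)
    also have "\<dots> = comb (?d - 1) B C c (facets s)"
      unfolding c by (rule incl_comb[OF finite_facets[OF s]]) (use facets_boundary[OF s] sub in auto)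
    finally show "bdy ?d A B C (gen ?d A B s) = comb (?d - 1) B C c (facets s)" .
  qed
qed

lemma cellular_generator_eq: "cellular_generator K \<omega> s = gen (zdim s) (SK (zdim s)) (SK (zdim s - 1)) s"
  unfolding cellular_generator_def gen_def incl_def Let_def ..

text \<open>The condition that \<open>incidence_numbers\<close> imposes on the row \<open>c s\<close> of a cell \<open>s\<close> of positive dimension.\<close>

definition boundary_formula :: "'x set \<Rightarrow> ('x set \<Rightarrow> int) \<Rightarrow> bool" where
  "boundary_formula s c \<longleftrightarrow> bdy (zdim s) (SK (zdim s)) (SK (zdim s - 1)) (SK (zdim s - 2)) (gen (zdim s) (SK (zdim s)) (SK (zdim s - 1)) s)
      = comb (zdim s - 1) (SK (zdim s - 1)) (SK (zdim s - 2)) c (facets s)"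

lemma incidence_iff:
  "incidence_numbers K \<omega> c \<longleftrightarrow>
     (\<forall>v\<in>vertices K. \<forall>z\<in>\<omega> v. augc z = c v {}) \<and> (\<forall>s\<in>cells - vertices K. boundary_formula s (c s))"
proof -
  have "(let d = zdim s; C = cellular_chain_group K (d - 1) in
        hom_relboundary d (subtopology W (SK d)) (SK (d - 1)) (SK (d - 2)) (cellular_generator K \<omega> s) =
        finprod C (\<lambda>t. cellular_generator K \<omega> t [^]\<^bsub>C\<^esub> c s t) {t \<in> cells. t \<subset> s \<and> dm s = dm t + 1})
     \<longleftrightarrow> boundary_formula s (c s)" if s: "s \<in> cells - vertices K" for s
  proof -
    let ?d = "zdim s"
    have C: "cellular_chain_group K (?d - 1) = H (?d - 1) (SK (?d - 1)) (SK (?d - 2))"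
      by (simp add: cellular_chain_group_def)
    interpret G: comm_group "H (?d - 1) (SK (?d - 1)) (SK (?d - 2))" by (rule comm_HG)
    have "finprod (H (?d - 1) (SK (?d - 1)) (SK (?d - 2))) (\<lambda>t. cellular_generator K \<omega> t [^]\<^bsub>H (?d - 1) (SK (?d - 1)) (SK (?d - 2))\<^esub> c s t) (facets s)
       = comb (?d - 1) (SK (?d - 1)) (SK (?d - 2)) (c s) (facets s)"
      unfolding lincomb_def
    proof (rule G.finprod_cong'[OF refl])
      fix t assume "t \<in> facets s"
      then have "zdim t = ?d - 1" "zdim t - 1 = ?d - 2" by (auto simp: facets_def)
      then show "cellular_generator K \<omega> t [^]\<^bsub>H (?d - 1) (SK (?d - 1)) (SK (?d - 2))\<^esub> c s t
        = gen (?d - 1) (SK (?d - 1)) (SK (?d - 2)) t [^]\<^bsub>H (?d - 1) (SK (?d - 1)) (SK (?d - 2))\<^esub> c s t"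
        by (simp only: cellular_generator_eq)
    qed (auto intro!: G.int_pow_closed gen_carrier)
    then show ?thesis
      unfolding Let_def C boundary_formula_def relbd_def cellular_generator_eq[of s] facets_def[symmetric] by simp
  qed
  then show ?thesis
    unfolding incidence_numbers_def augc_sum by blast
qed

text \<open>The orientation of a vertex is one of the two generators of the homology of a point, so its
  augmentation is \<open>1\<close> or \<open>-1\<close>.\<close>

lemma vertex_aug:
  assumes v: "v \<in> vertices K"
  shows "\<omega> v \<in> carrier (H 0 v {})" "aug (\<omega> v) * aug (\<omega> v) = 1"
proof -
  have vc: "v \<in> cells" "dm v = 0" using v by (auto simp: vertices_def)
  have om: "\<omega> v \<in> carrier (H 0 v {})" "generate (H 0 v {}) {\<omega> v} = carrier (H 0 v {})"
    using omega_generates[OF vc(1)] vc(2) dim0_boundary[OF vc(2)] by simp_all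
  then show "\<omega> v \<in> carrier (H 0 v {})" by simp
  obtain a where "a \<in> topspace (subtopology W v)" using cell_nonempty[OF vc(1)] cell_topspace[OF vc(1)] by auto
  from aug_path_connected(2)[OF cell_path_connected[OF vc(1)] this om(1)] om(2)
  show "aug (\<omega> v) * aug (\<omega> v) = 1" by simp
qed

lemma exists_incidence: "\<exists>c. incidence_numbers K \<omega> c"
proof -
  have "\<exists>c. boundary_formula s c" if s: "s \<in> cells" for s
  proof -
    let ?d = "zdim s"
    obtain c where "\<And>A B C. s \<subseteq> A \<Longrightarrow> bnd s \<subseteq> B \<Longrightarrow> dim_upto (proper_faces s) (?d - 2) \<subseteq> C \<Longrightarrow> C \<subseteq> B \<Longrightarrow> B \<subseteq> A \<Longrightarrow>
       bdy ?d A B C (gen ?d A B s) = comb (?d - 1) B C c (facets s)"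
      using boundary_formula_exists[OF s] by blast
    from this[OF skeleton_triple[OF s]] show ?thesis unfolding boundary_formula_def by blast
  qed
  then obtain c where c: "\<And>s. s \<in> cells \<Longrightarrow> boundary_formula s (c s)" by metis
  define c' where "c' = (\<lambda>s. if s \<in> vertices K then (\<lambda>_. aug (\<omega> s)) else c s)"
  have "incidence_numbers K \<omega> c'"
    unfolding incidence_iff
  proof (intro conjI ballI)
    fix v z assume v: "v \<in> vertices K" "z \<in> \<omega> v"
    have "aug (\<omega> v) = augc z" by (rule aug_eq[OF vertex_aug(1)[OF v(1)] v(2)])
    then show "augc z = c' v {}" using v by (simp add: c'_def)
  qed (use c in \<open>auto simp: c'_def\<close>)
  then show ?thesis by blast
qed

end

locale incidence_cw = oriented_cw K \<omega> for K :: "'x cell_complex" and \<omega> +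
  fixes c :: "'x set \<Rightarrow> 'x set \<Rightarrow> int"
  assumes incid: "incidence_numbers K \<omega> c"
begin

text \<open>The coefficients found in the boundary sphere of \<open>s\<close> agree with the incidence numbers,
  which are defined by the skeleta of the whole complex, because the facets of \<open>s\<close> are independent there.\<close>

lemma incidence_formula:
  assumes s: "s \<in> cells" "dm s > 0"
    and sub: "s \<subseteq> A" "bnd s \<subseteq> B" "dim_upto (proper_faces s) (zdim s - 2) \<subseteq> C" "C \<subseteq> B" "B \<subseteq> A"
  shows "bdy (zdim s) A B C (gen (zdim s) A B s)
      = comb (zdim s - 1) B C (c s) (facets s)"
proof -
  let ?d = "zdim s"
  obtain c' where c': "\<And>A B C. s \<subseteq> A \<Longrightarrow> bnd s \<subseteq> B \<Longrightarrow> dim_upto (proper_faces s) (?d - 2) \<subseteq> C \<Longrightarrow> C \<subseteq> B \<Longrightarrow> B \<subseteq> A \<Longrightarrow>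
     bdy ?d A B C (gen ?d A B s) = comb (?d - 1) B C c' (facets s)"
    using boundary_formula_exists[OF s(1)] by blast
  note 1 = c'[OF skeleton_triple[OF s(1)]]
  have "boundary_formula s (c s)" using incid s unfolding incidence_iff by (auto simp: vertices_def)
  then have eq: "comb (?d - 1) (SK (?d - 1)) (SK (?d - 1 - 1)) (c s) (facets s)
     = comb (?d - 1) (SK (?d - 1)) (SK (?d - 1 - 1)) c' (facets s)"
    using 1 unfolding boundary_formula_def by simp
  have "c s t = c' t" if "t \<in> facets s" for t
    by (rule skeleton_independent[OF finite_facets[OF s(1)] _ _ eq that]) (auto simp: facets_def)
  then show ?thesis
    unfolding c'[OF sub] by (intro comm_group.lincomb_cong[OF comm_HG]) (auto intro: gen_carrier)
qed

lemma incidence_vertex: "v \<in> vertices K \<Longrightarrow> c v {} = aug (\<omega> v)"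
  using incid vertex_aug(1) aug_eq class_obtain unfolding incidence_iff by metis

text \<open>Incidence numbers are only determined between a cell and its facets; all other entries of the
  matrix are set to \<open>0\<close>.\<close>

definition coef :: "'x set \<Rightarrow> 'x set \<Rightarrow> int" where
  "coef s t = (if t \<subset> s \<and> cell_rank K s = cell_rank K t + 1 then c s t else 0)"

lemma cell_rank_cell: "s \<in> cells \<Longrightarrow> cell_rank K s = dm s + 1"
  using cell_nonempty by (auto simp: cell_rank_def)

lemma coef_facet: "s \<in> cells \<Longrightarrow> t \<in> cells \<Longrightarrow> coef s t = (if t \<in> facets s then c s t else 0)"
  by (auto simp: coef_def facets_def cell_rank_cell)

end

section \<open>The cellular chain complex of a closed cell\<close>

context incidence_cw begin

lemma vertex_coef: "v \<in> vertices K \<Longrightarrow> coef v {} = aug (\<omega> v)"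
  using incidence_vertex[of v] cell_nonempty[of v] cell_rank_cell[of v]
  by (auto simp: coef_def cell_rank_def vertices_def)

lemma aug_gen:
  assumes "v \<in> vertices K" "v \<subseteq> A" shows "aug (gen 0 A {} v) = coef v {}"
proof -
  have "dm v = 0" using assms by (simp add: vertices_def)
  then have "gen 0 A {} v = inc 0 v {} A {} (\<omega> v)" by (simp add: gen_def dim0_boundary)
  then show ?thesis using aug_incl[OF assms(2) vertex_aug(1)[OF assms(1)]] vertex_coef[OF assms(1)] by simp
qed

abbreviation "layer \<equiv> rank_layer (face_poset K) (cell_rank K)"

lemma layer_0: "layer \<alpha> 0 = {}" and layer_1: "layer \<alpha> (Suc 0) = {{}}"
  by (auto simp: rank_layer_def face_poset_def cell_rank_def split: if_splits)

lemma layer_cells: "layer \<alpha> (Suc (Suc r)) = of_dim {t \<in> cells. t \<subseteq> \<alpha>} (int r)"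
  using cell_nonempty by (auto simp: rank_layer_def of_dim_def face_poset_def cell_rank_def)

text \<open>In what follows, \<open>\<alpha>\<close> is a cell, and the relative homology groups \<open>cgrp p\<close> of consecutive
  skeleta of \<open>\<alpha>\<close> form its own cellular chain complex.\<close>

context
  fixes \<alpha> assumes \<alpha>: "\<alpha> \<in> cells"
begin

abbreviation "faces \<equiv> {t \<in> cells. t \<subseteq> \<alpha>}"
abbreviation "skel \<equiv> dim_upto faces"
abbreviation "fcells \<equiv> of_dim faces"
abbreviation "cgrp p \<equiv> H p (skel p) (skel (p - 1))"
abbreviation "chn p a \<equiv> comb p (skel p) (skel (p - 1)) a (fcells p)"
abbreviation "cbd p \<equiv> bdy p (skel p) (skel (p - 1)) (skel (p - 2))"

lemma skel_mono: "a \<le> b \<Longrightarrow> skel a \<subseteq> skel b"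
  unfolding dim_upto_def by (auto intro: order_trans)

lemma skel_neg: "k < 0 \<Longrightarrow> skel k = {}"
  unfolding dim_upto_def by auto

lemma lower_skel: "lower {s \<in> faces. zdim s \<le> k}" "\<Union>{s \<in> faces. zdim s \<le> k} = skel k"
    "lower faces" "\<Union>faces = \<alpha>" "skel k \<subseteq> \<alpha>"
  using lower_dim[OF lower_faces[OF \<alpha>]] lower_faces[OF \<alpha>] \<alpha> by (auto simp: dim_upto_def)

lemma finite_fcells: "finite (fcells p)"
  by (rule finite_subset[OF _ finite_faces[OF \<alpha>]]) (auto simp: of_dim_def)

lemma fcells_cell: "s \<in> fcells p \<Longrightarrow> s \<in> cells \<and> s \<subseteq> \<alpha> \<and> zdim s = p"
  by (auto simp: of_dim_def)

lemma cell_in_skel: "s \<in> fcells p \<Longrightarrow> s \<subseteq> skel p"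
  by (auto simp: of_dim_def dim_upto_def)

lemma boundary_in_skel:
  assumes "s \<in> fcells p" shows "bnd s \<subseteq> skel (p - 1)"
proof
  note s = fcells_cell[OF assms]
  fix x assume x: "x \<in> bnd s"
  obtain r where r: "r \<in> cells" "r \<subset> s" "x \<in> open_cell K r" using boundary_face[OF _ x] s by blast
  have "zdim r \<le> p - 1" "r \<in> faces" using proper_face_in_boundary(2)[OF _ r(1,2)] r s by auto
  then show "x \<in> skel (p - 1)" using r(3) open_cell_subset[OF r(1)] unfolding dim_upto_def by blast
qed

lemma chn_closed: "chn p a \<in> carrier (cgrp p)"
  by (rule comm_group.lincomb_closed[OF comm_HG]) (rule funcsetI, rule gen_carrier)

lemma cellular_chains_generated: assumes "x \<in> carrier (cgrp p)" shows "\<exists>a. x = chn p a"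
proof -
  let ?S' = "{s \<in> faces. zdim s \<le> p}" and ?S = "{s \<in> faces. zdim s \<le> p - 1}"
  have diff: "?S' - ?S = fcells p" by (auto simp: of_dim_def)
  have "\<exists>a. x = comb p (\<Union>?S') (\<Union>?S) a (?S' - ?S)"
  proof (rule lower_homology_generated[OF lower_skel(1) lower_skel(1)])
    show "x \<in> carrier (H p (\<Union>?S') (\<Union>?S))" unfolding lower_skel(2) by (rule assms)
  qed auto
  then show ?thesis unfolding diff lower_skel(2) .
qed

lemma cellular_chains_independent:
  assumes eq: "chn p a = chn p b" and t: "t \<in> fcells p"
  shows "a t = b t"
proof -
  have "inc p (skel p) (skel (p - 1)) (SK p) (SK (p - 1)) (chn p a) = comb p (SK p) (SK (p - 1)) a (fcells p)" for a
    by (rule incl_comb[OF finite_fcells])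
      (use cell_in_skel boundary_in_skel in \<open>auto simp: dim_upto_def skeleton_def\<close>)
  from this[of a] this[of b] have "comb p (SK p) (SK (p - 1)) a (fcells p) = comb p (SK p) (SK (p - 1)) b (fcells p)"
    using eq by simp
  from skeleton_independent[OF finite_fcells _ _ this t] show ?thesis using fcells_cell by blast
qed

lemma cbd_gen:
  assumes s: "s \<in> fcells p" and p: "p \<ge> 1"
  shows "cbd p (gen p (skel p) (skel (p - 1)) s) = chn (p - 1) (coef s)"
proof -
  note sc = fcells_cell[OF s]
  interpret G: comm_group "cgrp (p - 1)" by (rule comm_HG)
  have "dim_upto (proper_faces s) (p - 2) \<subseteq> skel (p - 2)" using sc unfolding dim_upto_def proper_faces_def by blast
  then have "bdy p (skel p) (skel (p - 1)) (skel (p - 1 - 1)) (gen p (skel p) (skel (p - 1)) s) = comb (p - 1) (skel (p - 1)) (skel (p - 1 - 1)) (c s) (facets s)"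
    using incidence_formula[of s "skel p" "skel (p - 1)" "skel (p - 1 - 1)"] sc p
      cell_in_skel[OF s] boundary_in_skel[OF s] skel_mono[of "p - 2" "p - 1"] skel_mono[of "p - 1" p]
    by auto
  also have "\<dots> = comb (p - 1) (skel (p - 1)) (skel (p - 1 - 1)) (coef s) (facets s)"
    by (rule G.lincomb_cong) (use sc in \<open>auto intro: gen_carrier simp: coef_facet facets_def\<close>)
  also have "\<dots> = chn (p - 1) (coef s)"
  proof (rule G.lincomb_superset[OF finite_fcells])
    show "facets s \<subseteq> fcells (p - 1)" using sc by (auto simp: facets_def of_dim_def)
    show "coef s t = 0" if "t \<in> fcells (p - 1) - facets s" for t
      using that sc fcells_cell[of t "p - 1"] by (simp add: coef_facet)
  qed (rule funcsetI, rule gen_carrier)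
  finally show ?thesis by simp
qed

lemma cbd_chn:
  assumes p: "p \<ge> 1"
  shows "cbd p (chn p a) = chn (p - 1) (\<lambda>t. \<Sum>s\<in>fcells p. a s * coef s t)"
proof -
  interpret G: comm_group "cgrp (p - 1)" by (rule comm_HG)
  have h: "cbd p \<in> hom (cgrp p) (cgrp (p - 1))"
    using relbd_hom[OF skel_mono[of "p - 1" p], of W p "skel (p - 2)"] by simp
  have "cbd p (chn p a) = lincomb (cgrp (p - 1)) (\<lambda>s. cbd p (gen p (skel p) (skel (p - 1)) s)) a (fcells p)"
    by (rule hom_lincomb[OF comm_HG comm_HG h finite_fcells]) (rule funcsetI, rule gen_carrier)
  also have "\<dots> = lincomb (cgrp (p - 1)) (\<lambda>s. chn (p - 1) (coef s)) a (fcells p)"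
    by (rule G.lincomb_cong) (rule cbd_gen[OF _ p], assumption, rule refl, rule funcsetI, rule chn_closed)
  also have "\<dots> = chn (p - 1) (\<lambda>t. \<Sum>s\<in>fcells p. a s * coef s t)"
    by (rule G.lincomb_lincomb[OF finite_fcells finite_fcells]) (rule funcsetI, rule gen_carrier)
  finally show ?thesis .
qed

lemma aug_chn: "aug (chn 0 a) = (\<Sum>v\<in>fcells 0. a v * coef v {})"
proof -
  have e: "skel (0 - 1) = {}" by (rule skel_neg) simp
  have "aug (chn 0 a) = (\<Sum>v\<in>fcells 0. a v * aug (gen 0 (skel 0) {} v))"
    unfolding e by (rule aug_lincomb[OF finite_fcells]) (rule funcsetI, rule gen_carrier)
  also have "\<dots> = (\<Sum>v\<in>fcells 0. a v * coef v {})"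
  proof (rule sum.cong[OF refl])
    fix v assume v: "v \<in> fcells 0"
    then have "v \<in> vertices K" by (auto simp: of_dim_def vertices_def)
    then show "a v * aug (gen 0 (skel 0) {} v) = a v * coef v {}" using aug_gen cell_in_skel[OF v] by simp
  qed
  finally show ?thesis .
qed

lemma cell_skeleton_trivial: "trivial_group (H (k + 1) \<alpha> (skel (k + 1)))"
proof -
  have "trivial_group (H (k + 1) (\<Union>faces) (\<Union>{s \<in> faces. zdim s \<le> k + 1}))"
    by (rule lower_homology_trivial[OF lower_skel(1) lower_skel(3)]) auto
  then show ?thesis unfolding lower_skel(2,4) .
qed

text \<open>The homology of the contractible cell vanishes in degree \<open>p\<close>. The cells outside \<open>skel (p + 1)\<close> have
  dimension at least \<open>p + 2\<close> and those in \<open>skel (p - 2)\<close> have dimension at most \<open>p - 2\<close>, so neither changes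
  the homology in degree \<open>p\<close>.\<close>

lemma skel_pair_trivial:
  assumes p: "p \<ge> 1"
  shows "trivial_group (H p (skel (p + 1)) (skel (p - 2)))"
proof -
  have "trivial_group (H (p - 1) (\<Union>{s \<in> faces. zdim s \<le> p - 2}) (\<Union>{}))"
    by (rule lower_homology_trivial[OF _ lower_skel(1)]) (auto simp: lower_def)
  then have 1: "trivial_group (H (p - 1) (skel (p - 2)) {})" unfolding lower_skel(2) by simp
  have 2: "trivial_group (H p \<alpha> {})" by (rule cell_acyclic[OF \<alpha>]) (use p in simp)
  have "trivial_group (H p \<alpha> (skel (p - 2)))"
    by (rule triple_trivial_right[OF _ lower_skel(5) 2 1]) simp
  then show ?thesis
    using triple_trivial_left[OF skel_mono[of "p - 2" "p + 1"] lower_skel(5), where p = "p + 1"]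
      cell_skeleton_trivial[of p] by simp
qed

text \<open>It suffices that \<open>x\<close> becomes trivial in the homology of \<open>skel (p + 1)\<close> modulo \<open>skel (p - 1)\<close>. For
  \<open>p \<ge> 1\<close> the cycle \<open>x\<close> lifts to the homology modulo \<open>skel (p - 2)\<close>, where it becomes trivial. For \<open>p = 0\<close>
  the augmentation shows that \<open>x\<close> is trivial in the homology of the whole cell, and the
  \<open>1\<close>-skeleton has the same zeroth homology.\<close>

lemma cellular_cycle_bounds:
  assumes p: "p \<ge> 0" and x: "x \<in> carrier (cgrp p)"
    and 1: "p \<ge> 1 \<Longrightarrow> cbd p x = \<one>\<^bsub>cgrp (p - 1)\<^esub>"
    and 0: "p = 0 \<Longrightarrow> aug x = 0"
  shows "\<exists>w\<in>carrier (cgrp (p + 1)). bdy (p + 1) (skel (p + 1)) (skel p) (skel (p - 1)) w = x"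
proof -
  have sub: "skel (p - 2) \<subseteq> skel (p - 1)" "skel (p - 1) \<subseteq> skel p" "skel p \<subseteq> skel (p + 1)" by (rule skel_mono, simp)+
  have "inc p (skel p) (skel (p - 1)) (skel (p + 1)) (skel (p - 1)) x = \<one>\<^bsub>H p (skel (p + 1)) (skel (p - 1))\<^esub>"
  proof (cases "p \<ge> 1")
    case True
    have "cbd p x = \<one>\<^bsub>H (p - 1) (skel (p - 1)) (skel (p - 2))\<^esub>" using 1[OF True] by simp
    from triple_exact1(1)[OF sub(1,2) x this] obtain y where
      y: "y \<in> carrier (H p (skel p) (skel (p - 2)))" "inc p (skel p) (skel (p - 2)) (skel p) (skel (p - 1)) y = x" by blast
    have "inc p (skel p) (skel (p - 1)) (skel (p + 1)) (skel (p - 1)) x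
       = inc p (skel p) (skel (p - 2)) (skel (p + 1)) (skel (p - 1)) y"
      unfolding y(2)[symmetric] by (rule incl_incl) (use sub in auto)
    also have "\<dots> = inc p (skel (p + 1)) (skel (p - 2)) (skel (p + 1)) (skel (p - 1)) (inc p (skel p) (skel (p - 2)) (skel (p + 1)) (skel (p - 2)) y)"
      by (rule incl_incl[symmetric]) (use sub in auto)
    also have "inc p (skel p) (skel (p - 2)) (skel (p + 1)) (skel (p - 2)) y = \<one>\<^bsub>H p (skel (p + 1)) (skel (p - 2))\<^esub>"
      by (rule trivial_group_D[OF skel_pair_trivial[OF True] incl_carrier])
    finally show ?thesis by (simp add: incl_one)
  next
    case False
    then have p0: "p = 0" using p by simp
    have e: "skel (p - 1) = {}" by (rule skel_neg) (simp add: p0)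
    have x': "x \<in> carrier (H 0 (skel 0) {})" using x e unfolding p0 by simp
    have La: "skel 0 \<subseteq> \<alpha>" "skel 1 \<subseteq> \<alpha>" "skel 0 \<subseteq> skel 1" using lower_skel(5) skel_mono[of 0 1] by auto
    have "aug (inc 0 (skel 0) {} \<alpha> {} x) = 0" using aug_incl[OF La(1) x'] 0[OF p0] by simp
    moreover obtain a where "a \<in> topspace (subtopology W \<alpha>)" using cell_nonempty[OF \<alpha>] cell_topspace[OF \<alpha>] by auto
    ultimately have "inc 0 (skel 0) {} \<alpha> {} x = \<one>\<^bsub>H 0 \<alpha> {}\<^esub>"
      using aug_path_connected(1)[OF cell_path_connected[OF \<alpha>] _ incl_carrier] by blast
    then have z: "inc 0 (skel 1) {} \<alpha> {} (inc 0 (skel 0) {} (skel 1) {} x) = \<one>\<^bsub>H 0 \<alpha> {}\<^esub>"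
      using incl_incl[OF La(3) La(2), of "{}" "{}" "{}" W 0 x] by simp
    have "\<exists>w\<in>carrier (H 1 \<alpha> (skel 1)). bdy 1 \<alpha> (skel 1) {} w = inc 0 (skel 0) {} (skel 1) {} x"
      using triple_exact2[OF empty_subsetI La(2), where W = W and p = 1] z incl_carrier[of W 0 "skel 0" "{}" "skel 1" "{}" x] by simp
    then obtain w where w: "w \<in> carrier (H 1 \<alpha> (skel 1))" "bdy 1 \<alpha> (skel 1) {} w = inc 0 (skel 0) {} (skel 1) {} x" by blast
    have "inc 0 (skel 0) {} (skel 1) {} x = \<one>\<^bsub>H 0 (skel 1) {}\<^esub>"
      using trivial_group_D[OF _ w(1)] cell_skeleton_trivial[of 0] w(2) relbd_one[OF La(2), of W 1 "{}"] by simp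
    then show ?thesis unfolding e using p0 by simp
  qed
  then show ?thesis
    using triple_exact2[OF sub(2,3), where x = x and W = W and p = "p + 1"] x by simp
qed

text \<open>A face of minimal dimension has empty boundary, so it is a vertex.\<close>

lemma has_vertex: "\<exists>v\<in>fcells 0. coef v {} * coef v {} = 1"
proof -
  obtain s where s: "s \<in> faces" "\<And>t. t \<in> faces \<Longrightarrow> dm s \<le> dm t"
    using ex_has_least_nat[of "\<lambda>s. s \<in> faces" \<alpha> dm] \<alpha> by blast
  have "dm s = 0"
  proof (rule ccontr)
    assume "dm s \<noteq> 0"
    then obtain m where m: "dm s = Suc m" by (cases "dm s") auto
    have "(\<lambda>i. if i = 0 then 1 else 0) \<in> disc_boundary (Suc m)"
      by (auto simp: disc_boundary_def topspace_Euclidean_space if_distrib[of "\<lambda>x. x ^ 2"] cong: if_cong)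
    then obtain x where x: "x \<in> bnd s" unfolding cell_boundary_def m by blast
    obtain r where r: "r \<in> cells" "r \<subset> s" using boundary_face[OF _ x] s(1) by blast
    then have "dm r < dm s" "r \<in> faces" using proper_face_in_boundary(2)[OF _ r] s(1) by auto
    then show False using s(2)[of r] by simp
  qed
  then have "s \<in> vertices K" "s \<in> fcells 0" using s(1) by (auto simp: vertices_def of_dim_def)
  then show ?thesis using vertex_aug(2)[of s] vertex_coef[of s] by (intro bexI[of _ s]) simp_all
qed

text \<open>The augmented cellular chain complex of a cell is exact, because the cell is contractible.\<close>

theorem integral_exact:
  assumes cyc: "\<And>\<mu>. \<mu> \<in> layer \<alpha> n \<Longrightarrow> (\<Sum>t\<in>layer \<alpha> (Suc n). a t * coef t \<mu>) = 0"
  shows "\<exists>b. \<forall>t\<in>layer \<alpha> (Suc n). a t = (\<Sum>v\<in>layer \<alpha> (Suc (Suc n)). b v * coef v t)"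
proof (cases n)
  case 0
  obtain v where v: "v \<in> fcells 0" "coef v {} * coef v {} = 1" using has_vertex by blast
  have "(\<Sum>u\<in>fcells 0. (if u = v then a {} * coef v {} else 0) * coef u {}) = (\<Sum>u\<in>fcells 0. if u = v then a {} * coef v {} * coef v {} else 0)"
    by (rule sum.cong) auto
  also have "\<dots> = a {}" using v finite_fcells[of 0] by (simp add: mult.assoc)
  finally show ?thesis unfolding 0 layer_1 layer_cells
    by (intro exI[of _ "\<lambda>u. if u = v then a {} * coef v {} else 0"]) simp
next
  case (Suc r)
  let ?p = "int r"
  have next_p: "?p + 1 = int (Suc r)" by simp
  have "\<exists>w\<in>carrier (cgrp (?p + 1)). bdy (?p + 1) (skel (?p + 1)) (skel ?p) (skel (?p - 1)) w = chn ?p a"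
  proof (rule cellular_cycle_bounds[OF _ chn_closed])
    assume p: "?p \<ge> 1"
    then obtain r' where r': "r = Suc r'" by (cases r) auto
    have "(\<Sum>s\<in>fcells ?p. a s * coef s t) = 0" if "t \<in> fcells (?p - 1)" for t
      using cyc[of t] that by (simp add: Suc r' layer_cells)
    then show "cbd ?p (chn ?p a) = \<one>\<^bsub>cgrp (?p - 1)\<^esub>"
      unfolding cbd_chn[OF p] by (rule comm_group.lincomb_zero[OF comm_HG])
  next
    assume p: "?p = 0"
    have "(\<Sum>s\<in>fcells 0. a s * coef s {}) = 0"
      using cyc[of "{}"] p by (simp add: Suc layer_cells layer_1)
    then show "aug (chn ?p a) = 0" unfolding p aug_chn .
  qed simp
  then obtain w where w: "w \<in> carrier (cgrp (?p + 1))" "bdy (?p + 1) (skel (?p + 1)) (skel ?p) (skel (?p - 1)) w = chn ?p a" by blast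
  obtain b where b: "w = chn (?p + 1) b"
    using cellular_chains_generated[OF w(1)] by blast
  have "chn ?p a = chn ?p (\<lambda>t. \<Sum>s\<in>fcells (?p + 1). b s * coef s t)"
    using cbd_chn[of "?p + 1" b] w(2) unfolding b by simp
  from cellular_chains_independent[OF this] show ?thesis
    unfolding Suc layer_cells next_p by blast
qed

text \<open>Two consecutive boundary maps in the sequences of triples of skeleta compose to zero; in the
  lowest degree, so do the boundary and the augmentation.\<close>

theorem integral_square_zero:
  assumes r: "cell_rank K \<alpha> = Suc n" and \<mu>: "\<mu> \<in> layer \<alpha> n"
  shows "(\<Sum>t\<in>layer \<alpha> (Suc n). coef \<alpha> t * coef t \<mu>) = 0"
proof -
  let ?p = "int n"
  have n: "n \<noteq> 0" using \<mu> by (cases n) (simp_all add: layer_0)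
  have La: "\<alpha> \<in> fcells ?p" using r cell_rank_cell[OF \<alpha>] \<alpha> by (simp add: of_dim_def)
  have p: "?p \<ge> 1" using n by simp
  note f = cbd_gen[OF La p]
  obtain r where r: "n = Suc r" using n by (cases n) auto
  show ?thesis
  proof (cases r)
    case 0
    have e: "skel (?p - 2) = {}" by (rule skel_neg) (simp add: r 0)
    have "aug (bdy 1 (skel 1) (skel 0) {} (gen 1 (skel 1) (skel 0) \<alpha>)) = 0"
      by (rule aug_relbd) (use skel_mono[of 0 1] gen_carrier in auto)
    then have "(\<Sum>v\<in>fcells 0. coef \<alpha> v * coef v {}) = 0"
      using f unfolding e using aug_chn[of "coef \<alpha>"] r 0 by simp
    then show ?thesis using \<mu> r 0 by (simp add: layer_cells layer_1)
  next
    case (Suc r')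
    have q: "?p - 1 \<ge> 1" using Suc r by simp
    have "cbd (?p - 1) (cbd ?p (gen ?p (skel ?p) (skel (?p - 1)) \<alpha>)) = \<one>\<^bsub>cgrp (?p - 1 - 1)\<^esub>"
      using relbd_relbd[OF skel_mono skel_mono skel_mono, of "?p - 3" "?p - 2" "?p - 1" ?p W ?p] by simp
    then have "chn (?p - 1 - 1) (\<lambda>t. \<Sum>s\<in>fcells (?p - 1). coef \<alpha> s * coef s t) = \<one>\<^bsub>cgrp (?p - 1 - 1)\<^esub>"
      unfolding f cbd_chn[OF q] .
    also have "\<dots> = chn (?p - 1 - 1) (\<lambda>t. 0)"
      by (rule comm_group.lincomb_zero[OF comm_HG, symmetric]) simp
    finally have eq: "chn (?p - 1 - 1) (\<lambda>t. \<Sum>s\<in>fcells (?p - 1). coef \<alpha> s * coef s t) = chn (?p - 1 - 1) (\<lambda>t. 0)" .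
    have "\<mu> \<in> fcells (?p - 1 - 1)" using \<mu> r Suc by (simp add: layer_cells)
    from cellular_chains_independent[OF eq this] show ?thesis by (simp add: r Suc layer_cells)
  qed
qed

end
end

section \<open>Comparison of the cellular and the poset sequence\<close>

type_synonym ('n, 'k, 'm) gmod = "(('n, 'k) mpol, 'm, int ^ 'n) gmodule"

text \<open>A graded isomorphism takes homogeneous components into homogeneous components. For arbitrary
  records of the type of graded modules this does not pass to the inverse, so the isomorphism is
  built with equality.\<close>

definition strict_graded_iso :: "('r, 'm, 'd) gmodule \<Rightarrow> ('r, 'l, 'd) gmodule \<Rightarrow> ('m \<Rightarrow> 'l) \<Rightarrow> bool" where
  "strict_graded_iso M L f \<longleftrightarrow> graded_iso M L f \<and> (\<forall>d. hcomp M d \<subseteq> carrier M) \<and> (\<forall>d. f ` hcomp M d = hcomp L d)"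

text \<open>The direct sum over \<open>I\<close> has summands that are zero outside \<open>J\<close>; these are filled in with the zero
  element, since elements of direct sums are functions on the whole index set.\<close>

lemma gdirect_sum_iso:
  fixes M :: "'i \<Rightarrow> ('r, 'm, 'd) gmodule" and N :: "'i \<Rightarrow> ('r, 'l, 'd) gmodule"
  assumes J: "J \<subseteq> I"
    and bij: "\<And>j. j \<in> J \<Longrightarrow> bij_betw (t j) (carrier (M j)) (carrier (N j))"
    and zero: "\<And>j. j \<in> J \<Longrightarrow> t j \<zero>\<^bsub>M j\<^esub> = \<zero>\<^bsub>N j\<^esub>" "\<And>j. j \<in> J \<Longrightarrow> \<zero>\<^bsub>M j\<^esub> \<in> carrier (M j)"
    and add: "\<And>j x y. j \<in> J \<Longrightarrow> x \<in> carrier (M j) \<Longrightarrow> y \<in> carrier (M j) \<Longrightarrow> t j (x \<oplus>\<^bsub>M j\<^esub> y) = t j x \<oplus>\<^bsub>N j\<^esub> t j y"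
    and smult: "\<And>j r x. j \<in> J \<Longrightarrow> x \<in> carrier (M j) \<Longrightarrow> t j (r \<odot>\<^bsub>M j\<^esub> x) = r \<odot>\<^bsub>N j\<^esub> t j x"
    and hc: "\<And>j x d. j \<in> J \<Longrightarrow> x \<in> carrier (M j) \<Longrightarrow> t j x \<in> hcomp (N j) d \<longleftrightarrow> x \<in> hcomp (M j) d"
    and triv: "\<And>i. i \<in> I - J \<Longrightarrow> carrier (N i) = {\<zero>\<^bsub>N i\<^esub>}"
      "\<And>i. i \<in> I - J \<Longrightarrow> \<zero>\<^bsub>N i\<^esub> \<oplus>\<^bsub>N i\<^esub> \<zero>\<^bsub>N i\<^esub> = \<zero>\<^bsub>N i\<^esub>"
      "\<And>i r. i \<in> I - J \<Longrightarrow> r \<odot>\<^bsub>N i\<^esub> \<zero>\<^bsub>N i\<^esub> = \<zero>\<^bsub>N i\<^esub>"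
      "\<And>i d. i \<in> I - J \<Longrightarrow> \<zero>\<^bsub>N i\<^esub> \<in> hcomp (N i) d"
  shows "strict_graded_iso (gdirect_sum J M) (gdirect_sum I N) (\<lambda>f. \<lambda>i\<in>I. if i \<in> J then t i (f i) else \<zero>\<^bsub>N i\<^esub>)"
proof -
  let ?A = "gdirect_sum J M" and ?B = "gdirect_sum I N"
  let ?t = "\<lambda>f. \<lambda>i\<in>I. if i \<in> J then t i (f i) else \<zero>\<^bsub>N i\<^esub>"
  have cA: "f \<in> carrier ?A \<longleftrightarrow> f \<in> (\<Pi>\<^sub>E i\<in>J. carrier (M i)) \<and> finite {i \<in> J. f i \<noteq> \<zero>\<^bsub>M i\<^esub>}" for f
    by (simp add: gdirect_sum_def Let_def)
  have cB: "f \<in> carrier ?B \<longleftrightarrow> f \<in> (\<Pi>\<^sub>E i\<in>I. carrier (N i)) \<and> finite {i \<in> I. f i \<noteq> \<zero>\<^bsub>N i\<^esub>}" for f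
    by (simp add: gdirect_sum_def Let_def)
  have hA: "f \<in> hcomp ?A d \<longleftrightarrow> f \<in> carrier ?A \<and> (\<forall>i\<in>J. f i \<in> hcomp (M i) d)" for f d
    by (auto simp: gdirect_sum_def Let_def)
  have hB: "f \<in> hcomp ?B d \<longleftrightarrow> f \<in> carrier ?B \<and> (\<forall>i\<in>I. f i \<in> hcomp (N i) d)" for f d
    by (auto simp: gdirect_sum_def Let_def)
  have tj: "t j x \<in> carrier (N j)" if "j \<in> J" "x \<in> carrier (M j)" for j x
    using bij[OF that(1)] that(2) by (auto simp: bij_betw_def)
  have tinj: "t j x = t j y \<Longrightarrow> x = y" if "j \<in> J" "x \<in> carrier (M j)" "y \<in> carrier (M j)" for j x y
    using bij[OF that(1)] that(2,3) by (auto simp: bij_betw_def dest: inj_onD)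
  have tz: "t j x = \<zero>\<^bsub>N j\<^esub> \<longleftrightarrow> x = \<zero>\<^bsub>M j\<^esub>" if "j \<in> J" "x \<in> carrier (M j)" for j x
    using tinj[OF that zero(2)[OF that(1)]] zero(1)[OF that(1)] by auto
  have into: "?t f \<in> carrier ?B" if f: "f \<in> carrier ?A" for f
    unfolding cB
  proof
    show "?t f \<in> (\<Pi>\<^sub>E i\<in>I. carrier (N i))"
    proof (rule restrict_PiE_iff[THEN iffD2], intro ballI)
      fix i assume "i \<in> I"
      then show "(if i \<in> J then t i (f i) else \<zero>\<^bsub>N i\<^esub>) \<in> carrier (N i)"
        using f tj[of i "f i"] triv(1)[of i] unfolding cA by auto
    qed
    have "{i \<in> I. ?t f i \<noteq> \<zero>\<^bsub>N i\<^esub>} \<subseteq> {i \<in> J. f i \<noteq> \<zero>\<^bsub>M i\<^esub>}"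
      using zero(1) by (auto split: if_splits)
    then show "finite {i \<in> I. ?t f i \<noteq> \<zero>\<^bsub>N i\<^esub>}" using f unfolding cA by (blast intro: finite_subset)
  qed
  have inj: "inj_on ?t (carrier ?A)"
  proof (rule inj_onI)
    fix f g assume fg: "f \<in> carrier ?A" "g \<in> carrier ?A" "?t f = ?t g"
    show "f = g"
    proof (rule PiE_ext)
      show "f \<in> (\<Pi>\<^sub>E i\<in>J. carrier (M i))" "g \<in> (\<Pi>\<^sub>E i\<in>J. carrier (M i))" using fg cA by auto
      fix j assume j: "j \<in> J"
      then have "t j (f j) = t j (g j)" using fun_cong[OF fg(3), of j] J by (auto split: if_splits)
      then show "f j = g j" using tinj[OF j] fg(1,2) j unfolding cA by auto
    qed
  qed
  have surj: "\<exists>f\<in>carrier ?A. ?t f = g" if g: "g \<in> carrier ?B" for g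
  proof -
    define f where "f = (\<lambda>j\<in>J. inv_into (carrier (M j)) (t j) (g j))"
    have gj: "g j \<in> t j ` carrier (M j)" if "j \<in> J" for j
      using g bij[OF that] that J unfolding cB bij_betw_def by auto
    have fj: "f j \<in> carrier (M j)" "t j (f j) = g j" if "j \<in> J" for j
      using inv_into_into[OF gj[OF that]] f_inv_into_f[OF gj[OF that]] that by (auto simp: f_def)
    have "f \<in> carrier ?A" unfolding cA
    proof
      show "f \<in> (\<Pi>\<^sub>E i\<in>J. carrier (M i))" using fj(1) by (auto simp: f_def)
      have "{i \<in> J. f i \<noteq> \<zero>\<^bsub>M i\<^esub>} \<subseteq> {i \<in> I. g i \<noteq> \<zero>\<^bsub>N i\<^esub>}"
      proof
        fix i assume "i \<in> {i \<in> J. f i \<noteq> \<zero>\<^bsub>M i\<^esub>}"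
        then show "i \<in> {i \<in> I. g i \<noteq> \<zero>\<^bsub>N i\<^esub>}" using fj[of i] tz[of i "f i"] J by auto
      qed
      then show "finite {i \<in> J. f i \<noteq> \<zero>\<^bsub>M i\<^esub>}" using g unfolding cB by (blast intro: finite_subset)
    qed
    moreover have "?t f = g"
    proof (rule PiE_ext[of _ I "\<lambda>i. carrier (N i)"])
      show "?t f \<in> (\<Pi>\<^sub>E i\<in>I. carrier (N i))" "g \<in> (\<Pi>\<^sub>E i\<in>I. carrier (N i))"
        using into[OF calculation] g unfolding cB by blast+
      fix i assume i: "i \<in> I"
      show "?t f i = g i"
      proof (cases "i \<in> J")
        case False
        then have "g i \<in> carrier (N i)" using g i unfolding cB by auto
        then show ?thesis using triv(1)[of i] i False by simp
      qed (use i fj(2) in auto)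
    qed
    ultimately show ?thesis by blast
  qed
  have hcm: "?t f \<in> hcomp ?B d \<longleftrightarrow> f \<in> hcomp ?A d" if f: "f \<in> carrier ?A" for f d
  proof -
    have fj: "f j \<in> carrier (M j)" if "j \<in> J" for j using f that unfolding cA by auto
    have "(\<forall>i\<in>I. ?t f i \<in> hcomp (N i) d) \<longleftrightarrow> (\<forall>j\<in>J. f j \<in> hcomp (M j) d)"
      using J hc fj triv(4) by (auto split: if_splits)
    then show ?thesis unfolding hA hB using f into[OF f] by blast
  qed
  have him: "?t ` hcomp ?A d = hcomp ?B d" for d
  proof (intro equalityI subsetI)
    fix g assume "g \<in> ?t ` hcomp ?A d"
    then show "g \<in> hcomp ?B d" using hcm hA by blast
  next
    fix g assume g: "g \<in> hcomp ?B d"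
    then obtain f where "f \<in> carrier ?A" "?t f = g" using surj hB by blast
    then show "g \<in> ?t ` hcomp ?A d" using g hcm by blast
  qed
  have hom: "graded_hom ?A ?B ?t"
    unfolding graded_hom_def
  proof (intro conjI ballI allI)
    show "?t \<in> carrier ?A \<rightarrow> carrier ?B" using into by blast
    fix f g assume fg: "f \<in> carrier ?A" "g \<in> carrier ?A"
    have fj: "f j \<in> carrier (M j)" "g j \<in> carrier (M j)" if "j \<in> J" for j using fg that unfolding cA by auto
    show "?t (f \<oplus>\<^bsub>?A\<^esub> g) = ?t f \<oplus>\<^bsub>?B\<^esub> ?t g"
      using add fj triv(2) by (auto simp: gdirect_sum_def Let_def fun_eq_iff restrict_def)
  next
    fix r f assume f: "f \<in> carrier ?A"
    have fj: "f j \<in> carrier (M j)" if "j \<in> J" for j using f that unfolding cA by auto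
    show "?t (r \<odot>\<^bsub>?A\<^esub> f) = r \<odot>\<^bsub>?B\<^esub> ?t f"
      using smult fj triv(3) by (auto simp: gdirect_sum_def Let_def fun_eq_iff restrict_def)
  next
    fix d show "?t ` hcomp ?A d \<subseteq> hcomp ?B d" using him by blast
  qed
  have "bij_betw ?t (carrier ?A) (carrier ?B)"
    using inj surj into by (auto simp: bij_betw_def)
  then show ?thesis
    unfolding strict_graded_iso_def graded_iso_def using hom him hA by blast
qed

context incidence_cw begin

abbreviation "FP \<equiv> face_poset K"
abbreviation "rk \<equiv> cell_rank K"

lemma FP_cases: "s \<in> FP \<Longrightarrow> s = {} \<or> s \<in> cells"
  by (auto simp: face_poset_def)

lemma rk_strict: assumes "s \<in> FP" "t \<in> FP" "s < t" shows "rk s < rk t"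
proof -
  have t: "t \<in> cells" using assms FP_cases by auto
  show ?thesis
  proof (cases "s = {}")
    case True
    then show ?thesis using cell_rank_cell[OF t] by (simp add: cell_rank_def)
  next
    case False
    then have s: "s \<in> cells" using assms FP_cases by auto
    then show ?thesis using proper_face_in_boundary(2)[OF t s] assms(3) by (simp add: cell_rank_cell t)
  qed
qed

lemma finite_FP_below: assumes "x \<in> FP" shows "finite {t \<in> FP. t \<le> x}"
proof -
  have "{t \<in> FP. t \<le> x} \<subseteq> insert {} {t \<in> cells. t \<subseteq> x}" by (auto simp: face_poset_def)
  moreover have "finite {t \<in> cells. t \<subseteq> x}"
    using finite_faces[of x] FP_cases[OF assms] cell_nonempty by (cases "x = {}") auto
  ultimately show ?thesis using finite_subset by blast
qed

lemma finite_layer: "x \<in> FP \<Longrightarrow> finite (layer x n)"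
  by (rule finite_subset[OF _ finite_FP_below]) (auto simp: rank_layer_def)

lemma square_zero_below:
  assumes x: "x \<in> FP" and s: "s \<in> layer x (Suc (Suc n))" and m: "m \<in> layer x n"
  shows "(\<Sum>t\<in>layer x (Suc n). coef s t * coef t m) = 0"
proof -
  have "rk s = Suc n" and sx: "s \<subseteq> x" using s by (auto simp: rank_layer_def)
  moreover from this have sc: "s \<in> cells" using s FP_cases[of s] by (auto simp: rank_layer_def cell_rank_def)
  ultimately have sub: "layer s (Suc n) \<subseteq> layer x (Suc n)" and rs: "rk s = Suc n" by (auto simp: rank_layer_def)
  have "(\<Sum>t\<in>layer x (Suc n). coef s t * coef t m) = (\<Sum>t\<in>layer s (Suc n). coef s t * coef t m)"
    by (rule sum.mono_neutral_right[OF finite_layer[OF x] sub]) (auto simp: rank_layer_def coef_def)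
  also have "\<dots> = 0"
  proof (cases "m \<subseteq> s")
    case True
    then show ?thesis using m by (intro integral_square_zero[OF sc rs]) (auto simp: rank_layer_def)
  next
    case False
    then have "coef s t * coef t m = 0" for t by (auto simp: coef_def)
    then show ?thesis by (simp only: sum.neutral_const)
  qed
  finally show ?thesis .
qed

text \<open>The two theorems on the cellular chain complex of a closed cell, with coefficients in the field.\<close>

lemma face_poset_acyclic:
  "graded_acyclic_poset FP rk (\<lambda>s t. of_int (coef s t) :: 'k::field)"
proof
  show "bot \<in> FP" by (simp add: face_poset_def)
  show "rk bot = 0" by (simp add: cell_rank_def)
  show "rk x < rk y" if "x \<in> FP" "y \<in> FP" "x < y" for x y by (rule rk_strict[OF that])
  show "finite {y \<in> FP. y \<le> x}" if "x \<in> FP" for x by (rule finite_FP_below[OF that])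
  show "y < x \<and> rk x = Suc (rk y)" if "of_int (coef x y) \<noteq> (0::'k)" for x y
    using that by (auto simp: coef_def split: if_splits)
next
  fix x y n assume x: "x \<in> FP" and xy: "rk x = Suc n" "y \<in> layer x n"
  have xc: "x \<in> cells" using FP_cases[OF x] xy(1) by (auto simp: cell_rank_def)
  from arg_cong[OF integral_square_zero[OF xc xy], of "of_int :: int \<Rightarrow> 'k"]
  show "(\<Sum>t\<in>layer x (Suc n). of_int (coef x t) * of_int (coef t y)) = (0::'k)" by simp
next
  fix x n and a :: "'x set \<Rightarrow> 'k"
  assume x: "x \<in> FP" "x \<noteq> bot"
    and cyc: "\<And>y. y \<in> layer x n \<Longrightarrow> (\<Sum>t\<in>layer x (Suc n). a t * of_int (coef t y)) = 0"
  have xc: "x \<in> cells" using FP_cases[OF x(1)] x(2) by auto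
  show "\<exists>b. \<forall>t\<in>layer x (Suc n). a t = (\<Sum>v\<in>layer x (Suc (Suc n)). b v * of_int (coef v t))"
    by (rule exact_base_change[of "layer x" coef n a])
      (fact layer_0 finite_layer[OF x(1)] square_zero_below[OF x(1)] integral_exact[OF xc] cyc)+
qed

text \<open>The isomorphism \<open>\<theta> i\<close> multiplies the generator of the homology of each cell of rank \<open>i\<close> by the
  coefficient of that cell. It commutes with the differentials summand by summand, because the
  connecting maps act on the generators by the incidence numbers.\<close>

theorem cellular_iso_poset:
  fixes m :: "'x set \<Rightarrow> nat ^ 'n::finite"
  shows "\<exists>\<theta>. (\<forall>i. strict_graded_iso (cellular_module K m i :: ('n, 'k::field, 'x set \<Rightarrow> ('n, 'k) mpol) gmod)
       (poset_module FP (cell_label K m) i) (\<theta> i)) \<and>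
     (\<forall>i\<ge>1. \<forall>f\<in>carrier (cellular_module K m i :: ('n, 'k, 'x set \<Rightarrow> ('n, 'k) mpol) gmod).
        \<theta> (i - 1) (cellular_differential K m c i f) = poset_differential FP (cell_label K m) i (\<theta> i f))"
proof -
  interpret gap: graded_acyclic_poset FP rk "\<lambda>s t. of_int (coef s t) :: 'k" by (rule face_poset_acyclic)
  let ?\<eta> = "cell_label K m"
  let ?V = "\<lambda>i a. D_space FP i a :: ('k, ('x set set \<Rightarrow>\<^sub>0 'k) set) module"
  let ?N = "\<lambda>i a. mpol_tensor (if i = 0 then 0 else ?\<eta> a) (?V i a) :: ('n, 'k, nat ^ 'n \<Rightarrow> ('x set set \<Rightarrow>\<^sub>0 'k) set) gmod"
  let ?M = "\<lambda>a. mpol_gmodule (?\<eta> a) :: ('n, 'k, ('n, 'k) mpol) gmod"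
  let ?\<tau> = "\<lambda>i a. tensor_of (gap.zclass i a) :: ('n, 'k) mpol \<Rightarrow> _"
  define \<theta> where "\<theta> = (\<lambda>i (f :: 'x set \<Rightarrow> ('n, 'k) mpol). \<lambda>a\<in>D_index FP i. if a \<in> cells_of_rank K i then ?\<tau> i a (f a) else \<zero>\<^bsub>?N i a\<^esub>)"
  have idx: "(i = 0 \<and> a = bot) \<or> (a \<in> FP \<and> a \<noteq> bot \<and> 0 < i)" if "a \<in> D_index FP i" for i a
    using that by (auto simp: D_index_def split: if_splits)
  have cyc: "cyclic_image (?V i a) (gap.zclass i a)" if "a \<in> D_index FP i" for i a
    by (rule gap.zclass_cyclic[OF idx[OF that]])
  have rank0: "cells_of_rank K 0 = {{}}" by (auto simp: cells_of_rank_def face_poset_def cell_rank_def split: if_splits)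
  have sub: "cells_of_rank K i \<subseteq> D_index FP i" for i
    using rank0 by (auto simp: D_index_def cells_of_rank_def face_poset_def cell_rank_def)
  have inj: "inj (gap.zclass i a)" if a: "a \<in> cells_of_rank K i" for i a
  proof (rule gap.zclass_inj)
    show "(i = 0 \<and> a = bot) \<or> (a \<in> FP \<and> 0 < i \<and> rk a = i)"
      using a rank0 by (cases "i = 0") (auto simp: cells_of_rank_def)
  qed
  have off: "0 < i" "rk a \<noteq> i" if "a \<in> D_index FP i - cells_of_rank K i" for i a
  proof -
    have a: "a \<in> D_index FP i" "a \<notin> cells_of_rank K i" using that by auto
    show "0 < i" using a rank0 by (cases "i = 0") (simp_all add: D_index_def)
    then show "rk a \<noteq> i" using a by (simp add: D_index_def cells_of_rank_def)
  qed
  have tcyc: "cyclic_image (mpol_tensor s (?V i a)) (?\<tau> i a)" if "a \<in> D_index FP i" for i a s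
    by (rule tensor_cyclic_image[OF cyc[OF that]])
  have const: "?\<tau> i a p = ?\<tau> i a 0" if "a \<in> D_index FP i - cells_of_rank K i" for i a p
    unfolding tensor_of_def using gap.zclass_const[OF off[OF that]] by metis
  \<comment> \<open>The label of the empty cell is \<open>1\<close>, so the special treatment of the lowest term by the poset
    sequence agrees with the general rule.\<close>
  have label0: "?\<eta> {} = 0"
  proof -
    have "{m v $ j |v. v \<in> vertices K \<and> v \<subseteq> {}} = {}" for j
      using cell_nonempty by (auto simp: vertices_def)
    then show ?thesis unfolding cell_label_def by (simp add: vec_eq_iff)
  qed
  have iso: "strict_graded_iso (cellular_module K m i) (poset_module FP ?\<eta> i) (\<theta> i)" for i
    unfolding cellular_module_def poset_module_def \<theta>_def
  proof (rule gdirect_sum_iso[OF sub])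
    fix a assume a: "a \<in> cells_of_rank K i"
    then have aD: "a \<in> D_index FP i" using sub by blast
    note T = tcyc[OF aD]
    have i0: "(if i = 0 then 0 else ?\<eta> a) = ?\<eta> a" using a rank0 label0 by (cases "i = 0") auto
    show "bij_betw (?\<tau> i a) (carrier (?M a)) (carrier (?N i a))"
      using tensor_inj[OF inj[OF a]] cyclic_image.carrier_eq[OF T]
      by (auto simp: bij_betw_def mpol_gmodule_def)
    show "?\<tau> i a \<zero>\<^bsub>?M a\<^esub> = \<zero>\<^bsub>?N i a\<^esub>" "\<zero>\<^bsub>?M a\<^esub> \<in> carrier (?M a)"
      using cyclic_image.zero_eq[OF T] by (auto simp: mpol_gmodule_def)
    show "?\<tau> i a (x \<oplus>\<^bsub>?M a\<^esub> y) = ?\<tau> i a x \<oplus>\<^bsub>?N i a\<^esub> ?\<tau> i a y" for x y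
      using cyclic_image.add_eq[OF T] by (simp add: mpol_gmodule_def)
    show "?\<tau> i a (r \<odot>\<^bsub>?M a\<^esub> x) = r \<odot>\<^bsub>?N i a\<^esub> ?\<tau> i a x" for r x
      using cyclic_image.smult_eq[OF T] by (simp add: mpol_gmodule_def)
    show "?\<tau> i a x \<in> hcomp (?N i a) d \<longleftrightarrow> x \<in> hcomp (?M a) d" for x d
      unfolding i0 by (rule tensor_hcomp[OF cyc[OF aD] inj[OF a]])
  next
    fix a assume a: "a \<in> D_index FP i - cells_of_rank K i"
    then have aD: "a \<in> D_index FP i" by blast
    note T = tcyc[OF aD, of "if i = 0 then 0 else ?\<eta> a"]
    have all: "?\<tau> i a p = \<zero>\<^bsub>?N i a\<^esub>" for p
      using const[OF a, of p] cyclic_image.zero_eq[OF T] by simp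
    show car: "carrier (?N i a) = {\<zero>\<^bsub>?N i a\<^esub>}"
      unfolding cyclic_image.carrier_eq[OF T] using all by auto
    show "\<zero>\<^bsub>?N i a\<^esub> \<oplus>\<^bsub>?N i a\<^esub> \<zero>\<^bsub>?N i a\<^esub> = \<zero>\<^bsub>?N i a\<^esub>"
      using cyclic_image.add_eq[OF T, of 0 0] all by simp
    show "r \<odot>\<^bsub>?N i a\<^esub> \<zero>\<^bsub>?N i a\<^esub> = \<zero>\<^bsub>?N i a\<^esub>" for r
      using cyclic_image.smult_eq[OF T, of r 0] all by simp
    have "\<zero>\<^bsub>?N i a\<^esub> \<in> carrier (?N i a)" using car by simp
    then show "\<zero>\<^bsub>?N i a\<^esub> \<in> hcomp (?N i a) d" for d
      by (auto simp: mpol_tensor_def Let_def)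
  qed
  have comm: "\<theta> (i - 1) (cellular_differential K m c i f) = poset_differential FP ?\<eta> i (\<theta> i f)" if i: "i \<ge> 1" for i f
  proof (rule ext)
    fix l
    show "\<theta> (i - 1) (cellular_differential K m c i f) l = poset_differential FP ?\<eta> i (\<theta> i f) l"
    proof (cases "l \<in> D_index FP (i - 1)")
      case False
      then show ?thesis by (simp add: \<theta>_def poset_differential_def)
    next
      case l: True
      let ?s = "if i = 1 then 0 else ?\<eta> l"
      let ?T = "mpol_tensor ?s (?V (i - 1) l) :: ('n, 'k, nat ^ 'n \<Rightarrow> ('x set set \<Rightarrow>\<^sub>0 'k) set) gmod"
      let ?mm = "\<lambda>a. if i = 1 then ?\<eta> a else ?\<eta> a - ?\<eta> l"
      define A where "A = {a \<in> D_index FP i. (i = 1 \<or> covers_in FP a l) \<and> \<theta> i f a \<noteq> (\<lambda>_. \<zero>\<^bsub>?V i a\<^esub>)}"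
      have zero: "\<theta> i f a = (\<lambda>_. \<zero>\<^bsub>?V i a\<^esub>) \<longleftrightarrow> a \<notin> cells_of_rank K i \<or> f a = 0" if a: "a \<in> D_index FP i" for a
      proof -
        have z: "(\<lambda>_. \<zero>\<^bsub>?V i a\<^esub>) = ?\<tau> i a 0" "\<zero>\<^bsub>?N i a\<^esub> = ?\<tau> i a 0"
          using cyclic_image.zero_eq[OF cyc[OF a]] by (auto simp: tensor_of_def mpol_tensor_def Let_def fun_eq_iff)
        show ?thesis
        proof (cases "a \<in> cells_of_rank K i")
          case True
          then have "\<theta> i f a = ?\<tau> i a (f a)" using a by (simp add: \<theta>_def)
          then show ?thesis unfolding z(1) using True by (auto dest: injD[OF tensor_inj[OF inj[OF True]]])
        next
          case False
          then have "\<theta> i f a = \<zero>\<^bsub>?N i a\<^esub>" using a by (simp add: \<theta>_def)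
          then show ?thesis unfolding z using False by simp
        qed
      qed
      have A: "A = {a \<in> cells_of_rank K i. (i = 1 \<or> covers_in FP a l) \<and> f a \<noteq> 0}"
        unfolding A_def using zero sub by blast
      have trm: "xpow_tensor (?V (i - 1) l) (?mm a) (D_map FP i a l) (\<theta> i f a)
         = ?\<tau> (i - 1) l (f a * single (?mm a) (of_int (coef a l)))" if a: "a \<in> A" for a
      proof -
        have ar: "a \<in> cells_of_rank K i" "i = 1 \<or> covers_in FP a l" using a A by auto
        then have aP: "a \<in> FP" "rk a = i" by (auto simp: cells_of_rank_def)
        have map: "D_map FP i a l (gap.zclass i a x) = gap.zclass (i - 1) l (x * of_int (coef a l))" for x
        proof (cases "i = 1")
          case True
          then have "l = bot" using l by (simp add: D_index_def)
          then show ?thesis using gap.D_map_zclass_1[of a x] aP True by simp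
        next
          case False
          then show ?thesis using gap.D_map_zclass[of a i l x] aP ar(2) i by simp
        qed
        have "\<theta> i f a = ?\<tau> i a (f a)" using ar(1) sub by (auto simp: \<theta>_def)
        then show ?thesis using xpow_tensor_of[OF cyc[OF l], of "D_map FP i a l" "gap.zclass i a" "of_int (coef a l)" "?mm a" "f a"] map by simp
      qed
      have "poset_differential FP ?\<eta> i (\<theta> i f) l = finsum ?T (\<lambda>a. xpow_tensor (?V (i - 1) l) (?mm a) (D_map FP i a l) (\<theta> i f a)) A"
        using l by (simp add: poset_differential_def A_def)
      also have "\<dots> = ?\<tau> (i - 1) l (\<Sum>a\<in>A. f a * single (?mm a) (of_int (coef a l)))"
        by (rule cyclic_image.finsum_cong_eq[OF tcyc[OF l]]) (rule trm)
      also have "\<dots> = \<theta> (i - 1) (cellular_differential K m c i f) l"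
      proof (cases "l \<in> cells_of_rank K (i - 1)")
        case True
        then have lr: "rk l = i - 1" "l \<in> FP" by (auto simp: cells_of_rank_def)
        have cov: "(i = 1 \<or> covers_in FP a l) \<longleftrightarrow> l \<subset> a" if a: "a \<in> cells_of_rank K i" for a
        proof -
          have aP: "a \<in> FP" "rk a = i" using a by (auto simp: cells_of_rank_def)
          show ?thesis
          proof
            assume "i = 1 \<or> covers_in FP a l"
            then show "l \<subset> a"
            proof
              assume "i = 1"
              then have "l = {}" using l by (simp add: D_index_def)
              moreover have "a \<noteq> {}" using aP i by (auto simp: cell_rank_def)
              ultimately show ?thesis by blast
            qed (auto simp: covers_in_def)
          next
            assume "l \<subset> a"
            then have "l \<in> gap.lcovers a" using aP lr i by (auto simp: gap.lcovers_def)
            then show "i = 1 \<or> covers_in FP a l" using gap.covers_rank[OF aP(1)] by blast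
          qed
        qed
        have A': "A = {a \<in> cells_of_rank K i. l \<subset> a \<and> f a \<noteq> 0}" unfolding A using cov by blast
        have "(\<Sum>a\<in>A. f a * single (?mm a) (of_int (coef a l)))
           = (\<Sum>a\<in>{a \<in> cells_of_rank K i. l \<subset> a \<and> f a \<noteq> 0}. f a * single (?\<eta> a - ?\<eta> l) (of_int (c a l)))"
          unfolding A'
        proof (rule sum.cong[OF refl])
          fix a assume a: "a \<in> {a \<in> cells_of_rank K i. l \<subset> a \<and> f a \<noteq> 0}"
          have "coef a l = c a l" using a lr i by (auto simp: coef_def cells_of_rank_def)
          moreover have "?mm a = ?\<eta> a - ?\<eta> l"
          proof (cases "i = 1")
            case True
            then have "l = {}" using l by (simp add: D_index_def)
            then show ?thesis using True label0 by (simp add: vec_eq_iff)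
          qed simp
          ultimately show "f a * single (?mm a) (of_int (coef a l)) = f a * single (?\<eta> a - ?\<eta> l) (of_int (c a l))"
            by (simp only:)
        qed
        then show ?thesis using True l by (simp add: \<theta>_def cellular_differential_def)
      next
        case False
        then have "l \<in> D_index FP (i - 1) - cells_of_rank K (i - 1)" using l by blast
        from const[OF this] have "?\<tau> (i - 1) l p = ?\<tau> (i - 1) l 0" for p .
        moreover have "\<zero>\<^bsub>?N (i - 1) l\<^esub> = ?\<tau> (i - 1) l 0" by (rule cyclic_image.zero_eq[OF tcyc[OF l]])
        ultimately show ?thesis using False l by (simp add: \<theta>_def)
      qed
      finally show ?thesis by simp
    qed
  qed
  show ?thesis using iso comm by blast
qed

end

lemma carrier_cellular_module:
  fixes f :: "'x set \<Rightarrow> ('n::finite, 'k::field) mpol"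
  shows "f \<in> carrier (cellular_module K m i) \<longleftrightarrow> f \<in> extensional (cells_of_rank K i) \<and> finite {s \<in> cells_of_rank K i. f s \<noteq> 0}"
  by (auto simp: cellular_module_def gdirect_sum_def Let_def mpol_gmodule_def PiE_def)

lemma cellular_module_closed:
  fixes K :: "'x cell_complex" and m :: "'x set \<Rightarrow> nat ^ 'n::finite"
  defines "A \<equiv> \<lambda>i. cellular_module K m i :: ('n, 'k::field, 'x set \<Rightarrow> ('n, 'k) mpol) gmod"
  shows "x \<in> carrier (A i) \<Longrightarrow> y \<in> carrier (A i) \<Longrightarrow> x \<oplus>\<^bsub>A i\<^esub> y \<in> carrier (A i)" "x \<in> carrier (A i) \<Longrightarrow> r \<odot>\<^bsub>A i\<^esub> x \<in> carrier (A i)"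
proof -
  let ?C = "cells_of_rank K i"
  have "{s \<in> ?C. (\<lambda>s\<in>?C. x s + y s) s \<noteq> 0} \<subseteq> {s \<in> ?C. x s \<noteq> 0} \<union> {s \<in> ?C. y s \<noteq> 0}" by auto
  note fin = finite_subset[OF this]
  have eq: "x \<oplus>\<^bsub>A i\<^esub> y = (\<lambda>s\<in>?C. x s + y s)"
    by (simp add: A_def cellular_module_def gdirect_sum_def Let_def mpol_gmodule_def)
  show "x \<oplus>\<^bsub>A i\<^esub> y \<in> carrier (A i)" if "x \<in> carrier (A i)" "y \<in> carrier (A i)"
    using that fin restrict_extensional unfolding eq unfolding A_def carrier_cellular_module by blast
  have "{s \<in> ?C. (\<lambda>s\<in>?C. r * x s) s \<noteq> 0} \<subseteq> {s \<in> ?C. x s \<noteq> 0}" by auto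
  note fin = finite_subset[OF this]
  have eq: "r \<odot>\<^bsub>A i\<^esub> x = (\<lambda>s\<in>?C. r * x s)"
    by (simp add: A_def cellular_module_def gdirect_sum_def Let_def mpol_gmodule_def)
  show "r \<odot>\<^bsub>A i\<^esub> x \<in> carrier (A i)" if "x \<in> carrier (A i)"
    using that fin restrict_extensional unfolding eq unfolding A_def carrier_cellular_module by blast
qed

text \<open>The complex may have infinitely many cells. Supports stay finite because a cell has finitely
  many faces.\<close>

lemma (in regular_cw) cellular_differential_closed:
  fixes f :: "'x set \<Rightarrow> ('n::finite, 'k::field) mpol"
  assumes f: "f \<in> carrier (cellular_module K m i)" and i: "i \<ge> 1"
  shows "cellular_differential K m c i f \<in> carrier (cellular_module K m (i - 1))"
proof -
  let ?S = "{s \<in> cells_of_rank K i. f s \<noteq> 0}" and ?g = "cellular_differential K m c i f"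
  have "{t \<in> cells_of_rank K (i - 1). ?g t \<noteq> 0} \<subseteq> (\<Union>s\<in>?S. insert {} {t \<in> cells. t \<subseteq> s})"
  proof
    fix t assume t: "t \<in> {t \<in> cells_of_rank K (i - 1). ?g t \<noteq> 0}"
    have "{s \<in> cells_of_rank K i. t \<subset> s \<and> f s \<noteq> 0} \<noteq> {}"
    proof
      assume "{s \<in> cells_of_rank K i. t \<subset> s \<and> f s \<noteq> 0} = {}"
      then have "?g t = 0" using t by (simp only: cellular_differential_def mem_Collect_eq restrict_apply' sum.empty)
      then show False using t by simp
    qed
    then obtain s where "s \<in> ?S" "t \<subset> s" by blast
    then show "t \<in> (\<Union>s\<in>?S. insert {} {t \<in> cells. t \<subseteq> s})"
      using t by (auto simp: cells_of_rank_def face_poset_def)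
  qed
  moreover have "finite (\<Union>s\<in>?S. insert {} {t \<in> cells. t \<subseteq> s})"
  proof (rule finite_UN_I)
    show "finite ?S" using f unfolding carrier_cellular_module by blast
    fix s assume "s \<in> ?S"
    then have "s \<in> cells" using i by (auto simp: cells_of_rank_def face_poset_def cell_rank_def)
    then show "finite (insert {} {t \<in> cells. t \<subseteq> s})" using finite_faces by simp
  qed
  ultimately have "finite {t \<in> cells_of_rank K (i - 1). ?g t \<noteq> 0}" by (rule finite_subset)
  then show ?thesis unfolding carrier_cellular_module by (simp add: cellular_differential_def)
qed

lemma isomorphic_sequences_trans:
  assumes "isomorphic_sequences F d G e" "isomorphic_sequences G e L h"
  shows "isomorphic_sequences F d L h"
proof -
  obtain f where f: "\<And>i. graded_iso (F i) (G i) (f i)" "\<And>i x. i \<ge> 1 \<Longrightarrow> x \<in> carrier (F i) \<Longrightarrow> f (i - 1) (d i x) = e i (f i x)"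
    using assms(1) unfolding isomorphic_sequences_def by blast
  obtain g where g: "\<And>i. graded_iso (G i) (L i) (g i)" "\<And>i x. i \<ge> 1 \<Longrightarrow> x \<in> carrier (G i) \<Longrightarrow> g (i - 1) (e i x) = h i (g i x)"
    using assms(2) unfolding isomorphic_sequences_def by blast
  show ?thesis unfolding isomorphic_sequences_def
  proof (intro exI[of _ "\<lambda>i. g i \<circ> f i"] conjI allI impI ballI)
    fix i
    have "bij_betw (g i \<circ> f i) (carrier (F i)) (carrier (L i))"
      using f(1)[of i] g(1)[of i] bij_betw_trans unfolding graded_iso_def by blast
    moreover have "graded_hom (F i) (L i) (g i \<circ> f i)"
      using f(1)[of i] g(1)[of i] unfolding graded_iso_def graded_hom_def by (auto simp: Pi_iff image_subset_iff)
    ultimately show "graded_iso (F i) (L i) (g i \<circ> f i)" by (simp add: graded_iso_def)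
  next
    fix i x assume i: "(1::nat) \<le> i" and x: "x \<in> carrier (F i)"
    have "f i x \<in> carrier (G i)" using f(1)[of i] x by (auto simp: graded_iso_def bij_betw_def)
    then show "(g (i - 1) \<circ> f (i - 1)) (d i x) = h i ((g i \<circ> f i) x)"
      using f(2)[OF i x] g(2)[OF i] by simp
  qed
qed

lemma strict_graded_iso_inverse:
  assumes g: "strict_graded_iso A B g"
    and closed: "\<And>x y. x \<in> carrier A \<Longrightarrow> y \<in> carrier A \<Longrightarrow> x \<oplus>\<^bsub>A\<^esub> y \<in> carrier A" "\<And>r x. x \<in> carrier A \<Longrightarrow> r \<odot>\<^bsub>A\<^esub> x \<in> carrier A"
  shows "graded_iso B A (inv_into (carrier A) g)"
proof -
  let ?h = "inv_into (carrier A) g"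
  have bij: "bij_betw g (carrier A) (carrier B)" and hom: "graded_hom A B g"
    and hc: "\<And>d. hcomp A d \<subseteq> carrier A" "\<And>d. g ` hcomp A d = hcomp B d"
    using g by (auto simp: strict_graded_iso_def graded_iso_def)
  have hg: "?h (g x) = x" if "x \<in> carrier A" for x using bij that by (simp add: bij_betw_def)
  have hB: "?h y \<in> carrier A" "g (?h y) = y" if "y \<in> carrier B" for y
    using bij that by (auto simp: bij_betw_def intro: inv_into_into f_inv_into_f)
  have "graded_hom B A ?h"
    unfolding graded_hom_def
  proof (intro conjI ballI allI)
    show "?h \<in> carrier B \<rightarrow> carrier A" using hB by blast
    fix x y assume xy: "x \<in> carrier B" "y \<in> carrier B"
    have "x \<oplus>\<^bsub>B\<^esub> y = g (?h x \<oplus>\<^bsub>A\<^esub> ?h y)" using hom hB xy unfolding graded_hom_def by auto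
    then show "?h (x \<oplus>\<^bsub>B\<^esub> y) = ?h x \<oplus>\<^bsub>A\<^esub> ?h y" using hg closed(1) hB xy by simp
  next
    fix r x assume x: "x \<in> carrier B"
    have "r \<odot>\<^bsub>B\<^esub> x = g (r \<odot>\<^bsub>A\<^esub> ?h x)" using hom hB x unfolding graded_hom_def by auto
    then show "?h (r \<odot>\<^bsub>B\<^esub> x) = r \<odot>\<^bsub>A\<^esub> ?h x" using hg closed(2) hB x by simp
  next
    fix d show "?h ` hcomp B d \<subseteq> hcomp A d"
      using hg hc(1)[of d] unfolding hc(2)[symmetric] by force
  qed
  then show ?thesis using bij_betw_inv_into[OF bij] by (simp add: graded_iso_def)
qed

theorem (in incidence_cw) cellular_poset_isomorphic:
  fixes m :: "'x set \<Rightarrow> nat ^ 'n::finite"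
  defines "A \<equiv> \<lambda>i. cellular_module K m i :: ('n, 'k::field, 'x set \<Rightarrow> ('n, 'k) mpol) gmod"
    and "B \<equiv> poset_module (face_poset K) (cell_label K m)"
    and "dA \<equiv> cellular_differential K m c" and "dB \<equiv> poset_differential (face_poset K) (cell_label K m)"
  shows "isomorphic_sequences A dA B dB" "isomorphic_sequences B dB A dA"
proof -
  obtain \<theta> where \<theta>: "\<And>i. strict_graded_iso (A i) (B i) (\<theta> i)"
    "\<And>i f. i \<ge> 1 \<Longrightarrow> f \<in> carrier (A i) \<Longrightarrow> \<theta> (i - 1) (dA i f) = dB i (\<theta> i f)"
    using cellular_iso_poset[of m] unfolding A_def B_def dA_def dB_def by blast
  have iso: "graded_iso (A i) (B i) (\<theta> i)" for i using \<theta>(1)[of i] by (simp add: strict_graded_iso_def)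
  then have bij: "bij_betw (\<theta> i) (carrier (A i)) (carrier (B i))" for i by (simp add: graded_iso_def)
  show "isomorphic_sequences A dA B dB"
    unfolding isomorphic_sequences_def using iso \<theta>(2) by blast
  let ?h = "\<lambda>i. inv_into (carrier (A i)) (\<theta> i)"
  show "isomorphic_sequences B dB A dA"
    unfolding isomorphic_sequences_def
  proof (intro exI[of _ ?h] conjI allI impI ballI)
    show "graded_iso (B i) (A i) (?h i)" for i
      by (rule strict_graded_iso_inverse[OF \<theta>(1)]) (unfold A_def, rule cellular_module_closed; assumption)+
    fix i y assume i: "(1::nat) \<le> i" and y: "y \<in> carrier (B i)"
    have hy: "?h i y \<in> carrier (A i)" "\<theta> i (?h i y) = y"
      using inv_into_into[of y "\<theta> i"] f_inv_into_f[of y "\<theta> i"] bij[of i] y unfolding bij_betw_def by auto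
    have "dA i (?h i y) \<in> carrier (A (i - 1))"
      using cellular_differential_closed[OF _ i] hy(1) unfolding A_def dA_def by blast
    then show "?h (i - 1) (dB i y) = dA i (?h i y)"
      using \<theta>(2)[OF i hy(1)] hy(2) bij[of "i - 1"] unfolding bij_betw_def by (metis inv_into_f_f)
  qed
qed

theorem theorem2p2:
  fixes N :: "('n::finite, 'k::field) mpol set"
    and F :: "nat \<Rightarrow> (('n, 'k) mpol, 'm, int ^ 'n) gmodule"
    and d :: "nat \<Rightarrow> 'm \<Rightarrow> 'm"
    and K :: "'x cell_complex"
    and m :: "'x set \<Rightarrow> nat ^ 'n"
  assumes "monomial_ideal N"
    and "graded_free_resolution N F d"
    and "regular_cw_complex K"
    and "topspace (cw_space K) \<noteq> {}"
    and "\<exists>b. \<forall>\<sigma>\<in>cw_cells K. cw_dim K \<sigma> \<le> b"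
    and "inj_on m (vertices K)"
    and "minimal_monomial_generators N (m ` vertices K)"
  shows "supported_on_cw_complex K m F d \<longleftrightarrow>
         poset_resolution_on (face_poset K) (cell_label K m) F d"
proof
  assume "supported_on_cw_complex K m F d"
  then obtain \<omega> c where oc: "orientation K \<omega>" "incidence_numbers K \<omega> c"
    and F: "isomorphic_sequences F d (cellular_module K m) (cellular_differential K m c)"
    unfolding supported_on_cw_complex_def by blast
  interpret incidence_cw K \<omega> c by unfold_locales (use assms oc in auto)
  show "poset_resolution_on (face_poset K) (cell_label K m) F d"
    unfolding poset_resolution_on_def by (rule isomorphic_sequences_trans[OF F cellular_poset_isomorphic(1)])
next
  assume "poset_resolution_on (face_poset K) (cell_label K m) F d"
  then have F: "isomorphic_sequences F d (poset_module (face_poset K) (cell_label K m)) (poset_differential (face_poset K) (cell_label K m))"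
    unfolding poset_resolution_on_def .
  interpret regular_cw K by unfold_locales (rule assms(3))
  obtain \<omega> where om: "orientation K \<omega>" using exists_orientation by blast
  interpret oriented_cw K \<omega> by unfold_locales (rule om)
  obtain c where c: "incidence_numbers K \<omega> c" using exists_incidence by blast
  interpret incidence_cw K \<omega> c by unfold_locales (rule c)
  show "supported_on_cw_complex K m F d"
    unfolding supported_on_cw_complex_def
    using om c isomorphic_sequences_trans[OF F cellular_poset_isomorphic(2)] by blast
qed

end
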